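(* Let $k<n$ be integers with $k\ge2$, let $\mu<\lambda$ be infinite cardinals, and suppose $\operatorname{Pr}_{n,k}(\lambda,\mu)$ holds. Let $T=T_{n,k}$ and let $\mathcal{D}$ be a $(\lambda,\mu)$-perfected ultrafilter on a set $I$ with $|I|=\lambda$. Then $\mathcal{D}$ is good for $T$, i.e. for every $M\models T$, $M^I/\mathcal{D}$ is $\lambda^+$-saturated.
   Context: $T_{n,k}$ ($n>k\ge2$): model completion of the theory with one symmetric irreflexive $(k+1)$-ary relation $R$ and no complete $R$-hypergraph on $n+1$ vertices. $\operatorname{Pr}_{n,k}(\lambda,\mu)$: there is $G:[\lambda]^{<\aleph_0}\to\mu$ such that whenever $w\in[\lambda]^n$ and $\langle u_v:v\in[w]^k\rangle$ are finite subsets of $\lambda$ with $v\subseteq u_v$ for each $v$, and $G$ is constant on $\{u_v:v\in[w]^k\}$, then $w\subseteq u_v$ for some $v\in[w]^k$. $\operatorname{FI}_\mu(\alpha)$: finite partial functions $\alpha\to\mu$; $\mathfrak{B}^1_{\alpha,\mu}$: completion of the Boolean algebra freely generated by $\mathbf{x}_f$ ($f\in\operatorname{FI}_\mu(\alpha)$) with $\mathbf{x}_{f_2}\le\mathbf{x}_{f_1}$ for $f_1\subseteq f_2$ and $\mathbf{x}_f\cap\mathbf{x}_{f'}\ne0$ iff $f,f'$ compatible; $\mathfrak{B}^1_{\beta,\mu}$ for $\beta\le\alpha$ is the complete subalgebra generated by $\mathbf{x}_f$ with $\operatorname{dom}f\subseteq\beta$; $^+$ denotes nonzero elements. Built from: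 an ultrafilter $\mathcal{D}$ on $I$ is built from $(\mathcal{D}_0,\mathfrak{B},\mathcal{D}_* )$ if $\mathcal{D}_0$ is a regular $|I|^+$-excellent filter on $I$ (regular and good suffices), $\mathcal{D}_*$ an ultrafilter on the Boolean algebra $\mathfrak{B}$, and there is a surjective homomorphism $\mathbf{j}:\mathcal{P}(I)\to\mathfrak{B}$ with $\mathcal{D}_0=\mathbf{j}^{-1}(\{1\})$, $\mathcal{D}=\{A:\mathbf{j}(A)\in\mathcal{D}_*\}$. Perfect: for $\bar{\mathbf{b}}=\langle\mathbf{b}_u:u\in[\lambda]^{<\aleph_0}\rangle$ in $\mathfrak{B}=\mathfrak{B}^1_{2^\lambda,\mu}$, a support is a set $X\subseteq\{\mathbf{x}_f\}$ such that for each $u$ some maximal antichain consists of elements of $X$ each $\le\mathbf{b}_u$ or $\le1-\mathbf{b}_u$; multiplicative means $\mathbf{b}'_{u_1\cup u_2}=\mathbf{b}'_{u_1}\cap\mathbf{b}'_{u_2}$. An ultrafilter $\mathcal{D}_*$ on $\mathfrak{B}$ is $(\lambda,\mu)$-perfect if (A) implies (B): (A) $\bar{\mathbf{b}}$ is a monotonic ($u\subseteq v\Rightarrow\mathbf{b}_v\le\mathbf{b}_u$) sequence of elements of $\mathcal{D}_*$ with a support of size $\le\lambda$ such that for every $\alpha<2^\lambda$ containing the domains of all $f$ with $\mathbf{x}_f$ in the support there is a multiplicative $\langle\mathbf{b}'_u\rangle$ in $\mathfrak{B}^+$ with $\mathbf{b}'_u\le\mathbf{b}_u$ such that for every $\mathbf{c}\in\mathfrak{B}^+_{\alpha,\mu}\cap\mathcal{D}_*$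 no finite intersection of members of $\{\mathbf{b}'_{\{i\}}\cup(1-\mathbf{b}_{\{i\}}):i<\lambda\}$ is disjoint from $\mathbf{c}$; (B) some multiplicative sequence of elements of $\mathcal{D}_*$ refines $\bar{\mathbf{b}}$. Perfected: $\mathcal{D}$ on $I$, $|I|=\lambda$, is $(\lambda,\mu)$-perfected if it is built from $(\mathcal{D}_0,\mathfrak{B}^1_{2^\lambda,\mu},\mathcal{D}_* )$ with $\mathcal{D}_0$ a regular filter on $I$ and $\mathcal{D}_*$ $(\lambda,\mu)$-perfect. *)

theory Defs
  imports Complex_Main "HOL-Library.FuncSet"
begin

unbundle cardinal_syntax

text \<open>
  Cardinals \<open>\<lambda>\<close> and \<open>\<mu>\<close> are given as types \<open>'l\<close> and \<open>'c\<close>, so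
  the finite subsets of \<open>\<lambda>\<close> are the finite sets of type \<open>'l set\<close> and \<open>2\<^sup>\<lambda>\<close> is the cardinality of
  the type \<open>'l set\<close>. Families indexed by finite sets are total functions on sets of which
  only the values at finite sets matter.
\<close>

section \<open>First-order logic with one relation symbol\<close>

datatype fm =
    Fls
  | Eq nat nat
  | Rel "nat list"
  | Imp fm fm
  | All nat fm

primrec fv :: "fm \<Rightarrow> nat set" where
  "fv Fls = {}"
| "fv (Eq i j) = {i, j}"
| "fv (Rel xs) = set xs"
| "fv (Imp p q) = fv p \<union> fv q"
| "fv (All i p) = fv p - {i}"

primrec wf_fm :: "nat \<Rightarrow> fm \<Rightarrow> bool" where
  "wf_fm r Fls \<longleftrightarrow> True"
| "wf_fm r (Eq i j) \<longleftrightarrow> True"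
| "wf_fm r (Rel xs) \<longleftrightarrow> length xs = r"
| "wf_fm r (Imp p q) \<longleftrightarrow> wf_fm r p \<and> wf_fm r q"
| "wf_fm r (All i p) \<longleftrightarrow> wf_fm r p"

record 'm rstruct =
  univ :: "'m set"
  rel :: "'m list set"

definition is_rstruct :: "nat \<Rightarrow> 'm rstruct \<Rightarrow> bool" where
  "is_rstruct r M \<longleftrightarrow> univ M \<noteq> {} \<and> rel M \<subseteq> {xs. length xs = r \<and> set xs \<subseteq> univ M}"

primrec sat :: "'m rstruct \<Rightarrow> (nat \<Rightarrow> 'm) \<Rightarrow> fm \<Rightarrow> bool" where
  "sat M v Fls \<longleftrightarrow> False"
| "sat M v (Eq i j) \<longleftrightarrow> v i = v j"
| "sat M v (Rel xs) \<longleftrightarrow> map v xs \<in> rel M"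
| "sat M v (Imp p q) \<longleftrightarrow> (sat M v p \<longrightarrow> sat M v q)"
| "sat M v (All i p) \<longleftrightarrow> (\<forall>a\<in>univ M. sat M (v(i := a)) p)"

definition sentences :: "nat \<Rightarrow> fm set" where
  "sentences r = {p. wf_fm r p \<and> fv p = {}}"

definition models :: "nat \<Rightarrow> 'm rstruct \<Rightarrow> fm set \<Rightarrow> bool" where
  "models r M T \<longleftrightarrow> is_rstruct r M \<and>
     (\<forall>p\<in>T. \<forall>v. range v \<subseteq> univ M \<longrightarrow> sat M v p)"

definition embedding :: "nat \<Rightarrow> ('m \<Rightarrow> 'n) \<Rightarrow> 'm rstruct \<Rightarrow> 'n rstruct \<Rightarrow> bool" where
  "embedding r e M N \<longleftrightarrow> inj_on e (univ M) \<and> e ` univ M \<subseteq> univ N \<and>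
     (\<forall>xs. length xs = r \<and> set xs \<subseteq> univ M \<longrightarrow> (xs \<in> rel M \<longleftrightarrow> map e xs \<in> rel N))"

text \<open>
  \<open>T\<close> is a model completion of \<open>T0\<close>: \<open>T\<close> extends \<open>T0\<close>, every model of \<open>T0\<close> embeds into a model
  of \<open>T\<close>, and \<open>T\<close> together with the diagram of any model of \<open>T0\<close> is complete. (A model of
  \<open>T \<union> Diag A\<close> is a model of \<open>T\<close> with an embedding of \<open>A\<close>.) A definition cannot quantify over all
  types, so the structures considered live on subsets of one type \<open>'u\<close>. As the
  language is finite, the Loewenheim-Skolem theorems show that the notion is the same for all
  infinite \<open>'u\<close>.
\<close>

definition model_completion :: "'u itself \<Rightarrow> nat \<Rightarrow> fm set \<Rightarrow> fm set \<Rightarrow> bool" where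
  "model_completion (_ :: 'u itself) r T T0 \<longleftrightarrow>
     T \<subseteq> sentences r \<and>
     (\<forall>A :: 'u rstruct. models r A T \<longrightarrow> models r A T0) \<and>
     (\<forall>A :: 'u rstruct. models r A T0 \<longrightarrow>
        (\<exists>(B :: 'u rstruct) e. models r B T \<and> embedding r e A B)) \<and>
     (\<forall>(A :: 'u rstruct) (B1 :: 'u rstruct) (B2 :: 'u rstruct) e1 e2.
        models r A T0 \<and> models r B1 T \<and> models r B2 T \<and>
        embedding r e1 A B1 \<and> embedding r e2 A B2 \<longrightarrow>
        (\<forall>p v. wf_fm r p \<and> range v \<subseteq> univ A \<longrightarrow> (sat B1 (e1 \<circ> v) p \<longleftrightarrow> sat B2 (e2 \<circ> v) p)))"

definition alls :: "nat \<Rightarrow> fm \<Rightarrow> fm" where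
  "alls m p = foldr All [0..<m] p"

text \<open>
  Symmetry, irreflexivity (a related tuple has no repetition), and: there are no \<open>n + 1\<close> distinct
  vertices all of whose \<open>(k + 1)\<close>-element subsets are related. The elements of
  \<open>subseqs [0..<n+1]\<close> are the strictly increasing lists below \<open>n + 1\<close>.
\<close>

definition hypergraph_theory :: "nat \<Rightarrow> nat \<Rightarrow> fm set" where
  "hypergraph_theory n k =
     {alls (k+1) (Imp (Rel [0..<k+1]) (Rel xs)) | xs. distinct xs \<and> set xs = {0..<k+1}} \<union>
     {alls (k+1) (Imp (Rel [0..<k+1]) (Imp (Eq i j) Fls)) | i j. i < j \<and> j < k+1} \<union>
     {alls (n+1) (foldr Imp
        (concat (map (\<lambda>j. map (\<lambda>i. Imp (Eq i j) Fls) [0..<j]) [0..<n+1]) @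
         map Rel (filter (\<lambda>xs. length xs = k+1) (subseqs [0..<n+1]))) Fls)}"

text \<open>
  A set of formulas in the variable \<open>0\<close> with parameters in \<open>A\<close> is a set of pairs \<open>(p, v)\<close>, where
  \<open>v\<close> interprets the free variables of \<open>p\<close> other than \<open>0\<close> by elements of \<open>A\<close>.
\<close>

definition is_type_over :: "nat \<Rightarrow> 'm rstruct \<Rightarrow> 'm set \<Rightarrow> (fm \<times> (nat \<Rightarrow> 'm)) set \<Rightarrow> bool" where
  "is_type_over r M A P \<longleftrightarrow>
     (\<forall>(p, v)\<in>P. wf_fm r p \<and> v ` (fv p - {0}) \<subseteq> A) \<and>
     (\<forall>Q\<subseteq>P. finite Q \<longrightarrow> (\<exists>a\<in>univ M. \<forall>(p, v)\<in>Q. sat M (v(0 := a)) p))"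

definition saturated :: "nat \<Rightarrow> 'k rel \<Rightarrow> 'm rstruct \<Rightarrow> bool" where
  "saturated r \<kappa> M \<longleftrightarrow>
     (\<forall>A P. A \<subseteq> univ M \<and> |A| <o \<kappa> \<and> is_type_over r M A P \<longrightarrow>
        (\<exists>a\<in>univ M. \<forall>(p, v)\<in>P. sat M (v(0 := a)) p))"

section \<open>Filters and ultrapowers\<close>

definition filter_on :: "'i set \<Rightarrow> 'i set set \<Rightarrow> bool" where
  "filter_on I D \<longleftrightarrow> D \<subseteq> Pow I \<and> I \<in> D \<and> {} \<notin> D \<and>
     (\<forall>A\<in>D. \<forall>B\<in>D. A \<inter> B \<in> D) \<and> (\<forall>A\<in>D. \<forall>B. A \<subseteq> B \<and> B \<subseteq> I \<longrightarrow> B \<in> D)"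

definition ultrafilter_on :: "'i set \<Rightarrow> 'i set set \<Rightarrow> bool" where
  "ultrafilter_on I D \<longleftrightarrow> filter_on I D \<and> (\<forall>A\<subseteq>I. A \<in> D \<or> I - A \<in> D)"

definition regular_filter :: "'i set \<Rightarrow> 'i set set \<Rightarrow> bool" where
  "regular_filter I D \<longleftrightarrow> filter_on I D \<and>
     (\<exists>E\<subseteq>D. |E| =o |I| \<and> (\<forall>i\<in>I. finite {A\<in>E. i \<in> A}))"

definition good_filter :: "'i set \<Rightarrow> 'i set set \<Rightarrow> bool" where
  "good_filter I D \<longleftrightarrow> filter_on I D \<and>
     (\<forall>f :: 'i set \<Rightarrow> 'i set.
        (\<forall>u. finite u \<and> u \<subseteq> I \<longrightarrow> f u \<in> D) \<and>
        (\<forall>u v. finite v \<and> v \<subseteq> I \<and> u \<subseteq> v \<longrightarrow> f v \<subseteq> f u) \<longrightarrow>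
        (\<exists>g :: 'i set \<Rightarrow> 'i set.
           (\<forall>u. finite u \<and> u \<subseteq> I \<longrightarrow> g u \<in> D \<and> g u \<subseteq> f u) \<and>
           (\<forall>u v. finite u \<and> u \<subseteq> I \<and> finite v \<and> v \<subseteq> I \<longrightarrow> g (u \<union> v) = g u \<inter> g v)))"

definition ultra_equiv :: "'i set \<Rightarrow> 'i set set \<Rightarrow> 'm rstruct \<Rightarrow> (('i \<Rightarrow> 'm) \<times> ('i \<Rightarrow> 'm)) set" where
  "ultra_equiv I D M =
     {(f, g). f \<in> I \<rightarrow>\<^sub>E univ M \<and> g \<in> I \<rightarrow>\<^sub>E univ M \<and> {i\<in>I. f i = g i} \<in> D}"

definition ultrapower :: "'i set \<Rightarrow> 'i set set \<Rightarrow> 'm rstruct \<Rightarrow> ('i \<Rightarrow> 'm) set rstruct" where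
  "ultrapower I D M =
     \<lparr>univ = (I \<rightarrow>\<^sub>E univ M) // ultra_equiv I D M,
      rel = {map (\<lambda>f. ultra_equiv I D M `` {f}) fs | fs.
               set fs \<subseteq> I \<rightarrow>\<^sub>E univ M \<and> {i\<in>I. map (\<lambda>f. f i) fs \<in> rel M} \<in> D}\<rparr>"

section \<open>The complete Boolean algebra of finite partial functions\<close>

text \<open>
  The completion of the Boolean algebra freely generated by the elements \<open>x\<^sub>f\<close>, in the sense of
  forcing: the complete Boolean algebra, unique up to isomorphism, in which the \<open>x\<^sub>f\<close> are a dense
  set of nonzero elements with the prescribed order and compatibility; thus \<open>x\<^sub>f\<close> and \<open>x\<^sub>g\<close> meet in
  \<open>x\<^sub>h\<close>, \<open>h = f \<union> g\<close>, for compatible \<open>f\<close> and \<open>g\<close>. It is realised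
  as the algebra of regular open subsets of the set \<open>FI\<close> of finite partial functions ordered by
  reverse inclusion. The lemmas \<open>gen_*\<close> below record its characteristic properties.
  Note that the library class \<open>complete_boolean_algebra\<close> demands complete
  distributivity, which fails here, so the sort is \<open>{boolean_algebra, complete_lattice}\<close>.
\<close>

definition FI :: "('a \<rightharpoonup> 'c) set" where
  "FI = {f. finite (dom f)}"

definition compat_fun :: "('a \<rightharpoonup> 'c) \<Rightarrow> ('a \<rightharpoonup> 'c) \<Rightarrow> bool" where
  "compat_fun f g \<longleftrightarrow> (\<forall>a\<in>dom f \<inter> dom g. f a = g a)"

definition pneg :: "('a \<rightharpoonup> 'c) set \<Rightarrow> ('a \<rightharpoonup> 'c) set" where
  "pneg U = {f\<in>FI. \<forall>g\<in>FI. f \<subseteq>\<^sub>m g \<longrightarrow> g \<notin> U}"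

typedef ('a, 'c) fi_algebra = "{U :: ('a \<rightharpoonup> 'c) set. pneg (pneg U) = U}"
  morphisms rep_fi abs_fi
proof
  show "{} \<in> {U :: ('a \<rightharpoonup> 'c) set. pneg (pneg U) = U}"
    by (auto simp: pneg_def intro: map_le_refl)
qed

definition up_closed :: "('a \<rightharpoonup> 'c) set \<Rightarrow> bool" where
  "up_closed U \<longleftrightarrow> U \<subseteq> FI \<and> (\<forall>f\<in>U. \<forall>g\<in>FI. f \<subseteq>\<^sub>m g \<longrightarrow> g \<in> U)"

lemma pneg_anti: "U \<subseteq> V \<Longrightarrow> pneg V \<subseteq> pneg U"
  by (auto simp: pneg_def)

lemma up_closed_pneg: "up_closed (pneg U)"
  unfolding up_closed_def pneg_def by (blast intro: map_le_trans)

lemma up_closed_Union: "(\<And>U. U \<in> S \<Longrightarrow> up_closed U) \<Longrightarrow> up_closed (\<Union>S)"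
  unfolding up_closed_def by blast

lemma up_closed_Un: "up_closed U \<Longrightarrow> up_closed V \<Longrightarrow> up_closed (U \<union> V)"
  unfolding up_closed_def by blast

lemma up_closed_cone: "up_closed {g\<in>FI. f \<subseteq>\<^sub>m g}"
  unfolding up_closed_def by (blast intro: map_le_trans)

lemma pneg_pneg_iff:
  "f \<in> pneg (pneg U) \<longleftrightarrow>
     f \<in> FI \<and> (\<forall>g\<in>FI. f \<subseteq>\<^sub>m g \<longrightarrow> (\<exists>h\<in>FI. g \<subseteq>\<^sub>m h \<and> h \<in> U))"
  unfolding pneg_def by blast

lemma pneg_pneg_ge: "up_closed U \<Longrightarrow> U \<subseteq> pneg (pneg U)"
  unfolding pneg_pneg_iff up_closed_def subset_iff by (meson map_le_refl)

lemma pneg3: "up_closed U \<Longrightarrow> pneg (pneg (pneg U)) = pneg U"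
  by (simp add: pneg_anti pneg_pneg_ge subset_antisym up_closed_pneg)

lemma rep_pneg: "pneg (pneg (rep_fi x)) = rep_fi x"
  using rep_fi[of x] by simp

lemma rep_up_closed: "up_closed (rep_fi x)"
  by (metis rep_pneg up_closed_pneg)

lemma rep_sub: "rep_fi x \<subseteq> FI"
  using rep_up_closed[of x] by (simp add: up_closed_def)

lemma rep_abs_pneg: "up_closed U \<Longrightarrow> rep_fi (abs_fi (pneg U)) = pneg U"
  by (simp add: abs_fi_inverse pneg3)

lemma pneg_pneg_Inter:
  assumes "\<And>U. U \<in> S \<Longrightarrow> pneg (pneg U) = U"
  shows "pneg (pneg (FI \<inter> \<Inter>S)) = FI \<inter> \<Inter>S"
proof
  show "pneg (pneg (FI \<inter> \<Inter>S)) \<subseteq> FI \<inter> \<Inter>S"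
  proof
    fix f assume f: "f \<in> pneg (pneg (FI \<inter> \<Inter>S))"
    have "f \<in> U" if "U \<in> S" for U
    proof -
      have "FI \<inter> \<Inter>S \<subseteq> U" using that by blast
      then have "pneg (pneg (FI \<inter> \<Inter>S)) \<subseteq> pneg (pneg U)" by (intro pneg_anti)
      then show ?thesis using f assms[OF that] by blast
    qed
    then show "f \<in> FI \<inter> \<Inter>S" using f by (auto simp: pneg_def)
  qed
  have "up_closed U" if "U \<in> S" for U
    using assms[OF that] up_closed_pneg by metis
  then have "up_closed (FI \<inter> \<Inter>S)" unfolding up_closed_def by blast
  then show "FI \<inter> \<Inter>S \<subseteq> pneg (pneg (FI \<inter> \<Inter>S))" by (rule pneg_pneg_ge)
qed

lemma rep_abs_Inter: "rep_fi (abs_fi (FI \<inter> \<Inter>(rep_fi ` S))) = FI \<inter> \<Inter>(rep_fi ` S)"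
  by (rule abs_fi_inverse) (use rep_pneg in \<open>auto intro!: pneg_pneg_Inter\<close>)

instantiation fi_algebra :: (type, type) "{boolean_algebra, complete_lattice}"
begin

definition "x \<le> y \<longleftrightarrow> rep_fi x \<subseteq> rep_fi y"
definition "x < y \<longleftrightarrow> rep_fi x \<subset> rep_fi y"
definition "inf x y = abs_fi (rep_fi x \<inter> rep_fi y)"
definition "sup x y = abs_fi (pneg (pneg (rep_fi x \<union> rep_fi y)))"
definition "- x = abs_fi (pneg (rep_fi x))"
definition "x - y = inf x (- y :: ('a, 'b) fi_algebra)"
definition "bot = abs_fi {}"
definition "top = abs_fi FI"
definition "Inf S = abs_fi (FI \<inter> \<Inter>(rep_fi ` S))"
definition "Sup S = abs_fi (pneg (pneg (\<Union>(rep_fi ` S))))"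

lemma rep_inf: "rep_fi (inf x y) = rep_fi x \<inter> rep_fi y"
proof -
  have "FI \<inter> \<Inter>(rep_fi ` {x, y}) = rep_fi x \<inter> rep_fi y"
    using rep_sub by auto
  then show ?thesis
    using rep_abs_Inter[of "{x, y}"] by (simp add: inf_fi_algebra_def)
qed

lemma rep_sup: "rep_fi (sup x y) = pneg (pneg (rep_fi x \<union> rep_fi y))"
  by (simp add: sup_fi_algebra_def rep_abs_pneg up_closed_pneg)

lemma rep_uminus: "rep_fi (- x) = pneg (rep_fi x)"
  by (simp add: uminus_fi_algebra_def rep_abs_pneg rep_up_closed)

lemma rep_bot: "rep_fi bot = {}"
  unfolding bot_fi_algebra_def by (rule abs_fi_inverse) (auto simp: pneg_def intro: map_le_refl)

lemma rep_top: "rep_fi top = FI"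
  unfolding top_fi_algebra_def by (rule abs_fi_inverse) (auto simp: pneg_def intro: map_le_refl)

lemma rep_Inf: "rep_fi (Inf S) = FI \<inter> \<Inter>(rep_fi ` S)"
  by (simp add: Inf_fi_algebra_def rep_abs_Inter)

lemma rep_Sup: "rep_fi (Sup S) = pneg (pneg (\<Union>(rep_fi ` S)))"
  by (simp add: Sup_fi_algebra_def rep_abs_pneg up_closed_pneg)

lemma rep_Sup_le: "\<Union>(rep_fi ` S) \<subseteq> rep_fi z \<Longrightarrow> rep_fi (Sup S) \<subseteq> rep_fi z"
  unfolding rep_Sup by (metis pneg_anti rep_pneg)

lemma rep_sup_le: "rep_fi x \<union> rep_fi y \<subseteq> rep_fi z \<Longrightarrow> rep_fi (sup x y) \<subseteq> rep_fi z"
  unfolding rep_sup by (metis pneg_anti rep_pneg)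

lemma rep_sup_ge: "rep_fi x \<union> rep_fi y \<subseteq> rep_fi (sup x y)"
  unfolding rep_sup by (intro pneg_pneg_ge up_closed_Un rep_up_closed)

lemma rep_Sup_ge: "\<Union>(rep_fi ` S) \<subseteq> rep_fi (Sup S)"
  unfolding rep_Sup by (intro pneg_pneg_ge up_closed_Union) (auto simp: rep_up_closed)

instance
proof
  fix x y z :: "('a, 'b) fi_algebra" and S :: "('a, 'b) fi_algebra set"
  note le = less_eq_fi_algebra_def
  show "x < y \<longleftrightarrow> x \<le> y \<and> \<not> y \<le> x"
    by (auto simp: le less_fi_algebra_def)
  show "x \<le> x" "x \<le> y \<Longrightarrow> y \<le> z \<Longrightarrow> x \<le> z" "x \<le> y \<Longrightarrow> y \<le> x \<Longrightarrow> x = y"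
    by (auto simp: le rep_fi_inject)
  show "inf x y \<le> x" "inf x y \<le> y" "x \<le> y \<Longrightarrow> x \<le> z \<Longrightarrow> x \<le> inf y z"
    by (auto simp: le rep_inf)
  show "x \<le> sup x y" "y \<le> sup x y"
    using rep_sup_ge[of x y] by (auto simp: le)
  show "y \<le> x \<Longrightarrow> z \<le> x \<Longrightarrow> sup y z \<le> x"
    by (simp add: le rep_sup_le)
  show "bot \<le> x" "x \<le> top"
    by (auto simp: le rep_bot rep_top rep_sub)
  show "x \<in> S \<Longrightarrow> Inf S \<le> x" by (auto simp: le rep_Inf)
  show "(\<And>x. x \<in> S \<Longrightarrow> z \<le> x) \<Longrightarrow> z \<le> Inf S"
    using rep_sub[of z] by (auto simp: le rep_Inf)
  show "x \<in> S \<Longrightarrow> x \<le> Sup S" using rep_Sup_ge[of S] by (auto simp: le)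
  show "(\<And>x. x \<in> S \<Longrightarrow> x \<le> z) \<Longrightarrow> Sup S \<le> z"
    unfolding le by (rule rep_Sup_le) blast
  have "rep_fi (Inf {}) = rep_fi (top :: ('a, 'b) fi_algebra)" by (simp add: rep_Inf rep_top)
  then show "Inf {} = (top :: ('a, 'b) fi_algebra)" by (simp add: rep_fi_inject)
  have "rep_fi (Sup {}) = rep_fi (bot :: ('a, 'b) fi_algebra)"
    by (auto simp: rep_Sup rep_bot pneg_def intro: map_le_refl)
  then show "Sup {} = (bot :: ('a, 'b) fi_algebra)" by (simp add: rep_fi_inject)
  show "x - y = inf x (- y)" by (simp add: minus_fi_algebra_def)
  have "rep_fi (inf x (- x)) = rep_fi bot"
    by (auto simp: rep_inf rep_uminus rep_bot pneg_def intro: map_le_refl)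
  then show "inf x (- x) = bot" by (simp add: rep_fi_inject)
  have "pneg (rep_fi x \<union> pneg (rep_fi x)) = {}"
    unfolding pneg_def by (blast intro: map_le_refl map_le_trans)
  then have "rep_fi (sup x (- x)) = rep_fi top"
    by (simp add: rep_sup rep_uminus rep_top) (auto simp: pneg_def)
  then show "sup x (- x) = top" by (simp add: rep_fi_inject)
  have "rep_fi (sup x (inf y z)) = rep_fi (inf (sup x y) (sup x z))" (is "?l = ?r")
  proof
    show "?l \<subseteq> ?r"
      using rep_sup_ge[of x y] rep_sup_ge[of x z]
      by (intro rep_sup_le) (auto simp: rep_inf)
    show "?r \<subseteq> ?l"
    proof
      fix f assume f: "f \<in> ?r"
      show "f \<in> ?l"
        unfolding rep_sup[of x "inf y z"] pneg_pneg_iff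
      proof safe
        show "f \<in> FI" using f rep_sub by blast
        fix g assume g: "g \<in> FI" "f \<subseteq>\<^sub>m g"
        obtain h where h: "h \<in> FI" "g \<subseteq>\<^sub>m h" "h \<in> rep_fi x \<union> rep_fi y"
          using f g unfolding rep_inf rep_sup Int_iff pneg_pneg_iff by blast
        then have "f \<subseteq>\<^sub>m h" using g map_le_trans by blast
        then obtain h' where h': "h' \<in> FI" "h \<subseteq>\<^sub>m h'" "h' \<in> rep_fi x \<union> rep_fi z"
          using f h unfolding rep_inf rep_sup Int_iff pneg_pneg_iff by blast
        have "h' \<in> rep_fi x \<union> rep_fi y"
          using h h' rep_up_closed[of x] rep_up_closed[of y] unfolding up_closed_def by blast
        then have "h' \<in> rep_fi x \<union> rep_fi (inf y z)"
          using h' by (auto simp: rep_inf)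
        moreover have "g \<subseteq>\<^sub>m h'" using h h' map_le_trans by blast
        ultimately show "\<exists>h\<in>FI. g \<subseteq>\<^sub>m h \<and> h \<in> rep_fi x \<union> rep_fi (inf y z)"
          using h' by blast
      qed
    qed
  qed
  then show "sup x (inf y z) = inf (sup x y) (sup x z)" by (simp add: rep_fi_inject)
qed

end

definition gen :: "('a \<rightharpoonup> 'c) \<Rightarrow> ('a, 'c) fi_algebra" where
  "gen f = abs_fi (pneg (pneg {g\<in>FI. f \<subseteq>\<^sub>m g}))"

lemma rep_gen: "rep_fi (gen f) = pneg (pneg {g\<in>FI. f \<subseteq>\<^sub>m g})"
  by (simp add: gen_def rep_abs_pneg up_closed_pneg)

lemma rep_gen_iff:
  "g \<in> rep_fi (gen f) \<longleftrightarrow>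
     g \<in> FI \<and> (\<forall>h\<in>FI. g \<subseteq>\<^sub>m h \<longrightarrow> (\<exists>h'\<in>FI. h \<subseteq>\<^sub>m h' \<and> f \<subseteq>\<^sub>m h'))"
  unfolding rep_gen pneg_pneg_iff by blast

lemma gen_self: "f \<in> FI \<Longrightarrow> f \<in> rep_fi (gen f)"
  unfolding rep_gen_iff by (metis map_le_refl)

lemma compat_iff: "f \<in> FI \<Longrightarrow> g \<in> FI \<Longrightarrow> compat_fun f g \<longleftrightarrow> (\<exists>h\<in>FI. f \<subseteq>\<^sub>m h \<and> g \<subseteq>\<^sub>m h)"
proof
  assume fg: "f \<in> FI" "g \<in> FI" and c: "compat_fun f g"
  have "g a = (g ++ f) a" if "a \<in> dom g" for a
  proof -
    have "f a = None \<or> f a = g a"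
      using c that unfolding compat_fun_def by (metis IntI domIff)
    then show ?thesis by (auto simp: map_add_def split: option.splits)
  qed
  then have "f \<subseteq>\<^sub>m g ++ f" "g \<subseteq>\<^sub>m g ++ f"
    by (auto simp: map_le_def)
  moreover have "g ++ f \<in> FI" using fg by (simp add: FI_def)
  ultimately show "\<exists>h\<in>FI. f \<subseteq>\<^sub>m h \<and> g \<subseteq>\<^sub>m h" by blast
next
  assume "\<exists>h\<in>FI. f \<subseteq>\<^sub>m h \<and> g \<subseteq>\<^sub>m h"
  then show "compat_fun f g" unfolding compat_fun_def map_le_def by (metis IntE)
qed

lemma gen_mono: "f1 \<subseteq>\<^sub>m f2 \<Longrightarrow> gen f2 \<le> gen f1"
  unfolding less_eq_fi_algebra_def rep_gen
  by (intro pneg_anti) (blast intro: map_le_trans)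

lemma gen_le_iff:
  assumes "f \<in> FI"
  shows "gen f \<le> x \<longleftrightarrow> f \<in> rep_fi x"
proof
  assume "gen f \<le> x"
  then show "f \<in> rep_fi x" using gen_self[OF assms] by (auto simp: less_eq_fi_algebra_def)
next
  assume "f \<in> rep_fi x"
  then have "{g\<in>FI. f \<subseteq>\<^sub>m g} \<subseteq> rep_fi x"
    using rep_up_closed[of x] unfolding up_closed_def by blast
  then show "gen f \<le> x"
    unfolding less_eq_fi_algebra_def rep_gen
    by (subst rep_pneg[symmetric]) (intro pneg_anti)
qed

lemma gen_compat:
  assumes "f \<in> FI" "g \<in> FI"
  shows "inf (gen f) (gen g) \<noteq> bot \<longleftrightarrow> compat_fun f g"
proof -
  have "inf (gen f) (gen g) \<noteq> bot \<longleftrightarrow> rep_fi (gen f) \<inter> rep_fi (gen g) \<noteq> {}"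
    by (metis rep_bot rep_fi_inject rep_inf)
  also have "\<dots> \<longleftrightarrow> (\<exists>h\<in>FI. f \<subseteq>\<^sub>m h \<and> g \<subseteq>\<^sub>m h)"
  proof
    assume "rep_fi (gen f) \<inter> rep_fi (gen g) \<noteq> {}"
    then obtain a where a: "a \<in> rep_fi (gen f)" "a \<in> rep_fi (gen g)" by blast
    have "a \<in> FI" using a rep_sub by blast
    then obtain b where b: "b \<in> FI" "a \<subseteq>\<^sub>m b" "f \<subseteq>\<^sub>m b"
      using a(1) map_le_refl[of a] unfolding rep_gen_iff by blast
    then obtain c where "c \<in> FI" "b \<subseteq>\<^sub>m c" "g \<subseteq>\<^sub>m c"
      using a unfolding rep_gen_iff by blast
    then show "\<exists>h\<in>FI. f \<subseteq>\<^sub>m h \<and> g \<subseteq>\<^sub>m h" using b map_le_trans by blast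
  next
    assume "\<exists>h\<in>FI. f \<subseteq>\<^sub>m h \<and> g \<subseteq>\<^sub>m h"
    then obtain h where h: "h \<in> FI" "f \<subseteq>\<^sub>m h" "g \<subseteq>\<^sub>m h" by blast
    have "h \<in> rep_fi (gen q)" if "q \<subseteq>\<^sub>m h" for q
      unfolding rep_gen_iff
    proof (intro conjI ballI impI)
      fix h' assume "h' \<in> FI" "h \<subseteq>\<^sub>m h'"
      then show "\<exists>h''\<in>FI. h' \<subseteq>\<^sub>m h'' \<and> q \<subseteq>\<^sub>m h''"
        using map_le_trans[OF that] map_le_refl[of h'] by blast
    qed (rule h(1))
    then have "h \<in> rep_fi (gen f) \<inter> rep_fi (gen g)" using h by blast
    then show "rep_fi (gen f) \<inter> rep_fi (gen g) \<noteq> {}" by blast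
  qed
  finally show ?thesis using compat_iff[OF assms] by simp
qed

lemma gen_inf:
  assumes "f \<in> FI" "g \<in> FI" "compat_fun f g"
  shows "inf (gen f) (gen g) = gen (f ++ g)"
proof -
  have le: "f ++ g \<subseteq>\<^sub>m h \<longleftrightarrow> f \<subseteq>\<^sub>m h \<and> g \<subseteq>\<^sub>m h" for h
  proof
    have "f \<subseteq>\<^sub>m f ++ g"
    proof (unfold map_le_def, intro ballI)
      fix a assume "a \<in> dom f"
      then have "g a = None \<or> g a = f a"
        using assms(3) unfolding compat_fun_def by (metis IntI domIff)
      then show "f a = (f ++ g) a" by (auto simp: map_add_def split: option.splits)
    qed
    moreover have "g \<subseteq>\<^sub>m f ++ g" by simp
    moreover assume "f ++ g \<subseteq>\<^sub>m h"
    ultimately show "f \<subseteq>\<^sub>m h \<and> g \<subseteq>\<^sub>m h" using map_le_trans by blast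
  next
    assume "f \<subseteq>\<^sub>m h \<and> g \<subseteq>\<^sub>m h"
    then show "f ++ g \<subseteq>\<^sub>m h" by (simp add: map_add_le_mapI)
  qed
  have "p \<in> rep_fi (gen f) \<inter> rep_fi (gen g) \<longleftrightarrow> p \<in> rep_fi (gen (f ++ g))" for p
  proof
    assume p: "p \<in> rep_fi (gen f) \<inter> rep_fi (gen g)"
    have "\<exists>h'\<in>FI. h \<subseteq>\<^sub>m h' \<and> f ++ g \<subseteq>\<^sub>m h'" if h: "h \<in> FI" "p \<subseteq>\<^sub>m h" for h
    proof -
      obtain h1 where h1: "h1 \<in> FI" "h \<subseteq>\<^sub>m h1" "f \<subseteq>\<^sub>m h1"
        using p h unfolding Int_iff rep_gen_iff by blast
      have "p \<subseteq>\<^sub>m h1" using h(2) h1(2) by (rule map_le_trans)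
      then obtain h2 where h2: "h2 \<in> FI" "h1 \<subseteq>\<^sub>m h2" "g \<subseteq>\<^sub>m h2"
        using p h1(1) unfolding Int_iff rep_gen_iff by blast
      have "h \<subseteq>\<^sub>m h2" using h1(2) h2(2) by (rule map_le_trans)
      moreover have "f \<subseteq>\<^sub>m h2" using h1(3) h2(2) by (rule map_le_trans)
      ultimately show ?thesis using h2 le by blast
    qed
    then show "p \<in> rep_fi (gen (f ++ g))" using p unfolding Int_iff rep_gen_iff by blast
  next
    assume "p \<in> rep_fi (gen (f ++ g))"
    then show "p \<in> rep_fi (gen f) \<inter> rep_fi (gen g)" unfolding Int_iff rep_gen_iff le by blast
  qed
  then have "rep_fi (inf (gen f) (gen g)) = rep_fi (gen (f ++ g))"
    unfolding rep_inf by blast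
  then show ?thesis by (simp add: rep_fi_inject)
qed

lemma gen_nonzero: "f \<in> FI \<Longrightarrow> gen f \<noteq> bot"
  by (metis empty_iff gen_self rep_bot)

lemma gen_dense: "b \<noteq> bot \<Longrightarrow> \<exists>f\<in>FI. gen f \<le> b"
proof -
  assume "b \<noteq> bot"
  then have "rep_fi b \<noteq> {}" by (metis rep_bot rep_fi_inject)
  then obtain f where "f \<in> rep_fi b" by blast
  then show ?thesis using gen_le_iff[of f b] rep_sub[of b] by auto
qed

section \<open>Perfect and perfected ultrafilters\<close>

definition ba_ultrafilter :: "'b::boolean_algebra set \<Rightarrow> bool" where
  "ba_ultrafilter D \<longleftrightarrow> top \<in> D \<and> bot \<notin> D \<and>
     (\<forall>a\<in>D. \<forall>b\<in>D. inf a b \<in> D) \<and> (\<forall>a\<in>D. \<forall>b. a \<le> b \<longrightarrow> b \<in> D) \<and>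
     (\<forall>a. a \<in> D \<or> - a \<in> D)"

text \<open>The complete subalgebra generated by \<open>S\<close>; infima are obtained from suprema and complements.\<close>

definition complete_subalgebra ::
    "'b::{boolean_algebra, complete_lattice} set \<Rightarrow> 'b set" where
  "complete_subalgebra S =
     \<Inter>{C. S \<subseteq> C \<and> (\<forall>a\<in>C. - a \<in> C) \<and> (\<forall>X\<subseteq>C. Sup X \<in> C)}"

definition maximal_antichain :: "'b::boolean_algebra set \<Rightarrow> bool" where
  "maximal_antichain A \<longleftrightarrow> bot \<notin> A \<and> (\<forall>a\<in>A. \<forall>b\<in>A. a \<noteq> b \<longrightarrow> inf a b = bot) \<and>
     (\<forall>c. c \<noteq> bot \<longrightarrow> (\<exists>a\<in>A. inf a c \<noteq> bot))"

definition is_support ::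
    "('a, 'c) fi_algebra set \<Rightarrow> ('l set \<Rightarrow> ('a, 'c) fi_algebra) \<Rightarrow> bool" where
  "is_support X b \<longleftrightarrow> X \<subseteq> gen ` FI \<and>
     (\<forall>u. finite u \<longrightarrow>
        (\<exists>A\<subseteq>X. maximal_antichain A \<and> (\<forall>a\<in>A. a \<le> b u \<or> a \<le> - b u)))"

definition monotonic :: "('l set \<Rightarrow> 'b::boolean_algebra) \<Rightarrow> bool" where
  "monotonic b \<longleftrightarrow> (\<forall>u v. finite v \<and> u \<subseteq> v \<longrightarrow> b v \<le> b u)"

definition multiplicative :: "('l set \<Rightarrow> 'b::boolean_algebra) \<Rightarrow> bool" where
  "multiplicative b \<longleftrightarrow> (\<forall>u v. finite u \<and> finite v \<longrightarrow> b (u \<union> v) = inf (b u) (b v))"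

text \<open>
  The index set \<open>2\<^sup>\<lambda>\<close> is the type \<open>'l set\<close> with the well-order \<open>|UNIV|\<close>, whose order
  type is the initial ordinal of its cardinality. Ordinals below \<open>2\<^sup>\<lambda>\<close> are represented by the
  elements \<open>\<alpha>\<close>, standing for the proper initial segments \<open>underS |UNIV| \<alpha>\<close>.
\<close>

abbreviation below :: "'l set \<Rightarrow> 'l set set" where
  "below \<alpha> \<equiv> underS |UNIV :: 'l set set| \<alpha>"

definition perfect :: "('l set, 'c) fi_algebra set \<Rightarrow> bool" where
  "perfect D \<longleftrightarrow> ba_ultrafilter D \<and>
     (\<forall>b :: 'l set \<Rightarrow> ('l set, 'c) fi_algebra.
        monotonic b \<and> (\<forall>u. finite u \<longrightarrow> b u \<in> D) \<and>
        (\<exists>X. is_support X b \<and> |X| \<le>o |UNIV :: 'l set| \<and>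
           (\<forall>\<alpha>. (\<forall>f\<in>FI. gen f \<in> X \<longrightarrow> dom f \<subseteq> below \<alpha>) \<longrightarrow>
              (\<exists>b' :: 'l set \<Rightarrow> ('l set, 'c) fi_algebra.
                 multiplicative b' \<and>
                 (\<forall>u. finite u \<longrightarrow> b' u \<noteq> bot \<and> b' u \<le> b u) \<and>
                 (\<forall>c \<in> complete_subalgebra (gen ` {f\<in>FI. dom f \<subseteq> below \<alpha>}) \<inter> D. c \<noteq> bot \<longrightarrow>
                    (\<forall>F. finite F \<longrightarrow> inf c (INF i\<in>F. sup (b' {i}) (- b {i})) \<noteq> bot)))))
        \<longrightarrow>
        (\<exists>b' :: 'l set \<Rightarrow> ('l set, 'c) fi_algebra.
           multiplicative b' \<and> (\<forall>u. finite u \<longrightarrow> b' u \<in> D \<and> b' u \<le> b u)))"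

text \<open>
  Of the filter \<open>D0\<close> only regularity and goodness are required; excellence is a stronger condition
  than goodness.
\<close>

definition built_from ::
    "'i set \<Rightarrow> 'i set set \<Rightarrow> 'i set set \<Rightarrow> 'b::boolean_algebra set \<Rightarrow> bool" where
  "built_from I D D0 Ds \<longleftrightarrow>
     regular_filter I D0 \<and> good_filter I D0 \<and> ba_ultrafilter Ds \<and>
     (\<exists>j :: 'i set \<Rightarrow> 'b.
        j ` Pow I = UNIV \<and>
        (\<forall>A\<subseteq>I. \<forall>B\<subseteq>I. j (A \<inter> B) = inf (j A) (j B) \<and> j (A \<union> B) = sup (j A) (j B)) \<and>
        (\<forall>A\<subseteq>I. j (I - A) = - j A) \<and>
        D0 = {A. A \<subseteq> I \<and> j A = top} \<and>
        D = {A. A \<subseteq> I \<and> j A \<in> Ds})"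

definition perfected :: "'l itself \<Rightarrow> 'c itself \<Rightarrow> 'i set \<Rightarrow> 'i set set \<Rightarrow> bool" where
  "perfected (_ :: 'l itself) (_ :: 'c itself) I D \<longleftrightarrow>
     |I| =o |UNIV :: 'l set| \<and> ultrafilter_on I D \<and>
     (\<exists>D0 (Ds :: ('l set, 'c) fi_algebra set). perfect Ds \<and> built_from I D D0 Ds)"

section \<open>The combinatorial principle\<close>

definition Pr :: "nat \<Rightarrow> nat \<Rightarrow> 'l itself \<Rightarrow> 'c itself \<Rightarrow> bool" where
  "Pr n k (_ :: 'l itself) (_ :: 'c itself) \<longleftrightarrow>
     (\<exists>G :: 'l set \<Rightarrow> 'c. \<forall>(w :: 'l set) (u :: 'l set \<Rightarrow> 'l set).
        finite w \<and> card w = n \<and>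
        (\<forall>v. v \<subseteq> w \<and> card v = k \<longrightarrow> finite (u v) \<and> v \<subseteq> u v) \<and>
        (\<exists>c. \<forall>v. v \<subseteq> w \<and> card v = k \<longrightarrow> G (u v) = c) \<longrightarrow>
        (\<exists>v. v \<subseteq> w \<and> card v = k \<and> w \<subseteq> u v))"

end

theory Submission
  imports Defs "HOL-Library.Countable_Set"
begin

text \<open>
  A type over at most \<open>\<lambda>\<close> parameters of the ultrapower amounts to a link: a set
  \<open>S\<close> of \<open>k\<close>-sets of parameters which creates no complete hypergraph on
  \<open>n + 1\<close> vertices together with a new vertex. In the algebra \<open>\<B>\<close>, a
  condition decides for each parameter a canonical name, the least index of an equal parameter.
  Given \<open>\<alpha>\<close> beyond the support, fresh coordinates \<open>\<beta> y\<close>, for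
  \<open>y\<close> a \<open>k\<close>-set of names, are used to guess generically whether
  \<open>y\<close> belongs to the link, and one more coordinate guesses a colour below
  \<open>\<mu>\<close>. The formula \<open>R(x, v)\<close> is promised by those conditions which
  guess the name \<open>y\<close> of \<open>v\<close> into the link and the colour \<open>G u\<close>
  of some finite \<open>u \<supseteq> y\<close> inside which the guesses are consistent.
  If finitely many such promises completed a set \<open>w\<close> of \<open>n\<close> names and the
  new vertex to a complete hypergraph, the sets \<open>u\<close> belonging to the
  \<open>k\<close>-subsets of \<open>w\<close> would all have the same colour, so one of them would
  contain \<open>w\<close>, contradicting its consistency. Every element of the ultrafilter with
  support below \<open>\<alpha>\<close> meets any finite set of promises, so perfection applies. The
  guesses at the \<open>\<beta> y\<close> separate positive from negative instances, for which no
  bound on \<open>\<lambda>\<close> in terms of \<open>2\<^sup>\<mu>\<close> is needed.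
\<close>

section \<open>Countable elementary substructures\<close>

text \<open>The obstacle is multiplicativity. On nonempty sets a multiplicative refinement is
  determined by its values at singletons, so each instance \<open>R(x, v)\<close> must be promised
  without knowing the others, whereas the danger, a complete hypergraph on \<open>n + 1\<close>
  vertices, involves all \<open>k\<close>-subsets of an \<open>n\<close>-set at once. A promise
  would have to record the finite set \<open>u\<close> in which it was checked, but a coordinate of
  the algebra holds only an element of \<mu>. The colour \<open>G u\<close> is what fits, and
  \<open>Pr\<close> says that it is enough.

  Names are needed because distinct elements of the ultrapower may coincide at single indices, so
  sets of parameters can be compared only through equalities that a condition has decided.

  Links suffice because one-point extensions over finite sets allow back-and-forth: equalities and
  edges then determine the truth of all formulas.\<close>

instance fm :: countable by countable_datatype

lemma finite_fv: "finite (fv p)"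
  by (induction p) auto

lemma sat_cong: "(\<And>i. i \<in> fv p \<Longrightarrow> v i = v' i) \<Longrightarrow> sat M v p \<longleftrightarrow> sat M v' p"
proof (induction p arbitrary: v v')
  case (Rel xs)
  then have "map v xs = map v' xs" by simp
  then show ?case by (simp only: sat.simps)
next
  case (Imp p q)
  have "sat M v p \<longleftrightarrow> sat M v' p" by (rule Imp.IH(1)) (simp add: Imp.prems)
  moreover have "sat M v q \<longleftrightarrow> sat M v' q" by (rule Imp.IH(2)) (simp add: Imp.prems)
  ultimately show ?case by simp
next
  case (All i p)
  have "sat M (v(i := a)) p \<longleftrightarrow> sat M (v'(i := a)) p" for a
    using All.prems by (intro All.IH) auto
  then show ?case by simp
qed simp_all

definition substr :: "'m rstruct \<Rightarrow> 'm set \<Rightarrow> 'm rstruct" where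
  "substr M Y = \<lparr>univ = Y, rel = {xs \<in> rel M. set xs \<subseteq> Y}\<rparr>"

text \<open>The Tarski-Vaught test. The quantifier of the language is universal, so it is
  counterexamples that have to be found inside \<open>Y\<close>.\<close>

lemma sat_substr:
  assumes "Y \<subseteq> univ M"
    and wit: "\<And>p i v. range v \<subseteq> Y \<Longrightarrow> \<exists>a\<in>univ M. \<not> sat M (v(i := a)) p \<Longrightarrow>
                 \<exists>a\<in>Y. \<not> sat M (v(i := a)) p"
  shows "range v \<subseteq> Y \<Longrightarrow> sat (substr M Y) v p \<longleftrightarrow> sat M v p"
proof (induction p arbitrary: v)
  case (All i p)
  have "sat (substr M Y) (v(i := a)) p \<longleftrightarrow> sat M (v(i := a)) p" if "a \<in> Y" for a
    using All.prems that by (intro All.IH) (auto simp: fun_upd_def)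
  then have "sat (substr M Y) v (All i p) \<longleftrightarrow> (\<forall>a\<in>Y. sat M (v(i := a)) p)"
    by (simp add: substr_def)
  also have "\<dots> \<longleftrightarrow> (\<forall>a\<in>univ M. sat M (v(i := a)) p)"
    using wit[OF All.prems, of i p] assms(1) by blast
  finally show ?case by simp
qed (auto simp: substr_def)

text \<open>Downward Loewenheim-Skolem: \<open>Z\<close> closes \<open>X\<close> under
  counterexamples in countably many rounds.\<close>

lemma countable_elementary_substructure:
  assumes "univ M \<noteq> {}" "X \<subseteq> univ M" "countable X"
  shows "\<exists>Y. X \<subseteq> Y \<and> Y \<subseteq> univ M \<and> countable Y \<and> Y \<noteq> {} \<and>
           (\<forall>p v. range v \<subseteq> Y \<longrightarrow> (sat (substr M Y) v p \<longleftrightarrow> sat M v p))"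
proof -
  obtain a0 where a0: "a0 \<in> univ M" using assms(1) by blast
  \<comment> \<open>Assignments into a countable set may be uncountable in number, but a formula
    sees only finitely many variables. Finite lists, padded by \<open>a0\<close>, code all that
    matters and are countable in number.\<close>
  define val where "val xs = (\<lambda>i. if i < length xs then xs ! i else a0)" for xs :: "'a list"
  define wit where "wit = (\<lambda>(p, i :: nat, xs).
     if \<exists>a\<in>univ M. \<not> sat M ((val xs)(i := a)) p
     then SOME a. a \<in> univ M \<and> \<not> sat M ((val xs)(i := a)) p else a0)"
  define Z where "Z = rec_nat (insert a0 X) (\<lambda>_ Z. Z \<union> wit ` (UNIV \<times> UNIV \<times> lists Z))"
  have Z0: "Z 0 = insert a0 X"
    and ZS: "Z (Suc m) = Z m \<union> wit ` (UNIV \<times> UNIV \<times> lists (Z m))" for m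
    by (simp_all add: Z_def)
  have wit_ok: "wit (p, i, xs) \<in> univ M \<and> \<not> sat M ((val xs)(i := wit (p, i, xs))) p"
    if "\<exists>a\<in>univ M. \<not> sat M ((val xs)(i := a)) p" for p i xs
  proof -
    have "wit (p, i, xs) = (SOME a. a \<in> univ M \<and> \<not> sat M ((val xs)(i := a)) p)"
      using that by (simp add: wit_def)
    moreover have "\<exists>a. a \<in> univ M \<and> \<not> sat M ((val xs)(i := a)) p" using that by blast
    ultimately show ?thesis using someI_ex by simp
  qed
  have wit_in: "wit (p, i, xs) \<in> univ M" for p i xs
  proof (cases "\<exists>a\<in>univ M. \<not> sat M ((val xs)(i := a)) p")
    case False
    then have "wit (p, i, xs) = a0" by (simp add: wit_def)
    then show ?thesis using a0 by simp
  qed (use wit_ok in blast)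
  have "Z m \<subseteq> univ M" for m
    by (induction m) (use a0 assms(2) wit_in in \<open>auto simp: Z0 ZS\<close>)
  moreover have "countable (Z m)" for m
    by (induction m) (use assms(3) in \<open>auto simp: Z0 ZS\<close>)
  ultimately have Y: "(\<Union>m. Z m) \<subseteq> univ M" "countable (\<Union>m. Z m)" by auto
  have inc: "Z m \<subseteq> Z m'" if "m \<le> m'" for m m'
    using that by (rule lift_Suc_mono_le[rotated]) (simp add: ZS)
  have fin: "\<exists>m. F \<subseteq> Z m" if "finite F" "F \<subseteq> (\<Union>m. Z m)" for F
    using that
  proof (induction F)
    case (insert x F)
    then obtain m m' where "F \<subseteq> Z m" "x \<in> Z m'" by blast
    then have "insert x F \<subseteq> Z (max m m')"
      using inc[of m "max m m'"] inc[of m' "max m m'"] by auto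
    then show ?case by blast
  qed simp
  have closed: "\<exists>a\<in>\<Union>m. Z m. \<not> sat M (v(i := a)) p"
    if v: "range v \<subseteq> (\<Union>m. Z m)" and ex: "\<exists>a\<in>univ M. \<not> sat M (v(i := a)) p" for p i v
  proof -
    obtain N where N: "\<forall>j\<in>fv p. j < N"
      using finite_fv[of p] finite_nat_set_iff_bounded by blast
    define xs where "xs = map v [0..<N]"
    have eq: "sat M ((val xs)(i := a)) p \<longleftrightarrow> sat M (v(i := a)) p" for a
      using N by (intro sat_cong) (auto simp: val_def xs_def)
    have "set xs \<subseteq> (\<Union>m. Z m)" using v by (auto simp: xs_def)
    then obtain m where "set xs \<subseteq> Z m" using fin[of "set xs"] by blast
    then have "wit (p, i, xs) \<in> Z (Suc m)" by (auto simp: ZS lists_eq_set)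
    moreover have "\<not> sat M (v(i := wit (p, i, xs))) p" using wit_ok ex eq by blast
    ultimately show ?thesis by blast
  qed
  have elem: "\<forall>p v. range v \<subseteq> (\<Union>m. Z m) \<longrightarrow> (sat (substr M (\<Union>m. Z m)) v p \<longleftrightarrow> sat M v p)"
    by (intro allI impI sat_substr[OF Y(1) closed])
  have X: "X \<subseteq> (\<Union>m. Z m)" "(\<Union>m. Z m) \<noteq> {}" using Z0 by blast+
  show ?thesis
    by (rule exI[of _ "\<Union>m. Z m"]) (intro conjI X Y, rule elem)
qed

section \<open>Isomorphic copies of structures on another type\<close>

definition img_struct :: "('m \<Rightarrow> 'n) \<Rightarrow> 'm rstruct \<Rightarrow> 'n rstruct" where
  "img_struct h M = \<lparr>univ = h ` univ M, rel = map h ` rel M\<rparr>"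

lemma map_in_image_rel:
  assumes "inj_on h (univ M)" "is_rstruct r M" "set xs \<subseteq> univ M"
  shows "map h xs \<in> map h ` rel M \<longleftrightarrow> xs \<in> rel M"
proof
  assume "map h xs \<in> map h ` rel M"
  then obtain ys where ys: "ys \<in> rel M" "map h xs = map h ys" by blast
  then have "set xs \<union> set ys \<subseteq> univ M" using assms by (auto simp: is_rstruct_def)
  then have "inj_on h (set xs \<union> set ys)" using assms(1) inj_on_subset by blast
  then have "xs = ys" using ys(2) by (metis inj_on_map_eq_map)
  then show "xs \<in> rel M" using ys by simp
qed simp

lemma sat_img_struct:
  assumes "inj_on h (univ M)" "is_rstruct r M"
  shows "range v \<subseteq> univ M \<Longrightarrow> sat (img_struct h M) (h \<circ> v) p \<longleftrightarrow> sat M v p"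
proof (induction p arbitrary: v)
  case (Eq i j)
  then show ?case using inj_onD[OF assms(1), of "v i" "v j"] by auto
next
  case (Rel xs)
  then have "set (map v xs) \<subseteq> univ M" by auto
  from map_in_image_rel[OF assms this] show ?case by (simp add: img_struct_def comp_def)
next
  case (All i p)
  have "(h \<circ> v)(i := h a) = h \<circ> v(i := a)" for a by auto
  moreover have "sat (img_struct h M) (h \<circ> v(i := a)) p \<longleftrightarrow> sat M (v(i := a)) p"
    if "a \<in> univ M" for a using All.prems that by (intro All.IH) (auto simp: fun_upd_def)
  moreover have "univ (img_struct h M) = h ` univ M" by (simp add: img_struct_def)
  ultimately show ?case unfolding sat.simps by simp
qed auto

lemma models_img_struct:
  assumes "inj_on h (univ M)" "is_rstruct r M" "\<And>p v. p \<in> T \<Longrightarrow> range v \<subseteq> univ M \<Longrightarrow> sat M v p"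
  shows "models r (img_struct h M) T"
proof -
  have "is_rstruct r (img_struct h M)"
    using assms(2) unfolding is_rstruct_def img_struct_def by (simp add: image_subset_iff) blast
  moreover have "sat (img_struct h M) v p"
    if "p \<in> T" "range v \<subseteq> univ (img_struct h M)" for p v
  proof -
    define v' where "v' = inv_into (univ M) h \<circ> v"
    have "range v \<subseteq> h ` univ M" using that(2) by (simp add: img_struct_def)
    then have "h \<circ> v' = v" "range v' \<subseteq> univ M"
      unfolding v'_def by (auto simp: fun_eq_iff f_inv_into_f inv_into_into image_subset_iff
        rangeI subset_iff)
    then show ?thesis
      using sat_img_struct[OF assms(1,2), of v' p] assms(3)[OF that(1), of v'] by simp
  qed
  ultimately show ?thesis by (simp add: models_def)
qed

text \<open>\<open>model_completion\<close> speaks of structures on \<open>'u\<close>, while the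
  models of interest live on any type. Countable elementary substructures fit into every infinite
  type and connect the two. The element \<open>new\<close> outside the copy is room for one further
  vertex.\<close>

lemma countable_copy:
  assumes M: "models r M T" and X: "X \<subseteq> univ M" "countable X" and "infinite (UNIV :: 'u set)"
  obtains Y and h :: "'m \<Rightarrow> 'u" and new where
    "X \<subseteq> Y" "Y \<subseteq> univ (M :: 'm rstruct)" "inj_on h Y" "new \<notin> h ` Y"
    "\<And>p v. range v \<subseteq> Y \<Longrightarrow> sat (substr M Y) v p \<longleftrightarrow> sat M v p"
    "is_rstruct r (substr M Y)" "models r (img_struct h (substr M Y)) T"
proof -
  have M': "is_rstruct r M" using M by (simp add: models_def)
  then have "univ M \<noteq> {}" by (simp add: is_rstruct_def)
  from countable_elementary_substructure[OF this X] obtain Y where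
    Y: "X \<subseteq> Y" "Y \<subseteq> univ M" "countable Y" "Y \<noteq> {}"
      "\<And>p v. range v \<subseteq> Y \<Longrightarrow> sat (substr M Y) v p \<longleftrightarrow> sat M v p"
    by metis
  obtain g :: "nat \<Rightarrow> 'u" where g: "inj g" using infinite_countable_subset[OF assms(4)] by auto
  \<comment> \<open>\<open>Suc\<close> shifts the enumeration, so that \<open>g 0\<close> stays
    outside the image and can serve as \<open>new\<close>.\<close>
  define h where "h = g \<circ> Suc \<circ> to_nat_on Y"
  have "inj_on h Y"
    unfolding h_def by (intro comp_inj_on inj_on_to_nat_on[OF Y(3)] inj_on_subset[OF g]) auto
  moreover have "g 0 \<notin> h ` Y"
    using g by (auto simp: h_def dest: injD)
  ultimately have h: "inj_on h Y" "g 0 \<notin> h ` Y" by simp_all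
  have s: "is_rstruct r (substr M Y)"
    using M' Y(2,4) by (auto simp: is_rstruct_def substr_def)
  have "models r (img_struct h (substr M Y)) T"
  proof (rule models_img_struct[OF _ s])
    show "inj_on h (univ (substr M Y))" using h by (simp add: substr_def)
    show "sat (substr M Y) v p" if "p \<in> T" "range v \<subseteq> univ (substr M Y)" for p v
      using that Y(2,5) M by (auto simp: models_def substr_def)
  qed
  then show ?thesis using that Y h s by blast
qed

section \<open>Hypergraphs without large complete subgraphs\<close>

definition edges :: "'m rstruct \<Rightarrow> 'm set set" where
  "edges M = set ` rel M"

definition hgraph :: "nat \<Rightarrow> nat \<Rightarrow> 'm set \<Rightarrow> 'm set set \<Rightarrow> bool" where
  "hgraph n k V E \<longleftrightarrow> (\<forall>e\<in>E. e \<subseteq> V \<and> finite e \<and> card e = k + 1) \<and>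
     (\<forall>W\<subseteq>V. card W = n + 1 \<longrightarrow> (\<exists>Z\<subseteq>W. card Z = k + 1 \<and> Z \<notin> E))"

definition hgraph_struct :: "nat \<Rightarrow> nat \<Rightarrow> 'm rstruct \<Rightarrow> bool" where
  "hgraph_struct n k M \<longleftrightarrow> is_rstruct (k + 1) M \<and>
     (\<forall>xs. xs \<in> rel M \<longleftrightarrow> distinct xs \<and> set xs \<in> edges M) \<and> hgraph n k (univ M) (edges M)"

text \<open>The matrices of the axioms under a single assignment; quantifying over \<open>v\<close>
  replaces the prefixes \<open>alls\<close>.\<close>

definition hypergraph_clauses :: "nat \<Rightarrow> nat \<Rightarrow> 'm rstruct \<Rightarrow> (nat \<Rightarrow> 'm) \<Rightarrow> bool" where
  "hypergraph_clauses n k M v \<longleftrightarrow>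
     (\<forall>xs. distinct xs \<and> set xs = {0..<k+1} \<longrightarrow> map v [0..<k+1] \<in> rel M \<longrightarrow> map v xs \<in> rel M) \<and>
     (\<forall>i j. i < j \<and> j < k+1 \<longrightarrow> map v [0..<k+1] \<in> rel M \<longrightarrow> v i \<noteq> v j) \<and>
     \<not> ((\<forall>j<n+1. \<forall>i<j. v i \<noteq> v j) \<and>
        (\<forall>xs \<in> set (subseqs [0..<n+1]). length xs = k + 1 \<longrightarrow> map v xs \<in> rel M))"

section \<open>The axioms as a statement about edge sets\<close>

lemma sat_foldr_All:
  "sat M v (foldr All xs p) \<longleftrightarrow>
     (\<forall>v'. (\<forall>i. i \<notin> set xs \<longrightarrow> v' i = v i) \<and> (\<forall>i\<in>set xs. v' i \<in> univ M) \<longrightarrow> sat M v' p)"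
proof (induction xs arbitrary: v)
  case Nil
  have "(\<forall>i. v' i = v i) \<longleftrightarrow> v' = v" for v' by auto
  then show ?case by simp
next
  case (Cons x xs)
  show ?case (is "?l \<longleftrightarrow> ?r")
  proof
    assume l: ?l
    show ?r
    proof (intro allI impI)
      fix v' assume v': "(\<forall>i. i \<notin> set (x # xs) \<longrightarrow> v' i = v i) \<and> (\<forall>i\<in>set (x # xs). v' i \<in> univ M)"
      then have "sat M (v(x := v' x)) (foldr All xs p)" using l by simp
      then show "sat M v' p" using v' unfolding Cons.IH by auto
    qed
  next
    assume r: ?r
    have "sat M (v(x := a)) (foldr All xs p)" if a: "a \<in> univ M" for a
      unfolding Cons.IH
    proof (intro allI impI)
      fix v' assume v': "(\<forall>i. i \<notin> set xs \<longrightarrow> v' i = (v(x := a)) i) \<and> (\<forall>i\<in>set xs. v' i \<in> univ M)"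
      have "v' i = v i" if "i \<notin> set (x # xs)" for i using v' that by auto
      moreover have "v' i \<in> univ M" if "i \<in> set (x # xs)" for i
        using v' a that by (cases "i \<in> set xs") auto
      ultimately show "sat M v' p" using r by blast
    qed
    then show ?l by simp
  qed
qed

lemma sat_alls_iff:
  "(\<forall>v. range v \<subseteq> univ M \<longrightarrow> sat M v (alls m p)) \<longleftrightarrow> (\<forall>v. range v \<subseteq> univ M \<longrightarrow> sat M v p)"
proof
  assume l: "\<forall>v. range v \<subseteq> univ M \<longrightarrow> sat M v (alls m p)"
  show "\<forall>v. range v \<subseteq> univ M \<longrightarrow> sat M v p"
    using l unfolding alls_def sat_foldr_All by blast
next
  assume r: "\<forall>v. range v \<subseteq> univ M \<longrightarrow> sat M v p"
  show "\<forall>v. range v \<subseteq> univ M \<longrightarrow> sat M v (alls m p)"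
    unfolding alls_def sat_foldr_All
  proof (intro allI impI)
    fix v v' assume "range v \<subseteq> univ M"
      and "(\<forall>i. i \<notin> set [0..<m] \<longrightarrow> v' i = v i) \<and> (\<forall>i\<in>set [0..<m]. v' i \<in> univ M)"
    then have "v' i \<in> univ M" for i by (cases "i \<in> set [0..<m]") auto
    then show "sat M v' p" using r by blast
  qed
qed

lemma sat_foldr_Imp: "sat M v (foldr Imp ps q) \<longleftrightarrow> ((\<forall>p\<in>set ps. sat M v p) \<longrightarrow> sat M v q)"
  by (induction ps) auto

lemma models_hypergraph_clauses:
  "models (k+1) M (hypergraph_theory n k) \<longleftrightarrow>
     is_rstruct (k+1) M \<and> (\<forall>v. range v \<subseteq> univ M \<longrightarrow> hypergraph_clauses n k M v)"
proof -
  define T1 where "T1 = {Imp (Rel [0..<k+1]) (Rel xs) | xs. distinct xs \<and> set xs = {0..<k+1}}"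
  define T2 where "T2 = {Imp (Rel [0..<k+1]) (Imp (Eq i j) Fls) | i j. i < j \<and> j < k+1}"
  define p3 where "p3 = foldr Imp
        (concat (map (\<lambda>j. map (\<lambda>i. Imp (Eq i j) Fls) [0..<j]) [0..<n+1]) @
         map Rel (filter (\<lambda>xs. length xs = k+1) (subseqs [0..<n+1]))) Fls"
  have "hypergraph_theory n k = alls (k+1) ` T1 \<union> alls (k+1) ` T2 \<union> {alls (n+1) p3}"
    unfolding hypergraph_theory_def T1_def T2_def p3_def by blast
  then have 1: "(\<forall>p\<in>hypergraph_theory n k. \<forall>v. range v \<subseteq> univ M \<longrightarrow> sat M v p) \<longleftrightarrow>
      (\<forall>p\<in>T1 \<union> T2 \<union> {p3}. \<forall>v. range v \<subseteq> univ M \<longrightarrow> sat M v p)"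
    by (simp add: ball_Un sat_alls_iff)
  have 2: "(\<forall>p\<in>T1 \<union> T2 \<union> {p3}. sat M v p) \<longleftrightarrow> hypergraph_clauses n k M v" for v
  proof -
    have "(\<forall>p\<in>T1. sat M v p) \<longleftrightarrow> (\<forall>xs. distinct xs \<and> set xs = {0..<k+1} \<longrightarrow>
        sat M v (Imp (Rel [0..<k+1]) (Rel xs)))"
      unfolding T1_def by blast
    then have 1: "(\<forall>p\<in>T1. sat M v p) \<longleftrightarrow> (\<forall>xs. distinct xs \<and> set xs = {0..<k+1} \<longrightarrow>
        map v [0..<k+1] \<in> rel M \<longrightarrow> map v xs \<in> rel M)"
      unfolding sat.simps .
    have "(\<forall>p\<in>T2. sat M v p) \<longleftrightarrow> (\<forall>i j. i < j \<and> j < k+1 \<longrightarrow>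
        sat M v (Imp (Rel [0..<k+1]) (Imp (Eq i j) Fls)))"
      unfolding T2_def by blast
    then have 2: "(\<forall>p\<in>T2. sat M v p) \<longleftrightarrow> (\<forall>i j. i < j \<and> j < k+1 \<longrightarrow>
        map v [0..<k+1] \<in> rel M \<longrightarrow> v i \<noteq> v j)"
      unfolding sat.simps by simp
    have 3: "sat M v p3 \<longleftrightarrow> \<not> ((\<forall>j<n+1. \<forall>i<j. v i \<noteq> v j) \<and>
        (\<forall>xs \<in> set (subseqs [0..<n+1]). length xs = k + 1 \<longrightarrow> map v xs \<in> rel M))"
      unfolding p3_def sat_foldr_Imp by (auto simp del: upt_Suc simp: ball_Un)
    show ?thesis unfolding hypergraph_clauses_def ball_Un 1 2 by (simp add: 3 conj_assoc)
  qed
  show ?thesis unfolding models_def 1 2[symmetric] by blast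
qed

text \<open>Turns equality of the sets of entries into a permutation of positions, the form in which
  symmetry can be applied.\<close>

lemma Rel_perm:
  assumes "distinct ys" "set ys = set xs" "distinct xs" "length xs = m"
  shows "\<exists>zs. distinct zs \<and> set zs = {0..<m} \<and> ys = map ((!) xs) zs"
proof -
  have bij: "bij_betw ((!) xs) {0..<m} (set xs)"
    using assms(3,4) by (auto simp: bij_betw_def inj_on_nth set_conv_nth lessThan_atLeast0[symmetric])
  define g where "g = inv_into {0..<m} ((!) xs)"
  have g: "bij_betw g (set xs) {0..<m}" using bij unfolding g_def by (rule bij_betw_inv_into)
  have "xs ! g y = y" if "y \<in> set xs" for y
    using bij that unfolding g_def by (simp add: bij_betw_inv_into_right)
  then have "ys = map ((!) xs) (map g ys)" using assms(2) by (auto simp: map_idI comp_def intro!: map_idI[symmetric])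
  moreover have "distinct (map g ys)" "set (map g ys) = {0..<m}"
    using g assms(1,2) by (simp_all add: distinct_map bij_betw_def)
  ultimately show ?thesis by blast
qed

lemma nth_default_range:
  assumes "xs \<noteq> []" "set xs \<subseteq> U"
  shows "range (\<lambda>i. xs ! (if i < length xs then i else 0)) \<subseteq> U"
  using assms by (auto simp: subset_iff)

lemma hypergraph_clauses_imp_struct:
  assumes r: "is_rstruct (k+1) M" and cl: "\<And>v. range v \<subseteq> univ M \<Longrightarrow> hypergraph_clauses n k M v"
  shows "hgraph_struct n k M"
proof -
  have len: "length xs = k + 1" "set xs \<subseteq> univ M" if "xs \<in> rel M" for xs
    using r that by (auto simp: is_rstruct_def)
  \<comment> \<open>An assignment is total, so the variables beyond the list repeat its first entry;
    the range then stays inside the universe.\<close>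
  define val where "val xs i = xs ! (if i < length xs then i else 0)" for xs :: "'a list" and i
  have val: "range (val xs) \<subseteq> univ M" if "xs \<noteq> []" "set xs \<subseteq> univ M" for xs
    using nth_default_range[OF that] by (simp add: val_def[abs_def])
  have map_val: "map (val xs) zs = map ((!) xs) zs" if "set zs \<subseteq> {0..<length xs}" for xs zs
    using that by (auto simp: val_def)
  have map_all: "map (val xs) [0..<length xs] = xs" for xs
    by (subst map_val) (auto simp: map_nth)
  have clv: "hypergraph_clauses n k M (val xs)" if "xs \<in> rel M" for xs
    using that len[OF that] by (intro cl val) auto
  have dist: "distinct xs" if xs: "xs \<in> rel M" for xs
  proof -
    have m: "map (val xs) [0..<k+1] = xs" using map_all[of xs] len(1)[OF xs] by simp
    have "\<forall>i j. i < j \<and> j < k + 1 \<longrightarrow> val xs i \<noteq> val xs j"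
      using clv[OF xs] xs unfolding hypergraph_clauses_def m by blast
    then have "\<forall>i j. i < j \<and> j < length xs \<longrightarrow> xs ! i \<noteq> xs ! j"
      using len(1)[OF xs] by (auto simp: val_def)
    then show ?thesis unfolding distinct_conv_nth by (metis linorder_neqE_nat)
  qed
  have perm: "ys \<in> rel M" if xs: "xs \<in> rel M" and ys: "distinct ys" "set ys = set xs" for xs ys
  proof -
    have m: "map (val xs) [0..<k+1] = xs" using map_all[of xs] len(1)[OF xs] by simp
    obtain zs where zs: "distinct zs" "set zs = {0..<k+1}" "ys = map ((!) xs) zs"
      using Rel_perm[OF ys dist[OF xs] len(1)[OF xs]] by blast
    have "map (val xs) zs \<in> rel M"
      using clv[OF xs] xs zs(1,2) unfolding hypergraph_clauses_def m by blast
    then show ?thesis using zs len(1)[OF xs] map_val[of zs xs] by simp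
  qed
  have rel_iff: "xs \<in> rel M \<longleftrightarrow> distinct xs \<and> set xs \<in> edges M" for xs
    using dist perm by (auto simp: edges_def)
  have "\<exists>Z\<subseteq>W. card Z = k + 1 \<and> Z \<notin> edges M" if W: "W \<subseteq> univ M" "card W = n + 1" for W
  proof (rule ccontr)
    assume "\<not> ?thesis"
    then have all: "Z \<in> edges M" if "Z \<subseteq> W" "card Z = k + 1" for Z using that by blast
    have "finite W" using W(2) by (metis add_is_0 card.infinite one_neq_zero)
    then obtain ws where ws: "set ws = W" "distinct ws" using finite_distinct_list by blast
    have lw: "length ws = n + 1" using ws W(2) distinct_card by fastforce
    have "hypergraph_clauses n k M (val ws)" using ws W(1) lw by (intro cl val) auto
    moreover have "\<forall>j<n+1. \<forall>i<j. val ws i \<noteq> val ws j"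
      using ws(2) lw by (auto simp: val_def nth_eq_iff_index_eq)
    moreover have "map (val ws) xs \<in> rel M"
      if xs: "xs \<in> set (subseqs [0..<n+1])" "length xs = k + 1" for xs
    proof -
      have d: "distinct xs" using xs(1) subseqs_distinctD distinct_upt by blast
      have "set xs \<in> set ` set (subseqs [0..<n+1])" using xs(1) by blast
      then have s: "set xs \<subseteq> {0..<n+1}" unfolding subseqs_powset by (simp del: upt_Suc)
      have m: "map (val ws) xs = map ((!) ws) xs" using s lw by (intro map_val) auto
      have "inj_on ((!) ws) (set xs)"
        using ws(2) s lw by (intro inj_on_nth) auto
      then have d': "distinct (map ((!) ws) xs)" using d by (simp add: distinct_map)
      have "set (map ((!) ws) xs) \<subseteq> W" using s lw ws(1) by (auto simp: subset_iff)
      moreover have "card (set (map ((!) ws) xs)) = k + 1"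
        using distinct_card[OF d'] xs(2) by simp
      ultimately have "set (map ((!) ws) xs) \<in> edges M" by (rule all)
      then show ?thesis using d' unfolding m rel_iff by blast
    qed
    ultimately show False unfolding hypergraph_clauses_def by blast
  qed
  moreover have "e \<subseteq> univ M \<and> finite e \<and> card e = k + 1" if "e \<in> edges M" for e
    using that len dist by (auto simp: edges_def distinct_card)
  ultimately show ?thesis using r rel_iff by (simp add: hgraph_struct_def hgraph_def)
qed

lemma hgraph_struct_imp_clauses:
  assumes h: "hgraph_struct n k M" and v: "range v \<subseteq> univ M"
  shows "hypergraph_clauses n k M v"
proof -
  have r: "xs \<in> rel M \<longleftrightarrow> distinct xs \<and> set xs \<in> edges M" for xs
    using h by (simp add: hgraph_struct_def)
  have "map v xs \<in> rel M" if xs: "distinct xs" "set xs = {0..<k+1}" and e: "map v [0..<k+1] \<in> rel M" for xs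
  proof -
    have "inj_on v {0..<k+1}" using e unfolding r distinct_map by (simp del: upt_Suc)
    then have "distinct (map v xs)" using xs by (simp add: distinct_map)
    moreover have "set (map v xs) = set (map v [0..<k+1])" using xs by (simp del: upt_Suc)
    ultimately show ?thesis using e unfolding r by simp
  qed
  moreover have "v i \<noteq> v j" if "i < j" "j < k+1" and e: "map v [0..<k+1] \<in> rel M" for i j
  proof -
    have "inj_on v {0..<k+1}" using e unfolding r distinct_map by (simp del: upt_Suc)
    then show ?thesis using that(1,2) inj_onD[of v "{0..<k+1}" i j] by auto
  qed
  moreover have False if d: "\<forall>j<n+1. \<forall>i<j. v i \<noteq> v j"
    and all: "\<forall>xs \<in> set (subseqs [0..<n+1]). length xs = k + 1 \<longrightarrow> map v xs \<in> rel M"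
  proof -
    have inj: "inj_on v {0..<n+1}" 
      unfolding inj_on_def using d by (metis atLeastLessThan_iff linorder_neqE_nat)
    have "card (v ` {0..<n+1}) = n + 1" using card_image[OF inj] by simp
    then obtain Z where Z: "Z \<subseteq> v ` {0..<n+1}" "card Z = k + 1" "Z \<notin> edges M"
      using h v unfolding hgraph_struct_def hgraph_def by (metis image_subset_iff range_subsetD)
    then obtain Z' where Z': "Z' \<subseteq> {0..<n+1}" "Z = v ` Z'" by (metis subset_imageE)
    then obtain xs where xs: "xs \<in> set (subseqs [0..<n+1])" "set xs = Z'"
      using subset_subseqs[of Z' "[0..<n+1]"] by (auto simp del: upt_Suc subseqs.simps)
    have dx: "distinct xs" using xs(1) subseqs_distinctD distinct_upt by blast
    have "card Z' = k + 1"
      using Z(2) Z' card_image[OF inj_on_subset[OF inj Z'(1)]] by simp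
    then have "length xs = k + 1" using dx xs(2) distinct_card by fastforce
    then have "map v xs \<in> rel M" using all xs(1) by blast
    then show False using Z(3) Z' xs(2) unfolding r by simp
  qed
  ultimately show ?thesis unfolding hypergraph_clauses_def by blast
qed

lemma models_hypergraph_theory:
  "models (k+1) M (hypergraph_theory n k) \<longleftrightarrow> hgraph_struct n k M"
  unfolding models_hypergraph_clauses
  using hypergraph_clauses_imp_struct hgraph_struct_imp_clauses
  by (metis hgraph_struct_def)

text \<open>Think of \<open>S\<close> as the link over \<open>X\<close> of a vertex to be added.\<close>

definition admissible :: "nat \<Rightarrow> nat \<Rightarrow> 'm set set \<Rightarrow> 'm set \<Rightarrow> 'm set set \<Rightarrow> bool" where
  "admissible n k E X S \<longleftrightarrow> (\<forall>Y\<in>S. Y \<subseteq> X \<and> finite Y \<and> card Y = k) \<and>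
     (\<forall>W\<subseteq>X. card W = n \<longrightarrow> (\<exists>Y\<subseteq>W. card Y = k \<and> Y \<notin> S) \<or> (\<exists>Z\<subseteq>W. card Z = k + 1 \<and> Z \<notin> E))"

text \<open>The extension property over the base \<open>X\<close>. For finite \<open>X\<close> it
  will hold in all models of \<open>T\<close>; for \<open>X\<close> of size at most \<lambda> it is
  what saturation of the ultrapower comes down to.\<close>

definition extends_over :: "nat \<Rightarrow> nat \<Rightarrow> 'm set \<Rightarrow> 'm set set \<Rightarrow> 'm set \<Rightarrow> bool" where
  "extends_over n k V E X \<longleftrightarrow> (\<forall>S. admissible n k E X S \<longrightarrow>
     (\<exists>x\<in>V - X. \<forall>Y\<subseteq>X. finite Y \<and> card Y = k \<longrightarrow> (insert x Y \<in> E \<longleftrightarrow> Y \<in> S)))"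

text \<open>An \<open>n\<close>-set that leaves \<open>X\<close> has an element \<open>y\<close>
  outside \<open>X\<close>. By \<open>0 < k\<close> and \<open>k \<le> n\<close> it contains a
  \<open>k\<close>-set through \<open>y\<close>, which is not in \<open>S\<close> because the
  members of \<open>S\<close> lie inside \<open>X\<close>.\<close>

lemma admissible_mono:
  assumes adm: "admissible n k E X S" and XY: "X \<subseteq> Y" and k: "0 < k" "k \<le> n"
  shows "admissible n k E Y S"
proof -
  have "\<exists>Z\<subseteq>W. card Z = k \<and> Z \<notin> S" if W: "card W = n" "\<not> W \<subseteq> X" for W
  proof -
    obtain y where y: "y \<in> W" "y \<notin> X" using W(2) by blast
    have fin: "finite W" using W(1) k by (metis card.infinite le_zero_eq not_gr_zero)
    then have "k - 1 \<le> card (W - {y})" using y(1) W(1) k by simp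
    then obtain Z where Z: "Z \<subseteq> W - {y}" "card Z = k - 1" "finite Z"
      using obtain_subset_with_card_n by metis
    then have "y \<notin> Z" by blast
    with Z have "card (insert y Z) = k" "insert y Z \<subseteq> W" using k(1) y(1) by auto
    moreover have "insert y Z \<notin> S" using adm y(2) by (auto simp: admissible_def)
    ultimately show ?thesis by blast
  qed
  then show ?thesis using adm XY unfolding admissible_def by (metis subset_trans)
qed

text \<open>The axioms are checked one assignment at a time: its range is countable, hence contained
  in a countable elementary substructure with a copy on \<open>'u\<close>, where
  \<open>model_completion\<close> applies.\<close>

lemma models_completion_hgraph_struct:
  fixes M :: "'m rstruct"
  assumes mc: "model_completion TYPE('u) (k+1) T (hypergraph_theory n k)"
    and inf: "infinite (UNIV :: 'u set)" and M: "models (k+1) M T"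
  shows "hgraph_struct n k M"
proof -
  have "sat M v p" if p: "p \<in> hypergraph_theory n k" and v: "range v \<subseteq> univ M" for p v
  proof -
    have "countable (range v)" by simp
    from countable_copy[OF M v this inf] obtain Y and h :: "'m \<Rightarrow> 'u" where
      Y: "range v \<subseteq> Y" "inj_on h Y" "is_rstruct (k+1) (substr M Y)"
        "\<And>p v. range v \<subseteq> Y \<Longrightarrow> sat (substr M Y) v p \<longleftrightarrow> sat M v p"
        "models (k+1) (img_struct h (substr M Y)) T" by metis
    have u: "univ (substr M Y) = Y" by (simp add: substr_def)
    have "models (k+1) (img_struct h (substr M Y)) (hypergraph_theory n k)"
      using mc Y(5) unfolding model_completion_def by blast
    moreover have "range (h \<circ> v) \<subseteq> univ (img_struct h (substr M Y))"
      using Y(1) by (auto simp: img_struct_def substr_def)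
    ultimately have "sat (img_struct h (substr M Y)) (h \<circ> v) p"
      using p unfolding models_def by blast
    then have "sat (substr M Y) v p"
      using sat_img_struct[of h "substr M Y" "k+1" v p] Y u by simp
    then show ?thesis using Y(1,4) by blast
  qed
  then have "models (k+1) M (hypergraph_theory n k)" using M by (simp add: models_def)
  then show ?thesis by (simp only: models_hypergraph_theory)
qed

lemma wf_foldr_Imp: "wf_fm r (foldr Imp ps q) \<longleftrightarrow> (\<forall>p\<in>set ps. wf_fm r p) \<and> wf_fm r q"
  by (induction ps) auto

text \<open>
  A countable substructure \<open>A\<close> of a model is itself a model, so it satisfies the same
  formulas as any model around \<open>A\<close> with one more vertex; the new vertex is therefore imitated
  inside \<open>A\<close>.
\<close>

lemma models_completion_extends:
  fixes M :: "'m rstruct"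
  assumes mc: "model_completion TYPE('u) (k+1) T (hypergraph_theory n k)"
    and inf: "infinite (UNIV :: 'u set)" and M: "models (k+1) M T"
    and k: "0 < k" "k \<le> n" and X: "finite X" "X \<subseteq> univ M"
  shows "extends_over n k (univ M) (edges M) X"
  unfolding extends_over_def
proof (intro allI impI)
  fix S assume S: "admissible n k (edges M) X S"
  have HM: "hgraph_struct n k M" by (rule models_completion_hgraph_struct[OF mc inf M])
  from countable_copy[OF M X(2) countable_finite[OF X(1)] inf] obtain Y and h :: "'m \<Rightarrow> 'u" and new
    where Y: "X \<subseteq> Y" "Y \<subseteq> univ M" and h: "inj_on h Y" "new \<notin> h ` Y"
      and str: "is_rstruct (k+1) (substr M Y)" and AT: "models (k+1) (img_struct h (substr M Y)) T"
    by metis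
  define A where "A = img_struct h (substr M Y)"
  have uA: "univ A = h ` Y" by (simp add: A_def img_struct_def substr_def)
  have A0: "models (k+1) A (hypergraph_theory n k)"
    using mc AT unfolding model_completion_def A_def by blast
  then have HA: "hgraph_struct n k A" by (simp only: models_hypergraph_theory)
  have relM: "xs \<in> rel M \<longleftrightarrow> distinct xs \<and> set xs \<in> edges M" for xs
    using HM by (simp add: hgraph_struct_def)
  have relA: "xs \<in> rel A \<longleftrightarrow> distinct xs \<and> set xs \<in> edges A" for xs
    using HA by (simp add: hgraph_struct_def)
  have edgeA: "h ` Z \<in> edges A \<longleftrightarrow> Z \<in> edges M" if "Z \<subseteq> Y" for Z
  proof
    assume "h ` Z \<in> edges A"
    then obtain xs where xs: "xs \<in> rel M" "set xs \<subseteq> Y" "h ` Z = h ` set xs"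
      by (auto simp: edges_def A_def img_struct_def substr_def)
    then have "Z = set xs" using h(1) that inj_on_image_eq_iff by metis
    then show "Z \<in> edges M" using xs(1) by (simp add: edges_def)
  next
    assume "Z \<in> edges M"
    then show "h ` Z \<in> edges A" using that
      by (auto simp: edges_def A_def img_struct_def substr_def image_image)
  qed
  have edgeA_sub: "e \<subseteq> h ` Y \<and> finite e \<and> card e = k + 1" if "e \<in> edges A" for e
    using HA that by (simp add: hgraph_struct_def hgraph_def uA)
  have S': "Z \<subseteq> X \<and> finite Z \<and> card Z = k" if "Z \<in> S" for Z
    using S that by (simp add: admissible_def)
  \<comment> \<open>\<open>new\<close> receives the link \<open>S\<close>, copied along
    \<open>h\<close>; no other edge contains it.\<close>
  define EA' where "EA' = edges A \<union> (\<lambda>Z. insert new (h ` Z)) ` S"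
  define A' where "A' = \<lparr>univ = insert new (h ` Y), rel = {xs. distinct xs \<and> set xs \<in> EA'}\<rparr>"
  have EA'_sub: "e \<subseteq> insert new (h ` Y) \<and> finite e \<and> card e = k + 1" if "e \<in> EA'" for e
    using that unfolding EA'_def
  proof
    assume "e \<in> (\<lambda>Z. insert new (h ` Z)) ` S"
    then obtain Z where Z: "Z \<in> S" "e = insert new (h ` Z)" by blast
    have "Z \<subseteq> Y" using S'[OF Z(1)] Y by blast
    then have "new \<notin> h ` Z" "card (h ` Z) = k"
      using h S'[OF Z(1)] by (auto simp: card_image inj_on_subset)
    then show ?thesis using Z(2) S'[OF Z(1)] \<open>Z \<subseteq> Y\<close> by auto
  qed (use edgeA_sub in blast)
  have edgesA': "edges A' = EA'"
  proof
    show "EA' \<subseteq> edges A'"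
      using EA'_sub finite_distinct_list by (fastforce simp: edges_def A'_def image_iff)
  qed (auto simp: edges_def A'_def)
  have new_edge: "insert new (h ` Z) \<in> EA' \<longleftrightarrow> Z \<in> S" if "Z \<subseteq> Y" for Z
  proof
    assume "insert new (h ` Z) \<in> EA'"
    then consider "insert new (h ` Z) \<in> edges A"
      | Z' where "Z' \<in> S" "insert new (h ` Z) = insert new (h ` Z')"
      unfolding EA'_def by blast
    then show "Z \<in> S"
    proof cases
      case 1
      then show ?thesis using edgeA_sub h(2) by blast
    next
      case (2 Z')
      then have "Z' \<subseteq> Y" using S' Y(1) by blast
      then have "h ` Z = h ` Z'" using 2(2) h(2) that by (metis image_mono insert_ident subsetD)
      then have "Z = Z'" using h(1) that \<open>Z' \<subseteq> Y\<close> inj_on_image_eq_iff by metis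
      then show ?thesis using 2 by simp
    qed
  qed (simp add: EA'_def)
  have old_edge: "e \<in> EA' \<longleftrightarrow> e \<in> edges A" if "new \<notin> e" for e
    using that by (auto simp: EA'_def)
  have "\<exists>Z\<subseteq>W. card Z = k + 1 \<and> Z \<notin> EA'"
    if W: "W \<subseteq> insert new (h ` Y)" "card W = n + 1" for W
  proof (cases "new \<in> W")
    case False
    then have "W \<subseteq> univ A" using W(1) uA by blast
    moreover have "hgraph n k (univ A) (edges A)" using HA by (simp add: hgraph_struct_def)
    ultimately obtain Z where "Z \<subseteq> W" "card Z = k + 1" "Z \<notin> edges A"
      using W(2) unfolding hgraph_def by metis
    then show ?thesis using False old_edge[of Z] by blast
  next
    case True
    then obtain W' where W': "W' \<subseteq> Y" "W - {new} = h ` W'" using W(1) by (metis subset_imageE subset_insert_iff)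
    have cW: "card W' = n"
      using W(2) W' True card_image[OF inj_on_subset[OF h(1) W'(1)]]
      by (metis add_diff_cancel_right' card_Diff_singleton)
    \<comment> \<open>A \<open>k\<close>-set of \<open>W'\<close> outside \<open>S\<close> gives a
      non-edge through \<open>new\<close>; a non-edge inside \<open>W'\<close> stays one.\<close>
    have "admissible n k (edges M) Y S" by (rule admissible_mono[OF S Y(1) k])
    then consider Z where "Z \<subseteq> W'" "card Z = k" "Z \<notin> S"
      | Z where "Z \<subseteq> W'" "card Z = k + 1" "Z \<notin> edges M"
      using W'(1) cW unfolding admissible_def by blast
    then show ?thesis
    proof cases
      case (1 Z)
      have ZY: "Z \<subseteq> Y" "new \<notin> h ` Z" using 1 W' h(2) by blast+
      then have "insert new (h ` Z) \<notin> EA'" using new_edge 1 by blast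
      moreover have "card (insert new (h ` Z)) = k + 1"
        using 1(2) k(1) ZY card_image[OF inj_on_subset[OF h(1) ZY(1)]]
        by (metis Suc_eq_plus1 card_gt_0_iff card_insert_disjoint)
      moreover have "insert new (h ` Z) \<subseteq> W" using 1(1) W'(2) True by blast
      ultimately show ?thesis by blast
    next
      case (2 Z)
      have ZY: "Z \<subseteq> Y" "new \<notin> h ` Z" using 2 W' h(2) by blast+
      then have "h ` Z \<notin> EA'" using old_edge edgeA 2 by blast
      moreover have "card (h ` Z) = k + 1"
        using 2(2) card_image[OF inj_on_subset[OF h(1) ZY(1)]] by simp
      moreover have "h ` Z \<subseteq> W" using 2(1) W'(2) by blast
      ultimately show ?thesis by blast
    qed
  qed
  then have "hgraph n k (univ A') (edges A')"
    using EA'_sub unfolding hgraph_def edgesA' by (simp add: A'_def)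
  moreover have "is_rstruct (k+1) A'"
    using EA'_sub by (auto simp: is_rstruct_def A'_def distinct_card[symmetric])
  ultimately have "hgraph_struct n k A'"
    unfolding hgraph_struct_def edgesA' by (simp add: A'_def)
  then have A'0: "models (k+1) A' (hypergraph_theory n k)" by (simp only: models_hypergraph_theory)
  then obtain B :: "'u rstruct" and e where B: "models (k+1) B T" and e: "embedding (k+1) e A' B"
    using mc unfolding model_completion_def by blast
  have "embedding (k+1) e A B"
    unfolding embedding_def uA
  proof (intro conjI allI impI)
    show "inj_on e (h ` Y)" "e ` h ` Y \<subseteq> univ B"
      using e by (auto simp: embedding_def A'_def)
    fix xs assume xs: "length xs = k + 1 \<and> set xs \<subseteq> h ` Y"
    then have "new \<notin> set xs" using h(2) by blast
    then have "xs \<in> rel A \<longleftrightarrow> xs \<in> rel A'"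
      using old_edge unfolding relA by (simp add: A'_def)
    also have "\<dots> \<longleftrightarrow> map e xs \<in> rel B"
      using e xs unfolding embedding_def by (auto simp: A'_def)
    finally show "xs \<in> rel A \<longleftrightarrow> map e xs \<in> rel B" .
  qed
  moreover have "embedding (k+1) id A A" by (simp add: embedding_def)
  moreover have "models (k+1) A T" using AT by (simp add: A_def)
  ultimately have tr: "sat A (id \<circ> v) p \<longleftrightarrow> sat B (e \<circ> v) p"
    if "wf_fm (k+1) p" "range v \<subseteq> univ A" for p v
    using mc A0 B that unfolding model_completion_def by blast
  obtain y0 where y0: "y0 \<in> Y" using str by (auto simp: is_rstruct_def substr_def)
  obtain xs0 where xs0: "set xs0 = X" "distinct xs0" using X(1) finite_distinct_list by blast
  define m where "m = length xs0"
  \<comment> \<open>Variable \<open>0\<close> is kept for the new vertex, so the elements of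
    \<open>X\<close> are assigned to the variables \<open>1\<close> to \<open>m\<close>; all other
    variables get the default \<open>h y0\<close>.\<close>
  define v where "v i = h (if 1 \<le> i \<and> i \<le> m then xs0 ! (i - 1) else y0)" for i
  define v0 where "v0 = v(0 := new)"
  have "xs0 ! (i - 1) \<in> Y" if "1 \<le> i" "i \<le> m" for i
    using that nth_mem[of "i - 1" xs0] xs0(1) Y(1) by (auto simp: m_def)
  then have rv: "range v \<subseteq> h ` Y" using y0 by (auto simp: v_def)
  then have rv0: "range v0 \<subseteq> insert new (h ` Y)" by (auto simp: v0_def)
  \<comment> \<open>\<open>lits\<close> is the quantifier-free diagram of \<open>new\<close> over
    \<open>X\<close> as it holds in \<open>A'\<close>, together with the inequalities;
    \<open>p\<close> says that some element satisfies it.\<close>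
  define lits where "lits =
    map (\<lambda>ys. if map v0 ys \<in> rel A' then Rel ys else Imp (Rel ys) Fls) (List.n_lists (k+1) [0..<m+1]) @
    map (\<lambda>i. Imp (Eq 0 i) Fls) [1..<m+1]"
  define p where "p = Imp (All 0 (foldr Imp lits Fls)) Fls"
  have wf: "wf_fm (k+1) p"
    unfolding p_def wf_fm.simps wf_foldr_Imp lits_def
    by (auto simp: set_n_lists simp del: upt_Suc List.n_lists.simps)
  have sat_lits: "(\<forall>q\<in>set lits. sat N w q) \<longleftrightarrow>
      (\<forall>ys. length ys = k + 1 \<and> set ys \<subseteq> {0..<m+1} \<longrightarrow> (map w ys \<in> rel N \<longleftrightarrow> map v0 ys \<in> rel A')) \<and>
      (\<forall>i\<in>{1..<m+1}. w 0 \<noteq> w i)" for N :: "'u rstruct" and w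
  proof -
    have "(\<forall>q\<in>set lits. sat N w q) \<longleftrightarrow>
        (\<forall>ys\<in>set (List.n_lists (k+1) [0..<m+1]).
           sat N w (if map v0 ys \<in> rel A' then Rel ys else Imp (Rel ys) Fls)) \<and>
        (\<forall>i\<in>{1..<m+1}. w 0 \<noteq> w i)"
      unfolding lits_def set_append ball_Un set_map ball_simps by (simp del: upt_Suc List.n_lists.simps)
    moreover have "sat N w (if map v0 ys \<in> rel A' then Rel ys else Imp (Rel ys) Fls) \<longleftrightarrow>
        (map w ys \<in> rel N \<longleftrightarrow> map v0 ys \<in> rel A')" for ys by simp
    ultimately show ?thesis by (simp add: set_n_lists del: upt_Suc List.n_lists.simps)
  qed
  have sat_p: "sat N w p \<longleftrightarrow> (\<exists>a\<in>univ N. \<forall>q\<in>set lits. sat N (w(0 := a)) q)" for N :: "'u rstruct" and w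
    unfolding p_def by (simp add: sat_foldr_Imp)
  have "sat B (e \<circ> v) p"
    unfolding sat_p sat_lits
  proof (intro bexI conjI allI impI ballI)
    have eq: "(e \<circ> v)(0 := e new) = e \<circ> v0" by (auto simp: v0_def)
    show "e new \<in> univ B" using e by (auto simp: embedding_def A'_def)
    fix ys assume ys: "length ys = k + 1 \<and> set ys \<subseteq> {0..<m+1}"
    have "map v0 ys \<in> rel A' \<longleftrightarrow> map e (map v0 ys) \<in> rel B"
    proof -
      have "length (map v0 ys) = k + 1" "set (map v0 ys) \<subseteq> univ A'"
        using ys rv0 by (auto simp: A'_def)
      then show ?thesis using e unfolding embedding_def by blast
    qed
    then show "map ((e \<circ> v)(0 := e new)) ys \<in> rel B \<longleftrightarrow> map v0 ys \<in> rel A'"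
      unfolding eq by (simp add: comp_def)
  next
    fix i assume i: "i \<in> {1..<m+1}"
    have "v i \<in> h ` Y" using rv by blast
    then have "e new \<noteq> e (v i)"
      using e h(2) inj_onD[of e "univ A'" new "v i"] by (auto simp: embedding_def A'_def)
    then show "((e \<circ> v)(0 := e new)) 0 \<noteq> ((e \<circ> v)(0 := e new)) i" using i by simp
  qed
  then have "sat A v p" using tr[OF wf, of v] rv uA by simp
  then obtain x where x: "x \<in> Y" "\<forall>q\<in>set lits. sat A (v(0 := h x)) q"
    unfolding sat_p uA by blast
  have rel_x: "map (v(0 := h x)) ys \<in> rel A \<longleftrightarrow> map v0 ys \<in> rel A'"
    if "length ys = k + 1" "set ys \<subseteq> {0..<m+1}" for ys
    using x(2) that unfolding sat_lits by blast
  have v_idx: "\<exists>i. 1 \<le> i \<and> i \<le> m \<and> v i = h y" if y: "y \<in> X" for y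
  proof -
    obtain j where "j < m" "xs0 ! j = y" using y xs0(1) by (metis in_set_conv_nth m_def)
    then have "1 \<le> Suc j \<and> Suc j \<le> m \<and> v (Suc j) = h y" by (simp add: v_def)
    then show ?thesis by (rule exI)
  qed
  have "x \<notin> X"
  proof
    assume "x \<in> X"
    then obtain i where i: "1 \<le> i" "i \<le> m" "v i = h x" using v_idx by blast
    have "(v(0 := h x)) 0 \<noteq> (v(0 := h x)) i"
      using x(2) i(1,2) unfolding sat_lits by (metis atLeastLessThan_iff less_Suc_eq_le Suc_eq_plus1)
    then show False using i by simp
  qed
  moreover have "insert x Z \<in> edges M \<longleftrightarrow> Z \<in> S" if Z: "Z \<subseteq> X" "finite Z" "card Z = k" for Z
  proof -
    obtain zs where zs: "set zs = Z" "distinct zs" using Z(2) finite_distinct_list by blast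
    define idx where "idx y = (SOME i. 1 \<le> i \<and> i \<le> m \<and> v i = h y)" for y
    have idx: "1 \<le> idx y" "idx y \<le> m" "v (idx y) = h y" if "y \<in> X" for y
      using someI_ex[OF v_idx[OF that]] unfolding idx_def by blast+
    define ys where "ys = 0 # map idx zs"
    have ys: "length ys = k + 1" "set ys \<subseteq> {0..<m+1}"
      using zs Z distinct_card[OF zs(2)] idx by (auto simp: ys_def less_Suc_eq_le)
    have z: "map (w(0 := a)) ys = a # map h zs" if "w = v" for w a
    proof -
      have "(w(0 := a)) (idx y) = h y" if "y \<in> set zs" for y
        using idx[of y] that zs(1) Z(1) \<open>w = v\<close> by (auto split: if_splits)
      then show ?thesis by (simp add: ys_def)
    qed
    have ZY: "insert x Z \<subseteq> Y" "Z \<subseteq> Y" using Z(1) Y(1) x(1) by blast+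
    have "insert x Z \<in> edges M \<longleftrightarrow> h ` insert x Z \<in> edges A" using edgeA[OF ZY(1)] by simp
    also have "\<dots> \<longleftrightarrow> h x # map h zs \<in> rel A"
    proof -
      have "distinct (map h (x # zs))"
        using ZY zs Z(1) \<open>x \<notin> X\<close> inj_on_subset[OF h(1) ZY(1)] by (subst distinct_map) auto
      then show ?thesis unfolding relA using zs by simp
    qed
    also have "\<dots> \<longleftrightarrow> new # map h zs \<in> rel A'"
      using rel_x[OF ys] z[of v] by (simp add: v0_def)
    also have "\<dots> \<longleftrightarrow> insert new (h ` Z) \<in> EA'"
    proof -
      have "distinct (map h zs)" "new \<notin> h ` Z"
        using ZY zs h by (auto simp: distinct_map intro: inj_on_subset)
      then show ?thesis using zs by (simp add: A'_def)
    qed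
    also have "\<dots> \<longleftrightarrow> Z \<in> S" by (rule new_edge[OF ZY(2)])
    finally show ?thesis .
  qed
  ultimately show "\<exists>x\<in>univ M - X. \<forall>Y\<subseteq>X. finite Y \<and> card Y = k \<longrightarrow> (insert x Y \<in> edges M \<longleftrightarrow> Y \<in> S)"
    using x(1) Y(2) by blast
qed

section \<open>Supports in the forcing algebra\<close>

lemma card_of_Fpow_le:
  assumes inf: "infinite (UNIV :: 'l set)" and A: "|A :: 'a set| \<le>o |UNIV :: 'l set|"
  shows "|Fpow A| \<le>o |UNIV :: 'l set|"
proof -
  define F where "F = rec_nat {{}} (\<lambda>_ F. (\<lambda>(a, X). insert a X) ` (A \<times> F))"
  have F0: "F 0 = {{}}" and FS: "F (Suc m) = (\<lambda>(a, X). insert a X) ` (A \<times> F m)" for m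
    by (simp_all add: F_def)
  have "|F m| \<le>o |UNIV :: 'l set|" for m
  proof (induction m)
    case 0
    show ?case unfolding F0 using card_of_singl_ordLeq[of "UNIV :: 'l set" "{} :: 'a set"] by simp
  next
    case (Suc m)
    have "|A \<times> F m| \<le>o |UNIV :: 'l set|"
      using card_of_Times_ordLeq_infinite_Field[OF _ A Suc card_of_Card_order] inf by (simp add: Field_card_of)
    then show ?case unfolding FS using card_of_image ordLeq_transitive by blast
  qed
  moreover have "|UNIV :: nat set| \<le>o |UNIV :: 'l set|"
    using inf infinite_iff_card_of_nat by blast
  ultimately have "|\<Union>m. F m| \<le>o |UNIV :: 'l set|"
    by (intro card_of_UNION_ordLeq_infinite[OF inf]) auto
  moreover have "Fpow A \<subseteq> (\<Union>m. F m)"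
  proof
    fix X assume "X \<in> Fpow A"
    then have "finite X" "X \<subseteq> A" by (auto simp: Fpow_def)
    then show "X \<in> (\<Union>m. F m)"
    proof (induction X)
      case empty
      then show ?case using F0 by blast
    next
      case (insert x X)
      then obtain m where "X \<in> F m" by blast
      then have "insert x X \<in> F (Suc m)" unfolding FS using insert.prems by force
      then show ?case by blast
    qed
  qed
  ultimately show ?thesis using card_of_mono1 ordLeq_transitive by blast
qed

abbreviation FI_on :: "'a set \<Rightarrow> ('a \<rightharpoonup> 'c) set" where
  "FI_on d \<equiv> {f \<in> FI. dom f \<subseteq> d}"

lemma card_of_FI_on_le:
  assumes inf: "infinite (UNIV :: 'l set)" and c: "|UNIV :: 'c set| \<le>o |UNIV :: 'l set|"
    and d: "|d :: 'a set| \<le>o |UNIV :: 'l set|"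
  shows "|FI_on d :: ('a \<rightharpoonup> 'c) set| \<le>o |UNIV :: 'l set|"
proof -
  have "|d \<times> (UNIV :: 'c set)| \<le>o |UNIV :: 'l set|"
    using card_of_Times_ordLeq_infinite_Field[OF _ d c card_of_Card_order] inf by (simp add: Field_card_of)
  then have "|Fpow (d \<times> (UNIV :: 'c set))| \<le>o |UNIV :: 'l set|" by (rule card_of_Fpow_le[OF inf])
  moreover have "|FI_on d :: ('a \<rightharpoonup> 'c) set| \<le>o |Fpow (d \<times> (UNIV :: 'c set))|"
  proof (rule card_of_ordLeqI)
    show "inj_on Map.graph (FI_on d :: ('a \<rightharpoonup> 'c) set)"
    proof (rule inj_onI)
      fix f g :: "'a \<rightharpoonup> 'c" assume "Map.graph f = Map.graph g"
      then have "f x = Some y \<longleftrightarrow> g x = Some y" for x y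
        by (metis in_graphI in_graphD)
      then show "f = g" by (metis ext not_None_eq)
    qed
    fix f :: "'a \<rightharpoonup> 'c" assume f: "f \<in> FI_on d"
    have "Map.graph f = (\<lambda>a. (a, the (f a))) ` dom f"
      by (auto simp: Map.graph_def image_iff)
    then show "Map.graph f \<in> Fpow (d \<times> (UNIV :: 'c set))"
      using f by (auto simp: Fpow_def FI_def)
  qed
  ultimately show ?thesis using ordLeq_transitive by blast
qed

text \<open>Membership in \<open>U\<close> looks only at the coordinates in \<open>d\<close>. This
  stands in for membership in the complete subalgebra generated by the conditions on
  \<open>d\<close>.\<close>

definition supp_set :: "'a set \<Rightarrow> ('a \<rightharpoonup> 'c) set \<Rightarrow> bool" where
  "supp_set d U \<longleftrightarrow> (\<forall>f\<in>FI. f \<in> U \<longleftrightarrow> f |` d \<in> U)"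

abbreviation supported :: "'a set \<Rightarrow> ('a, 'c) fi_algebra \<Rightarrow> bool" where
  "supported d x \<equiv> supp_set d (rep_fi x)"

lemma restrict_FI: "f \<in> FI \<Longrightarrow> f |` d \<in> FI_on d"
  by (auto simp: FI_def)

lemma restrict_le: "f |` d \<subseteq>\<^sub>m f"
  by (auto simp: map_le_def)

lemma restrict_mono: "f \<subseteq>\<^sub>m g \<Longrightarrow> f |` d \<subseteq>\<^sub>m g |` d"
  by (auto simp: map_le_def restrict_map_def split: if_splits)

lemma restrict_id: "dom f \<subseteq> d \<Longrightarrow> f |` d = f"
  by (auto simp: restrict_map_def fun_eq_iff domIff subset_iff) (metis option.exhaust)

text \<open>The product structure of the forcing: the part of \<open>f\<close> on \<open>d\<close>
  may be strengthened to any \<open>g\<close> on \<open>d\<close> that extends it, while the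
  coordinates of \<open>f\<close> outside \<open>d\<close> stay as they are. Most amalgamations of
  conditions below rest on this.\<close>

lemma merge_restrict:
  assumes "f \<in> FI" "g \<in> FI_on d" "f |` d \<subseteq>\<^sub>m g"
  shows "f ++ g \<in> FI" "f \<subseteq>\<^sub>m f ++ g" "g \<subseteq>\<^sub>m f ++ g" "(f ++ g) |` d = g"
proof -
  show "f ++ g \<in> FI" using assms by (simp add: FI_def)
  have eq: "f a = g a" if "a \<in> d" "f a \<noteq> None" for a
    using assms(3) that unfolding map_le_def by (metis domIff restrict_in)
  show "f \<subseteq>\<^sub>m f ++ g"
    unfolding map_le_def
  proof
    fix a assume a: "a \<in> dom f"
    show "f a = (f ++ g) a"
    proof (cases "g a")
      case (Some y)
      then have "a \<in> d" using assms(2) by blast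
      then show ?thesis using eq a Some by (simp add: map_add_def domIff)
    qed (simp add: map_add_def)
  qed
  show "g \<subseteq>\<^sub>m f ++ g" by simp
  show "(f ++ g) |` d = g"
  proof
    fix a show "((f ++ g) |` d) a = g a"
    proof (cases "a \<in> d")
      case True
      then show ?thesis using eq[of a] by (cases "f a"; cases "g a") (auto simp: map_add_def)
    next
      case False
      then have "g a = None" using assms(2) by (auto simp: domIff)
      then show ?thesis using False by simp
    qed
  qed
qed

text \<open>If some \<open>g\<close> in \<open>U\<close> extends the restriction of \<open>f\<close>
  to \<open>d\<close>, then the restriction of \<open>g\<close> to \<open>d\<close> is already in
  \<open>U\<close>, and it merges with \<open>f\<close> into an extension of \<open>f\<close> in
  \<open>U\<close>.\<close>

lemma supp_set_pneg:
  assumes "supp_set d U"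
  shows "supp_set d (pneg U)"
  unfolding supp_set_def
proof (intro ballI iffI)
  fix f assume f: "f \<in> FI" "f \<in> pneg U"
  show "f |` d \<in> pneg U"
    unfolding pneg_def
  proof (intro CollectI conjI ballI impI notI)
    show "f |` d \<in> FI" using restrict_FI f by blast
    fix g assume g: "g \<in> FI" "f |` d \<subseteq>\<^sub>m g" "g \<in> U"
    have "f |` d \<subseteq>\<^sub>m g |` d" using restrict_mono[OF g(2), of d] by simp
    note m = merge_restrict[OF f(1) restrict_FI[OF g(1)] this]
    have "g |` d \<in> U" using assms g by (simp add: supp_set_def)
    then have "f ++ g |` d \<in> U" using assms m(1,4) by (simp add: supp_set_def)
    then show False using f(2) m(1,2) by (auto simp: pneg_def)
  qed
next
  fix f assume f: "f \<in> FI" "f |` d \<in> pneg U"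
  then show "f \<in> pneg U"
    using up_closed_pneg[of U] restrict_le[of f d] unfolding up_closed_def by blast
qed

lemma supp_set_mono: "supp_set d U \<Longrightarrow> d \<subseteq> d' \<Longrightarrow> supp_set d' U"
  unfolding supp_set_def
proof (intro ballI)
  fix f :: "'a \<rightharpoonup> 'b" assume a: "\<forall>f\<in>FI. (f \<in> U) = (f |` d \<in> U)" "d \<subseteq> d'" "f \<in> FI"
  have "(f |` d') |` d = f |` d" using a(2) by (simp add: inf.absorb2)
  then show "f \<in> U \<longleftrightarrow> f |` d' \<in> U" using a restrict_FI[OF a(3), of d'] by auto
qed

lemma supported_uminus: "supported d x \<Longrightarrow> supported d (- x)"
  by (simp add: rep_uminus supp_set_pneg)

lemma supported_Sup: "(\<And>x. x \<in> S \<Longrightarrow> supported d x) \<Longrightarrow> supported d (Sup S)"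
  unfolding rep_Sup by (intro supp_set_pneg) (auto simp: supp_set_def)

lemma supported_gen:
  assumes "f \<in> FI_on d"
  shows "supported d (gen f)"
proof -
  have "f \<subseteq>\<^sub>m g \<longleftrightarrow> f \<subseteq>\<^sub>m g |` d" for g
    using restrict_mono[of f g d] restrict_id[of f d] restrict_le[of g d] assms map_le_trans
    by (metis (no_types, lifting) mem_Collect_eq)
  then have "supp_set d {g \<in> FI. f \<subseteq>\<^sub>m g}"
    using restrict_FI by (auto simp: supp_set_def)
  then show ?thesis unfolding rep_gen by (intro supp_set_pneg)
qed

text \<open>The supported elements contain the generators and are closed under complements and
  suprema. Through this lemma the test elements in the definition of \<open>perfect\<close> become
  elements with a support.\<close>

lemma supported_complete_subalgebra:
  assumes "x \<in> complete_subalgebra (gen ` FI_on d)"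
  shows "supported d x"
proof -
  let ?C = "{x. supported d x}"
  have "gen ` FI_on d \<subseteq> ?C" using supported_gen by blast
  moreover have "\<forall>a\<in>?C. - a \<in> ?C" using supported_uminus by blast
  moreover have "\<forall>X\<subseteq>?C. Sup X \<in> ?C" using supported_Sup by blast
  ultimately show ?thesis using assms unfolding complete_subalgebra_def by blast
qed

lemma top_complete_subalgebra: "top \<in> complete_subalgebra S"
proof -
  have "- bot \<in> C" if "\<forall>a\<in>C. - a \<in> C" "\<forall>X\<subseteq>C. Sup X \<in> C" for C :: "'a set"
  proof -
    have "Sup {} \<in> C" using that(2) by blast
    then show ?thesis using that(1) by (metis Sup_empty)
  qed
  then show ?thesis unfolding complete_subalgebra_def by simp
qed

lemma rep_up: "p \<in> rep_fi x \<Longrightarrow> p \<subseteq>\<^sub>m q \<Longrightarrow> q \<in> FI \<Longrightarrow> q \<in> rep_fi x"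
  using rep_up_closed[of x] unfolding up_closed_def by blast

lemma rep_not_both: "p \<in> rep_fi x \<Longrightarrow> p \<notin> rep_fi (- x)"
  using rep_sub[of x] unfolding rep_uminus pneg_def by (auto intro: map_le_refl)

lemma decide:
  assumes "p \<in> FI"
  shows "\<exists>q\<in>FI. p \<subseteq>\<^sub>m q \<and> (q \<in> rep_fi x \<or> q \<in> rep_fi (- x))"
proof (cases "p \<in> rep_fi (- x)")
  case False
  then show ?thesis using assms unfolding rep_uminus pneg_def by blast
qed (use assms in \<open>auto intro: map_le_refl\<close>)

lemma decide_on:
  assumes "p \<in> FI_on d" "supported d x"
  shows "\<exists>q\<in>FI_on d. p \<subseteq>\<^sub>m q \<and> (q \<in> rep_fi x \<or> q \<in> rep_fi (- x))"
proof -
  obtain q where q: "q \<in> FI" "p \<subseteq>\<^sub>m q" "q \<in> rep_fi x \<or> q \<in> rep_fi (- x)"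
    using decide assms(1) by blast
  have "q |` d \<in> rep_fi x \<or> q |` d \<in> rep_fi (- x)"
    using q assms(2) supported_uminus[OF assms(2)] by (auto simp: supp_set_def)
  moreover have "p \<subseteq>\<^sub>m q |` d"
    using restrict_mono[OF q(2), of d] restrict_id[of p d] assms(1) by simp
  ultimately show ?thesis using restrict_FI[OF q(1), of d] by blast
qed

text \<open>Since \<open>rep_fi y\<close> is regular open, it is enough that \<open>y\<close> is
  dense below \<open>x\<close>.\<close>

lemma rep_leI:
  assumes "\<And>p. p \<in> rep_fi x \<Longrightarrow> \<exists>q\<in>FI. p \<subseteq>\<^sub>m q \<and> q \<in> rep_fi y"
  shows "x \<le> y"
  unfolding less_eq_fi_algebra_def
proof
  fix p assume p: "p \<in> rep_fi x"
  then have "p \<in> FI" using rep_sub by blast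
  moreover have "\<exists>h\<in>FI. g \<subseteq>\<^sub>m h \<and> h \<in> rep_fi y" if "g \<in> FI" "p \<subseteq>\<^sub>m g" for g
    using assms[OF rep_up[OF p that(2,1)]] .
  ultimately have "p \<in> pneg (pneg (rep_fi y))" unfolding pneg_pneg_iff by blast
  then show "p \<in> rep_fi y" by (simp add: rep_pneg)
qed

lemma bot_iff: "x = bot \<longleftrightarrow> rep_fi x = {}"
  by (metis rep_bot rep_fi_inject)

text \<open>A closing-off argument: choose for every condition \<open>p\<close> an extension
  \<open>h p\<close> that decides \<open>x\<close>, and let \<open>d\<close> be closed under
  \<open>h\<close>. A set of at most \<lambda> coordinates carries at most \<lambda> conditions, so
  \<omega> rounds of closing off keep the size at \<lambda>.\<close>

lemma exists_support:
  fixes x :: "('a, 'c) fi_algebra"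
  assumes inf: "infinite (UNIV :: 'l set)" and c: "|UNIV :: 'c set| \<le>o |UNIV :: 'l set|"
  shows "\<exists>d. |d| \<le>o |UNIV :: 'l set| \<and> supported d x"
proof -
  define h where "h p = (SOME q. q \<in> FI \<and> p \<subseteq>\<^sub>m q \<and> (q \<in> rep_fi x \<or> q \<in> rep_fi (- x)))" for p
  have h: "h p \<in> FI \<and> p \<subseteq>\<^sub>m h p \<and> (h p \<in> rep_fi x \<or> h p \<in> rep_fi (- x))" if "p \<in> FI" for p
  proof -
    have "\<exists>q. q \<in> FI \<and> p \<subseteq>\<^sub>m q \<and> (q \<in> rep_fi x \<or> q \<in> rep_fi (- x))"
      using decide[OF that, of x] by blast
    from someI_ex[OF this] show ?thesis unfolding h_def .
  qed
  define D where "D = rec_nat {} (\<lambda>_ d. d \<union> (\<Union>p\<in>FI_on d. dom (h p)))"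
  have D0: "D 0 = {}" and DS: "D (Suc m) = D m \<union> (\<Union>p\<in>FI_on (D m). dom (h p))" for m
    by (simp_all add: D_def)
  have card_fin: "|A :: 'a set| \<le>o |UNIV :: 'l set|" if "finite A" for A
    using that inf finite_ordLess_infinite[OF card_of_Well_order card_of_Well_order]
    by (intro ordLess_imp_ordLeq) (simp add: Field_card_of)
  have "|D m| \<le>o |UNIV :: 'l set|" for m
  proof (induction m)
    case 0
    show ?case unfolding D0 by (rule card_fin) simp
  next
    case (Suc m)
    have "|\<Union>p\<in>FI_on (D m). dom (h p)| \<le>o |UNIV :: 'l set|"
      using card_of_FI_on_le[OF inf c Suc] h card_fin
      by (intro card_of_UNION_ordLeq_infinite[OF inf]) (auto simp: FI_def)
    then show ?case
      unfolding DS using Suc inf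
      by (intro card_of_Un_ordLeq_infinite_Field[OF _ _ _ card_of_Card_order]) (auto simp: Field_card_of)
  qed
  moreover have "|UNIV :: nat set| \<le>o |UNIV :: 'l set|"
    using inf infinite_iff_card_of_nat by blast
  ultimately have card: "|\<Union>m. D m| \<le>o |UNIV :: 'l set|"
    by (intro card_of_UNION_ordLeq_infinite[OF inf]) auto
  define d where "d = (\<Union>m. D m)"
  have inc: "D m \<subseteq> D m'" if "m \<le> m'" for m m'
    using that by (rule lift_Suc_mono_le[rotated]) (simp add: DS)
  have fin_sub: "\<exists>m. F \<subseteq> D m" if "finite F" "F \<subseteq> d" for F
    using that
  proof (induction F)
    case (insert a F)
    then obtain m where "F \<subseteq> D m" by blast
    moreover obtain m' where "a \<in> D m'" using insert.prems by (auto simp: d_def)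
    ultimately have "insert a F \<subseteq> D (max m m')"
      using inc[of m "max m m'"] inc[of m' "max m m'"] by auto
    then show ?case by blast
  qed simp
  have "dom (h p) \<subseteq> d" if p: "p \<in> FI_on d" for p
  proof -
    have "finite (dom p)" "dom p \<subseteq> d" using p by (auto simp: FI_def)
    then obtain m where "dom p \<subseteq> D m" using fin_sub by blast
    then have "dom (h p) \<subseteq> D (Suc m)" unfolding DS using p by blast
    then show ?thesis unfolding d_def by blast
  qed
  then have hd: "h p \<in> FI_on d" if "p \<in> FI_on d" for p using h that by blast
  \<comment> \<open>Suppose \<open>f\<close> forces \<open>x\<close> while some \<open>g\<close>,
    extending the part of \<open>f\<close> on \<open>d\<close>, forces \<open>- x\<close>. With
    \<open>p\<close> the part of \<open>g\<close> on \<open>d\<close>, the condition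
    \<open>h p\<close> lies on \<open>d\<close> and is compatible with both, so its decision
    contradicts one of the two.\<close>
  have key: "f |` d \<in> pneg (rep_fi (- x))" if f: "f \<in> rep_fi x" for f
    unfolding pneg_def
  proof (intro CollectI conjI ballI impI notI)
    have fFI: "f \<in> FI" using f rep_sub by blast
    show "f |` d \<in> FI" using restrict_FI[OF fFI] by blast
    fix g assume g: "g \<in> FI" "f |` d \<subseteq>\<^sub>m g" "g \<in> rep_fi (- x)"
    define p where "p = g |` d"
    have p: "p \<in> FI_on d" "f |` d \<subseteq>\<^sub>m p"
      using restrict_FI[OF g(1)] restrict_mono[OF g(2), of d] by (simp_all add: p_def)
    have hp: "h p \<in> FI_on d" "p \<subseteq>\<^sub>m h p" "h p \<in> rep_fi x \<or> h p \<in> rep_fi (- x)"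
      using hd[OF p(1)] h p(1) by blast+
    have "f |` d \<subseteq>\<^sub>m h p" using p(2) hp(2) map_le_trans by blast
    note m1 = merge_restrict[OF fFI hp(1) this]
    have "g |` d \<subseteq>\<^sub>m h p" using hp(2) by (simp add: p_def)
    note m2 = merge_restrict[OF g(1) hp(1) this]
    have "f ++ h p \<in> rep_fi x" using rep_up[OF f m1(2,1)] .
    moreover have "g ++ h p \<in> rep_fi (- x)" using rep_up[OF g(3) m2(2,1)] .
    moreover have "f ++ h p \<in> rep_fi (- x) \<or> g ++ h p \<in> rep_fi x"
      using hp(3) rep_up[OF _ m1(3,1)] rep_up[OF _ m2(3,1)] by blast
    ultimately show False using rep_not_both by blast
  qed
  have "supported d x"
    unfolding supp_set_def
  proof (intro ballI iffI)
    fix f assume "f \<in> rep_fi x"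
    from key[OF this] show "f |` d \<in> rep_fi x" by (simp add: rep_uminus rep_pneg)
  next
    fix f assume "f \<in> FI" "f |` d \<in> rep_fi x"
    then show "f \<in> rep_fi x" using rep_up restrict_le by blast
  qed
  then show ?thesis using card d_def by blast
qed

text \<open>Zorn's lemma gives an antichain that is maximal among the conditions on \<open>d\<close>
  deciding \<open>x\<close>. It is maximal in the whole algebra: a condition \<open>p\<close> is
  restricted to \<open>d\<close>, and what is found there merges back with \<open>p\<close>, whose
  other coordinates lie outside \<open>d\<close>.\<close>

lemma supported_antichain:
  assumes x: "supported d x"
  shows "\<exists>A\<subseteq>gen ` FI_on d. maximal_antichain A \<and> (\<forall>a\<in>A. a \<le> x \<or> a \<le> - x)"
proof -
  define P where "P = gen ` {f \<in> FI_on d. f \<in> rep_fi x \<or> f \<in> rep_fi (- x)}"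
  define \<A> where "\<A> = {A. A \<subseteq> P \<and> (\<forall>a\<in>A. \<forall>b\<in>A. a \<noteq> b \<longrightarrow> inf a b = bot)}"
  have "\<exists>A\<in>\<A>. \<forall>B\<in>\<A>. A \<subseteq> B \<longrightarrow> B = A"
  proof (rule subset_Zorn_nonempty)
    show "\<A> \<noteq> {}" by (auto simp: \<A>_def)
    fix \<C> assume "\<C> \<noteq> {}" and C: "subset.chain \<A> \<C>"
    have "inf a b = bot" if ab: "a \<in> \<Union>\<C>" "b \<in> \<Union>\<C>" "a \<noteq> b" for a b
    proof -
      obtain A B where AB: "A \<in> \<C>" "B \<in> \<C>" "a \<in> A" "b \<in> B" using ab by blast
      then have "A \<subseteq> B \<or> B \<subseteq> A" using C unfolding subset.chain_def by blast
      moreover have "A \<in> \<A>" "B \<in> \<A>" using AB C unfolding subset.chain_def by blast+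
      ultimately show ?thesis using AB ab(3) unfolding \<A>_def by blast
    qed
    moreover have "A \<subseteq> P" if "A \<in> \<C>" for A
      using that C unfolding \<A>_def subset.chain_def by blast
    then have "\<Union>\<C> \<subseteq> P" by (rule Union_least)
    ultimately show "\<Union>\<C> \<in> \<A>" by (simp add: \<A>_def)
  qed
  then obtain A where A: "A \<in> \<A>" and max: "\<And>B. B \<in> \<A> \<Longrightarrow> A \<subseteq> B \<Longrightarrow> B = A" by blast
  have AP: "A \<subseteq> P" using A by (simp add: \<A>_def)
  have "\<exists>a\<in>A. inf a c \<noteq> bot" if c: "c \<noteq> bot" for c
  proof -
    obtain p where p: "p \<in> FI" "gen p \<le> c" using gen_dense[OF c] by blast
    obtain q where q: "q \<in> FI_on d" "p |` d \<subseteq>\<^sub>m q" "q \<in> rep_fi x \<or> q \<in> rep_fi (- x)"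
      using decide_on[OF restrict_FI[OF p(1)] x] by blast
    have qP: "gen q \<in> P" using q by (auto simp: P_def)
    have "\<exists>a\<in>A. inf a (gen q) \<noteq> bot"
    proof (rule ccontr)
      assume n: "\<not> ?thesis"
      then have "inf (gen q) a = bot" if "a \<in> A" for a using that by (metis inf_commute)
      then have "insert (gen q) A \<in> \<A>" using n A qP by (auto simp: \<A>_def)
      then have "gen q \<in> A" using max[of "insert (gen q) A"] by blast
      then show False using n gen_nonzero[of q] q(1) by auto
    qed
    then obtain a where a: "a \<in> A" "inf a (gen q) \<noteq> bot" by blast
    obtain f where f: "f \<in> FI_on d" "a = gen f" using a(1) AP by (auto simp: P_def)
    then obtain h where h: "h \<in> FI" "f \<subseteq>\<^sub>m h" "q \<subseteq>\<^sub>m h"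
      using a(2) gen_compat[of f q] compat_iff[of f q] q(1) by auto
    have "p |` d \<subseteq>\<^sub>m h |` d"
      using q(1,2) restrict_mono[OF h(3), of d] restrict_id[of q d] map_le_trans by auto
    note m = merge_restrict[OF p(1) restrict_FI[OF h(1)] this]
    have "f \<subseteq>\<^sub>m h |` d" using restrict_mono[OF h(2), of d] restrict_id[of f d] f(1) by simp
    then have "f \<subseteq>\<^sub>m p ++ h |` d" using m(3) map_le_trans by blast
    then have "inf (gen f) (gen p) \<noteq> bot"
      using gen_compat[of f p] compat_iff[of f p] f(1) p(1) m(1,2) by auto
    moreover have "inf (gen f) (gen p) \<le> inf a c" using f(2) p(2) by (simp add: le_infI2)
    ultimately show ?thesis using a(1) by (metis bot.extremum_uniqueI)
  qed
  moreover have "bot \<notin> A" using AP gen_nonzero unfolding P_def by force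
  moreover have "\<forall>a\<in>A. \<forall>b\<in>A. a \<noteq> b \<longrightarrow> inf a b = bot" using A by (simp add: \<A>_def)
  ultimately have "maximal_antichain A" by (simp add: maximal_antichain_def)
  moreover have "\<forall>a\<in>A. a \<le> x \<or> a \<le> - x"
    using AP by (auto simp: P_def gen_le_iff)
  moreover have "A \<subseteq> gen ` FI_on d" using AP by (auto simp: P_def)
  ultimately show ?thesis by (intro exI[of _ A] conjI)
qed

section \<open>Forcing statements about coordinates\<close>

locale forcing =
  fixes I :: "'i set" and j :: "'i set \<Rightarrow> ('a, 'c) fi_algebra"
  assumes j_Int: "A \<subseteq> I \<Longrightarrow> B \<subseteq> I \<Longrightarrow> j (A \<inter> B) = inf (j A) (j B)"
    and j_compl: "A \<subseteq> I \<Longrightarrow> j (I - A) = - j A"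
begin

text \<open>The forcing relation, with the image under \<open>j\<close> as the Boolean value of a
  property of indices.\<close>

definition F :: "('a \<rightharpoonup> 'c) \<Rightarrow> ('i \<Rightarrow> bool) \<Rightarrow> bool" where
  "F p \<phi> \<longleftrightarrow> p \<in> rep_fi (j {t \<in> I. \<phi> t})"

lemma j_empty: "j {} = bot"
proof -
  have "j {} = j (I \<inter> (I - I))" by simp
  also have "\<dots> = inf (j I) (j (I - I))" by (rule j_Int) auto
  also have "\<dots> = inf (j I) (- j I)" by (simp only: j_compl[OF subset_refl])
  finally show ?thesis by simp
qed

lemma j_top: "j I = top"
  using j_compl[of "{}"] by (simp add: j_empty)

lemma j_mono:
  assumes "A \<subseteq> B" "B \<subseteq> I"
  shows "j A \<le> j B"
proof -
  have "j (A \<inter> B) = inf (j A) (j B)" using assms by (intro j_Int) auto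
  moreover have "A \<inter> B = A" using assms(1) by blast
  ultimately show ?thesis by (simp add: inf.absorb_iff1)
qed

lemma j_neg: "j {t \<in> I. \<not> \<phi> t} = - j {t \<in> I. \<phi> t}"
proof -
  have "{t \<in> I. \<not> \<phi> t} = I - {t \<in> I. \<phi> t}" by blast
  then show ?thesis by (simp add: j_compl)
qed

lemma F_FI: "F p \<phi> \<Longrightarrow> p \<in> FI"
  unfolding F_def using rep_sub by blast

lemma F_mono: "F p \<phi> \<Longrightarrow> (\<And>t. t \<in> I \<Longrightarrow> \<phi> t \<Longrightarrow> \<psi> t) \<Longrightarrow> F p \<psi>"
  using j_mono[of "{t \<in> I. \<phi> t}" "{t \<in> I. \<psi> t}"] unfolding F_def less_eq_fi_algebra_def by blast

lemma F_conj: "F p \<phi> \<Longrightarrow> F p \<psi> \<Longrightarrow> F p (\<lambda>t. \<phi> t \<and> \<psi> t)"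
proof -
  have "{t \<in> I. \<phi> t \<and> \<psi> t} = {t \<in> I. \<phi> t} \<inter> {t \<in> I. \<psi> t}" by blast
  then show "F p \<phi> \<Longrightarrow> F p \<psi> \<Longrightarrow> ?thesis"
    unfolding F_def by (simp add: j_Int rep_inf)
qed

lemma F_true: "p \<in> FI \<Longrightarrow> F p (\<lambda>_. True)"
  by (simp add: F_def j_top rep_top)

lemma F_up: "F p \<phi> \<Longrightarrow> p \<subseteq>\<^sub>m q \<Longrightarrow> q \<in> FI \<Longrightarrow> F q \<phi>"
  unfolding F_def by (rule rep_up)

lemma F_contr: "F p \<phi> \<Longrightarrow> F p (\<lambda>t. \<not> \<phi> t) \<Longrightarrow> False"
  unfolding F_def j_neg using rep_not_both by blast

lemma F_Ball:
  assumes "finite K" "p \<in> FI" "\<And>x. x \<in> K \<Longrightarrow> F p (\<phi> x)"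
  shows "F p (\<lambda>t. \<forall>x\<in>K. \<phi> x t)"
  using assms(1,3)
proof (induction K)
  case empty
  then show ?case using F_true[OF assms(2)] by simp
next
  case (insert x K)
  then have "F p (\<lambda>t. \<phi> x t \<and> (\<forall>x\<in>K. \<phi> x t))" by (intro F_conj) auto
  then show ?case by simp
qed

text \<open>Forcing a negation quantifies over all extensions of \<open>p\<close>. When the value of
  \<open>\<phi>\<close> has support \<open>d\<close>, the extensions on \<open>d\<close> suffice,
  since any other can be restricted to \<open>d\<close>.\<close>

lemma F_negI_on:
  assumes "supported d (j {t \<in> I. \<phi> t})" "p \<in> FI_on d"
    and "\<And>q. q \<in> FI_on d \<Longrightarrow> p \<subseteq>\<^sub>m q \<Longrightarrow> \<not> F q \<phi>"
  shows "F p (\<lambda>t. \<not> \<phi> t)"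
  unfolding F_def j_neg rep_uminus pneg_def
proof (intro CollectI conjI ballI impI notI)
  show "p \<in> FI" using assms(2) by simp
  fix q assume q: "q \<in> FI" "p \<subseteq>\<^sub>m q" "q \<in> rep_fi (j {t \<in> I. \<phi> t})"
  then have "F (q |` d) \<phi>" using assms(1) by (simp add: F_def supp_set_def)
  moreover have "p \<subseteq>\<^sub>m q |` d"
    using restrict_mono[OF q(2), of d] restrict_id[of p d] assms(2) by simp
  ultimately show False using assms(3) restrict_FI[OF q(1)] by blast
qed

end

text \<open>Finitely many dense requirements that persist under strengthening are met one after the
  other. \<open>Q\<close> is a parameter because the strengthening sometimes has to stay on a given
  set of coordinates.\<close>

lemma extend_finite:
  assumes "finite K" "p \<in> Q"
    and ext: "\<And>x q. x \<in> K \<Longrightarrow> q \<in> Q \<Longrightarrow> \<exists>q'\<in>Q. q \<subseteq>\<^sub>m q' \<and> P x q'"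
    and up: "\<And>x q q'. P x q \<Longrightarrow> q \<subseteq>\<^sub>m q' \<Longrightarrow> q' \<in> Q \<Longrightarrow> P x q'"
  shows "\<exists>q\<in>Q. p \<subseteq>\<^sub>m q \<and> (\<forall>x\<in>K. P x q)"
  using assms(1) ext
proof (induction K)
  case empty
  show ?case using assms(2) map_le_refl by blast
next
  case (insert x K)
  then obtain q where q: "q \<in> Q" "p \<subseteq>\<^sub>m q" "\<forall>x\<in>K. P x q" by (metis insertCI)
  then obtain q' where q': "q' \<in> Q" "q \<subseteq>\<^sub>m q'" "P x q'" using insert.prems by blast
  then have "\<forall>y\<in>insert x K. P y q'" using q(3) up by blast
  then show ?case using q'(1,2) q(2) map_le_trans by blast
qed

text \<open>
  Parameters are indexed by \<open>J\<close>. A condition \<open>p\<close> may decide that \<open>a\<close> is the \<open>prec\<close>-least index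
  whose parameter equals that of \<open>i\<close>; then \<open>a\<close> is the canonical name of \<open>i\<close>. Distinct
  canonical names are forced to denote distinct elements.
\<close>

locale parameters = forcing I j for I :: "'i set" and j :: "'i set \<Rightarrow> ('a, 'c) fi_algebra" +
  fixes J :: "'l set" and f :: "'l \<Rightarrow> 'i \<Rightarrow> 'm" and prec :: "'l \<Rightarrow> 'l \<Rightarrow> bool"
  assumes wf_prec: "wfP prec" and total_prec: "x \<noteq> y \<Longrightarrow> prec x y \<or> prec y x"
begin

definition rho :: "('a \<rightharpoonup> 'c) \<Rightarrow> 'l \<Rightarrow> 'l \<Rightarrow> bool" where
  "rho p i a \<longleftrightarrow> a \<in> J \<and> F p (\<lambda>t. f i t = f a t) \<and>
     (\<forall>i'\<in>J. prec i' a \<longrightarrow> F p (\<lambda>t. f i t \<noteq> f i' t))"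

lemma rho_unique: "rho p i a \<Longrightarrow> rho p i b \<Longrightarrow> a = b"
  using total_prec[of a b] F_contr unfolding rho_def by blast

lemma rho_up: "rho p i a \<Longrightarrow> p \<subseteq>\<^sub>m q \<Longrightarrow> q \<in> FI \<Longrightarrow> rho q i a"
  unfolding rho_def using F_up by blast

lemma rho_eq: "rho p i a \<Longrightarrow> F p (\<lambda>t. f i t = f a t)"
  by (simp add: rho_def)

text \<open>If \<open>prec a b\<close>, then minimality of \<open>b\<close> forces
  \<open>f i'\<close> apart from \<open>f a\<close>, and \<open>f i'\<close> is forced equal to
  \<open>f b\<close>.\<close>

lemma rho_distinct:
  assumes "rho p i a" "rho p i' b" "a \<noteq> b"
  shows "F p (\<lambda>t. f a t \<noteq> f b t)"
proof -
  have *: "F p (\<lambda>t. f a t \<noteq> f b t)" if "rho p i a" "rho p i' b" "prec a b" for i i' a b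
  proof -
    have "F p (\<lambda>t. f i' t \<noteq> f a t)" using that by (simp add: rho_def)
    then show ?thesis by (rule F_mono[OF F_conj[OF rho_eq[OF that(2)]]]) auto
  qed
  show ?thesis
  proof (cases "prec a b")
    case False
    then have "F p (\<lambda>t. f b t \<noteq> f a t)" using * assms total_prec by blast
    then show ?thesis by (rule F_mono) auto
  qed (use * assms in blast)
qed

text \<open>Take \<open>a\<close> to be \<open>prec\<close>-least among the indices that some
  extension on \<open>d\<close> forces equal to \<open>i\<close>. Below that extension no smaller
  index can be made equal to \<open>i\<close> on \<open>d\<close>, so \<open>F_negI_on\<close>
  forces the inequalities. The extension stays on \<open>d\<close>, which leaves fresh coordinates
  free.\<close>

lemma rho_exists:
  assumes supp: "\<And>i i'. i \<in> J \<Longrightarrow> i' \<in> J \<Longrightarrow> supported d (j {t \<in> I. f i t = f i' t})"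
    and p: "p \<in> FI_on d" and i: "i \<in> J"
  shows "\<exists>q\<in>FI_on d. p \<subseteq>\<^sub>m q \<and> (\<exists>a. rho q i a)"
proof -
  define P where "P a \<longleftrightarrow> a \<in> J \<and> (\<exists>q\<in>FI_on d. p \<subseteq>\<^sub>m q \<and> F q (\<lambda>t. f i t = f a t))" for a
  have "P i" using p i F_true[of p] map_le_refl[of p] unfolding P_def by auto
  then obtain a where a: "P a" "\<And>a'. prec a' a \<Longrightarrow> \<not> P a'"
    using wf_prec unfolding wfp_eq_minimal by (metis mem_Collect_eq)
  then obtain q where q: "q \<in> FI_on d" "p \<subseteq>\<^sub>m q" "F q (\<lambda>t. f i t = f a t)"
    unfolding P_def by blast
  have "F q (\<lambda>t. f i t \<noteq> f i' t)" if i': "i' \<in> J" "prec i' a" for i'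
  proof (rule F_negI_on[OF supp[OF i i'(1)] q(1)])
    fix q' assume "q' \<in> FI_on d" "q \<subseteq>\<^sub>m q'"
    then show "\<not> F q' (\<lambda>t. f i t = f i' t)"
      using a(2)[OF i'(2)] i'(1) q(2) map_le_trans unfolding P_def by blast
  qed
  then have "rho q i a" using a(1) q(3) by (simp add: rho_def P_def)
  then show ?thesis using q by blast
qed

end

section \<open>Realizing a type in the forcing algebra\<close>

text \<open>The requirement that the type makes for \<open>v\<close> at the index \<open>t\<close>.
  The test \<open>card v = k\<close> counts parameter indices, although their values may collide at
  \<open>t\<close>. Sets \<open>v\<close> of other sizes only ask \<open>x\<close> to avoid the
  values, which keeps the realization off the parameters.\<close>

definition link_at ::
    "('l \<Rightarrow> 'i \<Rightarrow> 'm) \<Rightarrow> 'm set set \<Rightarrow> nat \<Rightarrow> 'l set set \<Rightarrow> 'l set \<Rightarrow> 'm \<Rightarrow> 'i \<Rightarrow> bool" where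
  "link_at f E k S v x t \<longleftrightarrow> x \<notin> (\<lambda>i. f i t) ` v \<and>
     (card v = k \<longrightarrow> (insert x ((\<lambda>i. f i t) ` v) \<in> E \<longleftrightarrow> v \<in> S))"

text \<open>
  \<open>\<beta> y\<close> are fresh coordinates. A generic value \<open>c1\<close> at \<open>\<beta> y\<close> says that the set \<open>y\<close> of canonical
  names belongs to the link of the realization, and the generic value at \<open>\<beta> {}\<close> is a colour under
  \<open>G\<close>.
\<close>

locale type_over_parameters = parameters I j J f prec
  for I :: "'i set" and j :: "'i set \<Rightarrow> ('a, 'c) fi_algebra" and J :: "'l set"
    and f :: "'l \<Rightarrow> 'i \<Rightarrow> 'm" and prec :: "'l \<Rightarrow> 'l \<Rightarrow> bool" +
  fixes n k :: nat and V :: "'m set" and E :: "'m set set" and S :: "'l set set"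
    and G :: "'l set \<Rightarrow> 'c" and \<beta> :: "'l set \<Rightarrow> 'a" and c0 c1 :: 'c
  assumes k: "0 < k" "k \<le> n"
    and f_in: "i \<in> J \<Longrightarrow> t \<in> I \<Longrightarrow> f i t \<in> V"
    and hyp: "hgraph n k V E"
    and ext: "finite X \<Longrightarrow> X \<subseteq> V \<Longrightarrow> extends_over n k V E X"
    and G: "\<And>w u. finite w \<Longrightarrow> card w = n \<Longrightarrow>
        (\<And>v. v \<subseteq> w \<Longrightarrow> card v = k \<Longrightarrow> finite (u v) \<and> v \<subseteq> u v \<and> G (u v) = \<epsilon>) \<Longrightarrow>
        \<exists>v\<subseteq>w. card v = k \<and> w \<subseteq> u v"
    and c01: "c0 \<noteq> c1"
begin

definition "vals t X = (\<lambda>i. f i t) ` X"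

abbreviation "\<phi> \<equiv> link_at f E k S"

text \<open>A coordinate holds an element of \<open>'c\<close>, so it records the colour of
  \<open>u\<close> and not \<open>u\<close> itself; different \<open>y\<close> may have different
  witnesses of the same colour. As \<open>0 < k\<close>, the empty set is no \<open>k\<close>-set
  and is free to index the colour.\<close>

definition linked :: "('a \<rightharpoonup> 'c) \<Rightarrow> 'l set \<Rightarrow> bool" where
  "linked q y \<longleftrightarrow> card y = k \<and> q (\<beta> y) = Some c1 \<and>
     (\<exists>u. finite u \<and> y \<subseteq> u \<and> q (\<beta> {}) = Some (G u) \<and>
        (\<forall>w\<subseteq>u. card w = n \<longrightarrow>
           (\<exists>z\<subseteq>w. card z = k + 1 \<and> F q (\<lambda>t. vals t z \<notin> E)) \<or>
           (\<exists>y'\<subseteq>w. card y' = k \<and> q (\<beta> y') = Some c0)))"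

definition Q :: "'l set \<Rightarrow> ('a \<rightharpoonup> 'c) set" where
  "Q v = {q \<in> FI. \<exists>r. (\<forall>i\<in>v. rho q i (r i)) \<and>
     (card v = k \<longrightarrow> (if v \<in> S then linked q (r ` v) else q (\<beta> (r ` v)) = Some c0))}"

lemma map_le_Some: "p \<subseteq>\<^sub>m q \<Longrightarrow> p x = Some y \<Longrightarrow> q x = Some y"
  unfolding map_le_def by (metis domI)

lemma linked_up: "linked p y \<Longrightarrow> p \<subseteq>\<^sub>m q \<Longrightarrow> q \<in> FI \<Longrightarrow> linked q y"
  unfolding linked_def using F_up map_le_Some by meson

lemma Q_up:
  assumes "p \<in> Q v" "p \<subseteq>\<^sub>m q" "q \<in> FI"
  shows "q \<in> Q v"
proof -
  obtain r where r: "\<forall>i\<in>v. rho p i (r i)"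
    "card v = k \<longrightarrow> (if v \<in> S then linked p (r ` v) else p (\<beta> (r ` v)) = Some c0)"
    using assms(1) by (auto simp: Q_def)
  have "\<forall>i\<in>v. rho q i (r i)" using r(1) rho_up assms(2,3) by blast
  moreover have "card v = k \<longrightarrow> (if v \<in> S then linked q (r ` v) else q (\<beta> (r ` v)) = Some c0)"
    using r(2) linked_up[OF _ assms(2,3)] map_le_Some[OF assms(2)] by auto
  ultimately show ?thesis using assms(3) unfolding Q_def by blast
qed

text \<open>At an index where all forced facts hold, the guesses describe a link on the values of
  the names. \<open>ext\<close> yields the element \<open>x\<close> once this link is admissible,
  and admissibility is where the property of \<open>G\<close> enters.\<close>

lemma forces_realization:
  assumes s: "finite s" "\<And>v. v \<in> s \<Longrightarrow> finite v \<and> v \<subseteq> J" and h: "h \<in> FI" "\<And>v. v \<in> s \<Longrightarrow> h \<in> Q v"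
  shows "F h (\<lambda>t. \<exists>x\<in>V. \<forall>v\<in>s. \<phi> v x t)"
proof -
  define K where "K = \<Union>s"
  have K: "finite K" "K \<subseteq> J" using s by (auto simp: K_def)
  have "\<exists>a. rho h i a" if "i \<in> K" for i
    using that h(2) by (fastforce simp: K_def Q_def)
  then obtain r where r: "\<And>i. i \<in> K \<Longrightarrow> rho h i (r i)" by metis
  have Qr: "card v = k \<longrightarrow> (if v \<in> S then linked h (r ` v) else h (\<beta> (r ` v)) = Some c0)"
    if v: "v \<in> s" for v
  proof -
    obtain r' where r': "\<forall>i\<in>v. rho h i (r' i)"
      "card v = k \<longrightarrow> (if v \<in> S then linked h (r' ` v) else h (\<beta> (r' ` v)) = Some c0)"
      using h(2)[OF v] by (auto simp: Q_def)
    have "r' i = r i" if "i \<in> v" for i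
    proof (rule rho_unique)
      show "rho h i (r' i)" using r'(1) that by blast
      show "rho h i (r i)" using that v by (intro r) (auto simp: K_def)
    qed
    then have "r' ` v = r ` v" by (rule image_cong[OF refl])
    from r'(2)[unfolded this] show ?thesis .
  qed
  have rJ: "r ` K \<subseteq> J" using r by (auto simp: rho_def)
  \<comment> \<open>Everything forced about the finitely many names, \<open>Z\<close> included, is
    forced simultaneously, so that the argument can move into the structure at a single index
    \<open>t\<close>.\<close>
  define Z where "Z = {z. z \<subseteq> r ` K \<and> F h (\<lambda>t. vals t z \<notin> E)}"
  have finZ: "finite Z"
    by (rule finite_subset[of _ "Pow (r ` K)"]) (use K(1) in \<open>auto simp: Z_def\<close>)
  have F1: "F h (\<lambda>t. \<forall>i\<in>K. f i t = f (r i) t)"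
    by (rule F_Ball[OF K(1) h(1)]) (use rho_eq r in blast)
  have F2: "F h (\<lambda>t. \<forall>(a, b)\<in>r ` K \<times> r ` K. a \<noteq> b \<longrightarrow> f a t \<noteq> f b t)"
  proof (rule F_Ball[OF _ h(1)])
    show "finite (r ` K \<times> r ` K)" using K(1) by simp
    fix ab assume "ab \<in> r ` K \<times> r ` K"
    then obtain i i' where ab: "ab = (r i, r i')" "i \<in> K" "i' \<in> K" by blast
    have "F h (\<lambda>t. r i \<noteq> r i' \<longrightarrow> f (r i) t \<noteq> f (r i') t)"
    proof (cases "r i = r i'")
      case True
      then show ?thesis using F_true[OF h(1)] by simp
    next
      case False
      then show ?thesis using rho_distinct[OF r[OF ab(2)] r[OF ab(3)]] by simp
    qed
    then show "F h (\<lambda>t. case ab of (a, b) \<Rightarrow> a \<noteq> b \<longrightarrow> f a t \<noteq> f b t)" by (simp add: ab(1))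
  qed
  have F3: "F h (\<lambda>t. \<forall>z\<in>Z. vals t z \<notin> E)"
    by (rule F_Ball[OF finZ h(1)]) (simp add: Z_def)
  show ?thesis
  proof (rule F_mono[OF F_conj[OF F1 F_conj[OF F2 F3]]])
    fix t assume t: "t \<in> I" and *: "(\<forall>i\<in>K. f i t = f (r i) t) \<and>
      (\<forall>(a, b)\<in>r ` K \<times> r ` K. a \<noteq> b \<longrightarrow> f a t \<noteq> f b t) \<and> (\<forall>z\<in>Z. vals t z \<notin> E)"
    have inj: "inj_on (\<lambda>i. f i t) (r ` K)" using * by (auto simp: inj_on_def)
    have vals_eq: "y = y'" if "vals t y = vals t y'" "y \<subseteq> r ` K" "y' \<subseteq> r ` K" for y y'
      using that inj_on_image_eq_iff[OF inj] unfolding vals_def by blast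
    have vals_card: "card (vals t y) = card y" if "y \<subseteq> r ` K" for y
      unfolding vals_def by (rule card_image[OF inj_on_subset[OF inj that]])
    have vals_r: "vals t v = vals t (r ` v)" if "v \<in> s" for v
      using * that unfolding vals_def image_image K_def by (intro image_cong) auto
    have rv: "r ` v \<subseteq> r ` K" if "v \<in> s" for v using that by (auto simp: K_def)
    define X where "X = vals t (r ` K)"
    have X: "finite X" "X \<subseteq> V" using K(1) rJ f_in[OF _ t] by (auto simp: X_def vals_def)
    define P where "P = (\<lambda>v. vals t (r ` v)) ` {v \<in> s. card v = k \<and> v \<in> S}"
    have lk: "linked h (r ` v)" if "v \<in> s" "card v = k" "v \<in> S" for v
      using Qr[OF that(1)] that by simp
    have "admissible n k E X P"
      unfolding admissible_def
    proof (intro conjI ballI allI impI)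
      fix Y assume "Y \<in> P"
      then obtain v where v: "v \<in> s" "card v = k" "v \<in> S" "Y = vals t (r ` v)" by (auto simp: P_def)
      then show "Y \<subseteq> X" using rv unfolding X_def vals_def by blast
      then show "finite Y" using X(1) finite_subset by blast
      show "card Y = k" using lk[OF v(1-3)] vals_card[OF rv[OF v(1)]] v(4) by (simp add: linked_def)
    next
      fix W assume W: "W \<subseteq> X" "card W = n"
      show "(\<exists>Y\<subseteq>W. card Y = k \<and> Y \<notin> P) \<or> (\<exists>Z\<subseteq>W. card Z = k + 1 \<and> Z \<notin> E)"
      proof (rule ccontr)
        assume neg: "\<not> ?thesis"
        obtain w where w: "w \<subseteq> r ` K" "W = vals t w"
          using W(1) unfolding X_def vals_def by (metis subset_imageE)
        have cw: "card w = n" "finite w"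
          using W(2) w(2) vals_card[OF w(1)] finite_subset[OF w(1)] K(1) by simp_all
        have "\<exists>v\<in>s. card v = k \<and> v \<in> S \<and> y = r ` v" if y: "y \<subseteq> w" "card y = k" for y
        proof -
          have yr: "y \<subseteq> r ` K" using y(1) w(1) by blast
          have "vals t y \<subseteq> W" "card (vals t y) = k"
            using y w vals_card[OF yr] by (auto simp: vals_def)
          then have "vals t y \<in> P" using neg by blast
          then show ?thesis using vals_eq[OF _ yr rv] by (auto simp: P_def)
        qed
        then have lky: "linked h y" if "y \<subseteq> w" "card y = k" for y using lk that by blast
        then have "\<exists>u. y \<subseteq> w \<and> card y = k \<longrightarrow> finite u \<and> y \<subseteq> u \<and> h (\<beta> {}) = Some (G u) \<and>
            (\<forall>w\<subseteq>u. card w = n \<longrightarrow>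
               (\<exists>z\<subseteq>w. card z = k + 1 \<and> F h (\<lambda>t. vals t z \<notin> E)) \<or>
               (\<exists>y'\<subseteq>w. card y' = k \<and> h (\<beta> y') = Some c0))" for y
          unfolding linked_def by blast
        then obtain u where u: "\<And>y. y \<subseteq> w \<Longrightarrow> card y = k \<Longrightarrow>
            finite (u y) \<and> y \<subseteq> u y \<and> h (\<beta> {}) = Some (G (u y)) \<and>
            (\<forall>w\<subseteq>u y. card w = n \<longrightarrow>
               (\<exists>z\<subseteq>w. card z = k + 1 \<and> F h (\<lambda>t. vals t z \<notin> E)) \<or>
               (\<exists>y'\<subseteq>w. card y' = k \<and> h (\<beta> y') = Some c0))"
          by metis
        \<comment> \<open>\<open>h\<close> has a single value at \<open>\<beta> {}\<close>, so all
          witnesses \<open>u y\<close> have one colour and \<open>G\<close> makes one of them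
          contain \<open>w\<close>. What \<open>linked\<close> says of the \<open>n\<close>-subsets
          of that witness then applies to \<open>w\<close>.\<close>
        have "\<exists>y\<subseteq>w. card y = k \<and> w \<subseteq> u y"
          by (rule G[OF cw(2,1), where \<epsilon> = "the (h (\<beta> {}))"]) (use u in force)
        then consider z where "z \<subseteq> w" "card z = k + 1" "F h (\<lambda>t. vals t z \<notin> E)"
          | y' where "y' \<subseteq> w" "card y' = k" "h (\<beta> y') = Some c0"
          using u cw(1) by metis
        then show False
        proof cases
          case (1 z)
          then have zr: "z \<subseteq> r ` K" using w(1) by blast
          then have "vals t z \<notin> E" using * 1(3) by (auto simp: Z_def)
          moreover have "vals t z \<subseteq> W" "card (vals t z) = k + 1"
            using 1 w vals_card[OF zr] by (auto simp: vals_def)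
          ultimately show False using neg by blast
        next
          case (2 y')
          then show False using lky[of y'] c01 by (simp add: linked_def)
        qed
      qed
    qed
    then obtain x where x: "x \<in> V" "x \<notin> X"
      "\<And>Y. Y \<subseteq> X \<Longrightarrow> finite Y \<Longrightarrow> card Y = k \<Longrightarrow> insert x Y \<in> E \<longleftrightarrow> Y \<in> P"
      using ext[OF X] unfolding extends_over_def by (metis DiffE)
    have "\<phi> v x t" if v: "v \<in> s" for v
    proof -
      have sub: "vals t v \<subseteq> X" using vals_r[OF v] rv[OF v] unfolding X_def vals_def by blast
      then have fin: "finite (vals t v)" using X(1) finite_subset by blast
      have "insert x (vals t v) \<in> E \<longleftrightarrow> v \<in> S" if cv: "card v = k"
      proof
        assume e: "insert x (vals t v) \<in> E"
        then have "card (insert x (vals t v)) = k + 1" using hyp by (auto simp: hgraph_def)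
        moreover have "x \<notin> vals t v" using sub x(2) by blast
        ultimately have "card (vals t v) = k" using fin by simp
        then have "vals t v \<in> P" using x(3)[OF sub fin] e by simp
        then obtain v' where v': "v' \<in> s" "card v' = k" "v' \<in> S" "vals t (r ` v) = vals t (r ` v')"
          using vals_r[OF v] by (auto simp: P_def)
        \<comment> \<open>\<open>v\<close> and \<open>v'\<close> have the same names and so read the
          same coordinate; its value \<open>c1\<close> excludes the \<open>c0\<close> that
          \<open>v \<notin> S\<close> would require.\<close>
        have "r ` v = r ` v'" by (rule vals_eq[OF v'(4) rv[OF v] rv[OF v'(1)]])
        then have "h (\<beta> (r ` v)) = Some c1" using lk[OF v'(1-3)] by (simp add: linked_def)
        then show "v \<in> S" using Qr[OF v] cv c01 by (auto split: if_splits)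
      next
        assume vS: "v \<in> S"
        then have "vals t v \<in> P" using v cv vals_r[OF v] by (auto simp: P_def)
        moreover have "card (vals t v) = k"
          using lk[OF v cv vS] vals_card[OF rv[OF v]] vals_r[OF v] by (simp add: linked_def)
        ultimately show "insert x (vals t v) \<in> E" using x(3)[OF sub fin] by simp
      qed
      then show ?thesis using sub x(2) unfolding link_at_def vals_def[symmetric] by blast
    qed
    then show "\<exists>x\<in>V. \<forall>v\<in>s. \<phi> v x t" using x(1) by blast
  qed
qed

text \<open>The names of \<open>K\<close> are decided by a condition on \<open>d\<close>, where the
  coordinates \<open>\<beta> y\<close> are still free and can be filled with the truth about
  \<open>S\<close>. The set \<open>u\<close> of all names of \<open>K\<close> is a common witness
  for all \<open>v\<close>, and \<open>cons\<close> is its consistency.\<close>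

lemma generic_realization:
  assumes supp: "\<And>i i'. i \<in> J \<Longrightarrow> i' \<in> J \<Longrightarrow> supported d (j {t \<in> I. f i t = f i' t})"
    and fresh: "\<And>y. finite y \<Longrightarrow> \<beta> y \<notin> d" and inj_\<beta>: "inj_on \<beta> {y. finite y}"
    and p: "p \<in> FI_on d" and K: "finite K" "K \<subseteq> J"
    and dist: "\<And>i i'. i \<in> K \<Longrightarrow> i' \<in> K \<Longrightarrow> i \<noteq> i' \<Longrightarrow> F p (\<lambda>t. f i t \<noteq> f i' t)"
    and cons: "\<And>w. w \<subseteq> K \<Longrightarrow> card w = n \<Longrightarrow> (\<exists>v\<subseteq>w. card v = k \<and> v \<notin> S) \<or>
        (\<exists>z\<subseteq>w. card z = k + 1 \<and> F p (\<lambda>t. vals t z \<notin> E))"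
  shows "\<exists>q\<in>FI. p \<subseteq>\<^sub>m q \<and> (\<forall>v\<subseteq>K. q \<in> Q v)"
proof -
  have "\<exists>q\<in>FI_on d. p \<subseteq>\<^sub>m q \<and> (\<forall>i\<in>K. \<exists>a. rho q i a)"
  proof (rule extend_finite[OF K(1) p])
    show "\<exists>q'\<in>FI_on d. q \<subseteq>\<^sub>m q' \<and> (\<exists>a. rho q' i a)" if "i \<in> K" "q \<in> FI_on d" for i q
      using rho_exists[OF supp that(2)] that(1) K(2) by blast
    show "\<exists>a. rho q' i a" if "\<exists>a. rho q i a" "q \<subseteq>\<^sub>m q'" "q' \<in> FI_on d" for i q q'
      using that rho_up by blast
  qed
  then obtain q r where q: "q \<in> FI_on d" "p \<subseteq>\<^sub>m q" and r: "\<And>i. i \<in> K \<Longrightarrow> rho q i (r i)" by metis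
  have qFI: "q \<in> FI" using q(1) by simp
  \<comment> \<open>Since \<open>p\<close> forces the parameters in \<open>K\<close> apart, no two
    of them share a name; hence \<open>inv_into K r\<close> recovers a subset of \<open>K\<close>
    from its names.\<close>
  have inj: "inj_on r K"
  proof (rule inj_onI, rule ccontr)
    fix i i' assume i: "i \<in> K" "i' \<in> K" "r i = r i'" "i \<noteq> i'"
    have "F q (\<lambda>t. f i' t = f (r i) t)" using rho_eq[OF r[OF i(2)]] i(3) by simp
    then have "F q (\<lambda>t. f i t = f i' t)"
      by (rule F_mono[OF F_conj[OF rho_eq[OF r[OF i(1)]]]]) auto
    then show False using F_up[OF dist[OF i(1,2,4)] q(2) qFI] F_contr by blast
  qed
  define u where "u = r ` K"
  have finu: "finite u" using K(1) by (simp add: u_def)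
  define Y where "Y = {y. y \<subseteq> u \<and> card y = k}"
  have finY: "finite Y" using finu by (auto simp: Y_def)
  have Y: "finite y" "y \<noteq> {}" if "y \<in> Y" for y
    using that finu k(1) finite_subset by (auto simp: Y_def)
  define val where "val y = (if y = {} then G u else if inv_into K r ` y \<in> S then c1 else c0)" for y
  \<comment> \<open>\<open>m\<close> takes the value \<open>val y\<close> at
    \<open>\<beta> y\<close>; the choice is unambiguous because \<open>\<beta>\<close> is injective
    on finite sets.\<close>
  define m where "m a = (if \<exists>y\<in>insert {} Y. a = \<beta> y then Some (val (SOME y. y \<in> insert {} Y \<and> a = \<beta> y)) else None)" for a
  have m: "m (\<beta> y) = Some (val y)" if y: "y \<in> insert {} Y" for y
  proof -
    have "(SOME y'. y' \<in> insert {} Y \<and> \<beta> y = \<beta> y') = y"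
    proof (rule some_equality)
      fix y' assume "y' \<in> insert {} Y \<and> \<beta> y = \<beta> y'"
      then show "y' = y" using inj_onD[OF inj_\<beta>, of y' y] Y y by auto
    qed (use y in simp)
    then show ?thesis using y unfolding m_def by auto
  qed
  have dom_m: "dom m \<subseteq> \<beta> ` insert {} Y" by (auto simp: m_def split: if_splits)
  define q' where "q' = q ++ m"
  have q'FI: "q' \<in> FI"
    using qFI finite_subset[OF dom_m] finY by (auto simp: q'_def FI_def)
  have qq': "q \<subseteq>\<^sub>m q'"
    unfolding map_le_def
  proof
    fix a assume "a \<in> dom q"
    then have "a \<in> d" using q(1) by blast
    then have "a \<notin> dom m" using dom_m fresh Y(1) by blast
    then show "q a = q' a" by (simp add: q'_def map_add_dom_app_simps(3))
  qed
  have q'm: "q' (\<beta> y) = Some (val y)" if "y \<in> insert {} Y" for y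
    using m[OF that] by (simp add: q'_def)
  have val_r: "val (r ` v) = (if v \<in> S then c1 else c0) \<and> r ` v \<in> Y \<and> card (r ` v) = k"
    if v: "v \<subseteq> K" "card v = k" for v
  proof -
    have "card (r ` v) = k" using card_image[OF inj_on_subset[OF inj v(1)]] v(2) by simp
    moreover have "r ` v \<subseteq> u" using v(1) by (auto simp: u_def)
    moreover have "r ` v \<noteq> {}" using v(2) k(1) by auto
    ultimately show ?thesis
      using inv_into_image_cancel[OF inj v(1)] by (simp add: val_def Y_def)
  qed
  have "q' \<in> Q v" if v: "v \<subseteq> K" for v
    unfolding Q_def
  proof (intro CollectI conjI exI[of _ r] ballI impI q'FI)
    show "rho q' i (r i)" if "i \<in> v" for i using rho_up[OF r qq' q'FI] that v by blast
    assume cv: "card v = k"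
    note vr = val_r[OF v cv]
    have b: "q' (\<beta> (r ` v)) = Some (if v \<in> S then c1 else c0)" using q'm[of "r ` v"] vr by simp
    have "linked q' (r ` v)" if vS: "v \<in> S"
      unfolding linked_def
    proof (intro conjI exI[of _ u] allI impI finu)
      show "card (r ` v) = k" using vr by simp
      show "q' (\<beta> (r ` v)) = Some c1" using b vS by simp
      show "r ` v \<subseteq> u" using v by (auto simp: u_def)
      show "q' (\<beta> {}) = Some (G u)" using q'm[of "{}"] by (simp add: val_def)
      fix w assume w: "w \<subseteq> u" "card w = n"
      then obtain w' where w': "w' \<subseteq> K" "w = r ` w'" unfolding u_def by (metis subset_imageE)
      have "card w' = n" using w(2) w' card_image[OF inj_on_subset[OF inj w'(1)]] by simp
      from cons[OF w'(1) this]
      show "(\<exists>z\<subseteq>w. card z = k + 1 \<and> F q' (\<lambda>t. vals t z \<notin> E)) \<or>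
            (\<exists>y'\<subseteq>w. card y' = k \<and> q' (\<beta> y') = Some c0)"
      proof (elim disjE exE conjE)
        fix v' assume v': "v' \<subseteq> w'" "card v' = k" "v' \<notin> S"
        have "v' \<subseteq> K" using v'(1) w'(1) by blast
        note vr' = val_r[OF this v'(2)]
        have "q' (\<beta> (r ` v')) = Some c0" using q'm[of "r ` v'"] vr' v'(3) by simp
        moreover have "r ` v' \<subseteq> w" using v'(1) w'(2) by blast
        ultimately show ?thesis using vr' by blast
      next
        fix z assume z: "z \<subseteq> w'" "card z = k + 1" "F p (\<lambda>t. vals t z \<notin> E)"
        have zK: "z \<subseteq> K" using z(1) w'(1) by blast
        have finz: "finite z" using zK K(1) finite_subset by blast
        have "F q' (\<lambda>t. \<forall>i\<in>z. f i t = f (r i) t)"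
          by (rule F_Ball[OF finz q'FI], rule F_up[OF rho_eq[OF r] qq' q'FI]) (use zK in blast)
        then have "F q' (\<lambda>t. (\<forall>i\<in>z. f i t = f (r i) t) \<and> vals t z \<notin> E)"
          by (rule F_conj) (rule F_up[OF z(3) map_le_trans[OF q(2) qq'] q'FI])
        then have "F q' (\<lambda>t. vals t (r ` z) \<notin> E)"
        proof (rule F_mono)
          fix t assume t: "(\<forall>i\<in>z. f i t = f (r i) t) \<and> vals t z \<notin> E"
          then have "vals t (r ` z) = vals t z" unfolding vals_def image_image by (intro image_cong) auto
          then show "vals t (r ` z) \<notin> E" using t by simp
        qed
        moreover have "r ` z \<subseteq> w" using z(1) w'(2) by blast
        moreover have "card (r ` z) = k + 1"
          using card_image[OF inj_on_subset[OF inj zK]] z(2) by simp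
        ultimately show ?thesis by blast
      qed
    qed
    then show "if v \<in> S then linked q' (r ` v) else q' (\<beta> (r ` v)) = Some c0" using b by simp
  qed
  then show ?thesis using q'FI map_le_trans[OF q(2) qq'] by blast
qed

end

section \<open>Perfect ultrafilters realize types\<close>

text \<open>Fewer than 2^\<lambda> coordinates are excluded, so 2^\<lambda> remain, and only
  \<lambda> finite sets have to be placed.\<close>

lemma exists_fresh_coordinates:
  assumes inf: "infinite (UNIV :: 'l set)" and d: "|d :: 'l set set| <o |UNIV :: 'l set set|"
  shows "\<exists>\<beta> :: 'l set \<Rightarrow> 'l set. inj_on \<beta> {y. finite y} \<and> (\<forall>y. finite y \<longrightarrow> \<beta> y \<notin> d)"
proof -
  have infs: "infinite (UNIV :: 'l set set)" using inf by (simp add: Finite_Set.finite_set)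
  have "\<not> |- d| <o |UNIV :: 'l set set|"
  proof
    assume "|- d| <o |UNIV :: 'l set set|"
    then have "|d \<union> - d| <o |UNIV :: 'l set set|"
      using card_of_Un_ordLess_infinite[OF infs d] by blast
    then have "|UNIV :: 'l set set| <o |UNIV :: 'l set set|" by (simp only: Compl_partition)
    then show False using ordLess_irreflexive by blast
  qed
  then have 1: "|UNIV :: 'l set set| \<le>o |- d|"
    by (simp add: not_ordLess_iff_ordLeq card_of_Well_order)
  have 2: "|Fpow (UNIV :: 'l set)| \<le>o |UNIV :: 'l set|"
    by (rule card_of_Fpow_le[OF inf]) (simp add: card_of_refl ordIso_imp_ordLeq)
  have 3: "|UNIV :: 'l set| \<le>o |UNIV :: 'l set set|"
    using card_of_Pow[of "UNIV :: 'l set"] by (simp add: ordLess_imp_ordLeq)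
  have "|Fpow (UNIV :: 'l set)| \<le>o |- d|"
    by (rule ordLeq_transitive[OF 2 ordLeq_transitive[OF 3 1]])
  then obtain \<beta> where "inj_on \<beta> (Fpow (UNIV :: 'l set))" "\<beta> ` Fpow (UNIV :: 'l set) \<subseteq> - d"
    using card_of_ordLeq by metis
  moreover have "Fpow (UNIV :: 'l set) = {y. finite y}" by (auto simp: Fpow_def)
  ultimately show ?thesis by auto
qed

lemma ba_ultrafilter_Inf:
  fixes D :: "'b::{boolean_algebra, complete_lattice} set"
  assumes D: "ba_ultrafilter D" and M: "finite M" "M \<subseteq> D"
  shows "Inf M \<in> D"
  using M by (induction M) (use D in \<open>auto simp: ba_ultrafilter_def\<close>)

lemma supported_Inf: "(\<And>x. x \<in> S \<Longrightarrow> supported d x) \<Longrightarrow> supported d (Inf S)"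
  using restrict_FI by (auto simp: rep_Inf supp_set_def)

text \<open>As a meet over singletons, \<open>b\<close> is multiplicative at once. The content is
  that such a meet still lies below the value of the joint requirement, by
  \<open>forces_realization\<close>, and that it meets every \<open>c\<close> in \<open>Ds\<close>
  with support \<open>d\<close>, by \<open>generic_realization\<close>.\<close>

lemma generic_refinement:
  fixes I :: "'i set" and j :: "'i set \<Rightarrow> ('l set, 'c) fi_algebra" and f :: "'l \<Rightarrow> 'i \<Rightarrow> 'm"
    and \<sigma> :: "'l \<Rightarrow> 'l set" and V :: "'m set" and E :: "'m set set" and S :: "'l set set" and k :: nat
    and prec :: "'l \<Rightarrow> 'l \<Rightarrow> bool"
  defines "B u \<equiv> {t \<in> I. \<exists>x\<in>V. \<forall>v\<in>u. link_at f E k S v x t}"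
  assumes "parameters I j prec"
    and inf: "infinite (UNIV :: 'l set)" and infc: "infinite (UNIV :: 'c set)"
    and k: "0 < k" "k \<le> n" and f_in: "\<And>i t. i \<in> J \<Longrightarrow> t \<in> I \<Longrightarrow> f i t \<in> V"
    and hyp: "hgraph n k V E"
    and ext: "\<And>X. finite X \<Longrightarrow> X \<subseteq> V \<Longrightarrow> extends_over n k V E X"
    and Pr: "Pr n k TYPE('l) TYPE('c)"
    and Ds: "ba_ultrafilter Ds"
    and \<sigma>: "\<And>i. finite (\<sigma> i) \<and> \<sigma> i \<subseteq> J"
    and dist: "\<And>i i'. i \<in> J \<Longrightarrow> i' \<in> J \<Longrightarrow> i \<noteq> i' \<Longrightarrow> j {t \<in> I. f i t \<noteq> f i' t} \<in> Ds"
    and cons: "\<And>w. w \<subseteq> J \<Longrightarrow> card w = n \<Longrightarrow> (\<exists>v\<subseteq>w. card v = k \<and> v \<notin> S) \<or>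
        (\<exists>z\<subseteq>w. card z = k + 1 \<and> j {t \<in> I. (\<lambda>i. f i t) ` z \<notin> E} \<in> Ds)"
    and d: "|d :: 'l set set| <o |UNIV :: 'l set set|"
    and supp_eq: "\<And>i i'. i \<in> J \<Longrightarrow> i' \<in> J \<Longrightarrow> supported d (j {t \<in> I. f i t = f i' t})"
    and supp_edge: "\<And>z. finite z \<Longrightarrow> supported d (j {t \<in> I. (\<lambda>i. f i t) ` z \<in> E})"
  shows "\<exists>b. multiplicative b \<and> (\<forall>u. finite u \<longrightarrow> b u \<le> j (B (\<sigma> ` u)) \<and>
           (\<forall>c\<in>Ds. supported d c \<longrightarrow> inf c (b u) \<noteq> bot))"
proof -
  obtain \<beta> :: "'l set \<Rightarrow> 'l set" where
    \<beta>: "inj_on \<beta> {y. finite y}" "\<And>y. finite y \<Longrightarrow> \<beta> y \<notin> d"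
    using exists_fresh_coordinates[OF inf d] by blast
  obtain c0 c1 :: 'c where c01: "c0 \<noteq> c1"
    using infc by (metis (full_types) UNIV_I finite.simps finite_subset insertI1 subsetI)
  obtain G :: "'l set \<Rightarrow> 'c" where G: "\<forall>w u. finite w \<and> card w = n \<and>
      (\<forall>v. v \<subseteq> w \<and> card v = k \<longrightarrow> finite (u v) \<and> v \<subseteq> u v) \<and>
      (\<exists>c. \<forall>v. v \<subseteq> w \<and> card v = k \<longrightarrow> G (u v) = c) \<longrightarrow>
      (\<exists>v. v \<subseteq> w \<and> card v = k \<and> w \<subseteq> u v)"
    using Pr unfolding Pr_def by blast
  interpret parameters I j J f prec by (rule assms(2))
  interpret type_over_parameters I j J f prec n k V E S G \<beta> c0 c1
  proof
    show "\<exists>v\<subseteq>w. card v = k \<and> w \<subseteq> u v" if "finite w" "card w = n"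
      "\<And>v. v \<subseteq> w \<Longrightarrow> card v = k \<Longrightarrow> finite (u v) \<and> v \<subseteq> u v \<and> G (u v) = \<epsilon>" for w u \<epsilon>
      using G[rule_format, of w u] that by blast
  qed (use k f_in hyp ext c01 in auto)
  define b where "b u = (INF i\<in>u. Sup (gen ` Q (\<sigma> i)))" for u :: "'l set"
  have "multiplicative b" by (auto simp: multiplicative_def b_def image_Un Inf_union_distrib)
  moreover have "b u \<le> j (B (\<sigma> ` u))" if u: "finite u" for u
  proof (rule rep_leI)
    fix p assume p: "p \<in> rep_fi (b u)"
    define P where "P = {q \<in> FI. p \<subseteq>\<^sub>m q}"
    have "p \<in> P" using p rep_sub map_le_refl by (auto simp: P_def)
    \<comment> \<open>Below \<open>b u\<close> each \<open>Q (\<sigma> i)\<close> is dense, and by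
      \<open>Q_up\<close> it persists under strengthening, so one extension meets all of
      them.\<close>
    have "\<exists>q\<in>P. p \<subseteq>\<^sub>m q \<and> (\<forall>i\<in>u. q \<in> Q (\<sigma> i))"
    proof (rule extend_finite[OF u \<open>p \<in> P\<close>])
      fix i q assume i: "i \<in> u" and q: "q \<in> P"
      have "p \<in> rep_fi (Sup (gen ` Q (\<sigma> i)))" using p i by (auto simp: b_def rep_Inf)
      then have "q \<in> rep_fi (Sup (gen ` Q (\<sigma> i)))" using rep_up q by (auto simp: P_def)
      then obtain h where h: "h \<in> FI" "q \<subseteq>\<^sub>m h" "h \<in> \<Union> (rep_fi ` gen ` Q (\<sigma> i))"
        unfolding rep_Sup pneg_pneg_iff using map_le_refl[of q] by blast
      then obtain g where g: "g \<in> Q (\<sigma> i)" "h \<in> rep_fi (gen g)" by blast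
      then obtain h' where h': "h' \<in> FI" "h \<subseteq>\<^sub>m h'" "g \<subseteq>\<^sub>m h'"
        unfolding rep_gen_iff using map_le_refl[of h] by blast
      have "h' \<in> Q (\<sigma> i)" by (rule Q_up[OF g(1) h'(3,1)])
      moreover have qh: "q \<subseteq>\<^sub>m h'" using h(2) h'(2) map_le_trans by blast
      moreover have "h' \<in> P" using q qh h'(1) map_le_trans by (auto simp: P_def)
      ultimately show "\<exists>q'\<in>P. q \<subseteq>\<^sub>m q' \<and> q' \<in> Q (\<sigma> i)" by blast
    next
      show "q' \<in> Q (\<sigma> i)" if "q \<in> Q (\<sigma> i)" "q \<subseteq>\<^sub>m q'" "q' \<in> P" for i q q'
        using Q_up that by (auto simp: P_def)
    qed
    then obtain q where q: "q \<in> FI" "p \<subseteq>\<^sub>m q" "\<And>v. v \<in> \<sigma> ` u \<Longrightarrow> q \<in> Q v"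
      by (auto simp: P_def)
    have "F q (\<lambda>t. \<exists>x\<in>V. \<forall>v\<in>\<sigma> ` u. \<phi> v x t)"
      by (rule forces_realization) (use u \<sigma> q in auto)
    then have "q \<in> rep_fi (j (B (\<sigma> ` u)))" by (simp add: F_def B_def)
    then show "\<exists>q\<in>FI. p \<subseteq>\<^sub>m q \<and> q \<in> rep_fi (j (B (\<sigma> ` u)))" using q by blast
  qed
  moreover have "inf c (b u) \<noteq> bot" if u: "finite u" and c: "c \<in> Ds" "supported d c" for u c
  proof -
    define K where "K = \<Union> (\<sigma> ` u)"
    have K: "finite K" "K \<subseteq> J" using u \<sigma> by (auto simp: K_def)
    \<comment> \<open>\<open>M1\<close> and \<open>M2\<close> collect the facts about
      \<open>K\<close> that hold in the ultrafilter: distinctness and missing edges. They are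
      finitely many, so together with \<open>c\<close> they have a nonzero meet, and a condition
      below it satisfies the hypotheses of \<open>generic_realization\<close>.\<close>
    define M1 where "M1 = (\<lambda>(i, i'). j {t \<in> I. f i t \<noteq> f i' t}) ` {(i, i'). (i, i') \<in> K \<times> K \<and> i \<noteq> i'}"
    define M2 where "M2 = (\<lambda>z. j {t \<in> I. vals t z \<notin> E}) `
      {z. z \<subseteq> K \<and> j {t \<in> I. vals t z \<notin> E} \<in> Ds}"
    have "finite {(i, i'). (i, i') \<in> K \<times> K \<and> i \<noteq> i'}"
      by (rule finite_subset[of _ "K \<times> K"]) (use K(1) in auto)
    then have M: "finite (M1 \<union> M2)" using K(1) by (simp add: M1_def M2_def)
    have "M1 \<union> M2 \<subseteq> Ds" using dist K(2) by (auto simp: M1_def M2_def)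
    then have "Inf (insert c (M1 \<union> M2)) \<in> Ds"
      using c(1) M by (intro ba_ultrafilter_Inf[OF Ds]) auto
    then have "Inf (insert c (M1 \<union> M2)) \<noteq> bot" using Ds by (auto simp: ba_ultrafilter_def)
    then obtain p0 where p0: "p0 \<in> FI" "gen p0 \<le> Inf (insert c (M1 \<union> M2))"
      using gen_dense by blast
    have "supported d x" if "x \<in> insert c (M1 \<union> M2)" for x
    proof -
      consider "x = c" | i i' where "i \<in> J" "i' \<in> J" "x = j {t \<in> I. f i t \<noteq> f i' t}"
        | z where "z \<subseteq> K" "x = j {t \<in> I. vals t z \<notin> E}"
        using \<open>x \<in> insert c (M1 \<union> M2)\<close> K(2) by (auto simp: M1_def M2_def)
      then show ?thesis
      proof cases
        case (2 i i')
        then show ?thesis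
          using supported_uminus[OF supp_eq[of i i']] j_neg[of "\<lambda>t. f i t = f i' t"] by simp
      next
        case (3 z)
        then have "finite z" using K(1) finite_subset by blast
        then show ?thesis
          using 3 supported_uminus[OF supp_edge[of z]] j_neg[of "\<lambda>t. vals t z \<in> E"]
          by (simp add: vals_def)
      qed (use c in simp)
    qed
    then have "supported d (Inf (insert c (M1 \<union> M2)))" by (rule supported_Inf)
    moreover have "p0 \<in> rep_fi (Inf (insert c (M1 \<union> M2)))" using p0 gen_le_iff by blast
    ultimately have pI: "p0 |` d \<in> rep_fi (Inf (insert c (M1 \<union> M2)))"
      using p0(1) by (simp add: supp_set_def)
    \<comment> \<open>Restricted to \<open>d\<close>, the condition still forces all these facts,
      which have support \<open>d\<close>, and it leaves the coordinates \<open>\<beta> y\<close> of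
      finite \<open>y\<close> undefined.\<close>
    define p where "p = p0 |` d"
    have p: "p \<in> FI_on d" using restrict_FI[OF p0(1), of d] by (simp add: p_def)
    have pM: "p \<in> rep_fi x" if "x \<in> insert c (M1 \<union> M2)" for x
      using pI that unfolding rep_Inf p_def by blast
    have "\<exists>q\<in>FI. p \<subseteq>\<^sub>m q \<and> (\<forall>v\<subseteq>K. q \<in> Q v)"
    proof (rule generic_realization[OF supp_eq \<beta>(2,1) p K])
      show "F p (\<lambda>t. f i t \<noteq> f i' t)" if "i \<in> K" "i' \<in> K" "i \<noteq> i'" for i i'
        unfolding F_def using that by (intro pM) (auto simp: M1_def)
      fix w assume w: "w \<subseteq> K" "card w = n"
      have wJ: "w \<subseteq> J" using w(1) K(2) by blast
      from cons[OF wJ w(2)]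
      show "(\<exists>v\<subseteq>w. card v = k \<and> v \<notin> S) \<or>
          (\<exists>z\<subseteq>w. card z = k + 1 \<and> F p (\<lambda>t. vals t z \<notin> E))"
      proof (elim disjE exE conjE)
        fix z assume z: "z \<subseteq> w" "card z = k + 1" "j {t \<in> I. (\<lambda>i. f i t) ` z \<notin> E} \<in> Ds"
        have "F p (\<lambda>t. vals t z \<notin> E)"
          unfolding F_def using z w(1) by (intro pM) (auto simp: M2_def vals_def)
        then show ?thesis using z by blast
      qed blast
    qed
    then obtain q where q: "q \<in> FI" "p \<subseteq>\<^sub>m q" "\<And>v. v \<subseteq> K \<Longrightarrow> q \<in> Q v" by blast
    have "q \<in> rep_fi c" using rep_up[OF pM[of c] q(2,1)] by simp
    moreover have "q \<in> rep_fi (b u)"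
    proof -
      have "gen q \<le> Sup (gen ` Q (\<sigma> i))" if "i \<in> u" for i
        using q(3)[of "\<sigma> i"] that by (intro Sup_upper) (auto simp: K_def)
      then have "gen q \<le> b u" unfolding b_def by (rule INF_greatest)
      then show ?thesis using gen_le_iff[OF q(1)] by blast
    qed
    ultimately show ?thesis unfolding bot_iff rep_inf by blast
  qed
  ultimately show ?thesis by blast
qed

lemma exists_common_support:
  assumes inf: "infinite (UNIV :: 'l set)" and c: "|UNIV :: 'c set| \<le>o |UNIV :: 'l set|"
    and X: "|X :: ('a, 'c) fi_algebra set| \<le>o |UNIV :: 'l set|"
  shows "\<exists>d. |d| \<le>o |UNIV :: 'l set| \<and> (\<forall>x\<in>X. supported d x)"
proof -
  obtain s :: "('a, 'c) fi_algebra \<Rightarrow> 'a set" where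
    s: "\<And>x. |s x| \<le>o |UNIV :: 'l set| \<and> supported (s x) x"
    using exists_support[OF inf c] by metis
  have "|\<Union>x\<in>X. s x| \<le>o |UNIV :: 'l set|"
    using s by (intro card_of_UNION_ordLeq_infinite[OF inf X]) auto
  moreover have "supported (\<Union>x\<in>X. s x) x" if "x \<in> X" for x
    using supp_set_mono[of "s x"] s[of x] that by blast
  ultimately show ?thesis by blast
qed

lemma is_support_FI_on:
  assumes "\<And>u. finite u \<Longrightarrow> supported d (b u)"
  shows "is_support (gen ` FI_on d) b"
  using assms supported_antichain unfolding is_support_def by blast

text \<open>The hypothesis of perfection is verified for \<open>b\<close>, with the conditions on a
  set \<open>d0\<close> of at most \<lambda> coordinates as support;
  \<open>generic_refinement\<close> then serves every \<open>\<alpha>\<close> beyond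
  \<open>d0\<close>.\<close>

lemma perfect_refinement:
  fixes I :: "'i set" and j :: "'i set \<Rightarrow> ('l set, 'c) fi_algebra" and f :: "'l \<Rightarrow> 'i \<Rightarrow> 'm"
    and \<sigma> :: "'l \<Rightarrow> 'l set" and V :: "'m set" and E :: "'m set set" and S :: "'l set set" and k :: nat
    and prec :: "'l \<Rightarrow> 'l \<Rightarrow> bool"
  defines "B u \<equiv> {t \<in> I. \<exists>x\<in>V. \<forall>v\<in>u. link_at f E k S v x t}"
  assumes par: "parameters I j prec"
    and inf: "infinite (UNIV :: 'l set)" and infc: "infinite (UNIV :: 'c set)"
    and lc: "|UNIV :: 'c set| \<le>o |UNIV :: 'l set|"
    and k: "0 < k" "k \<le> n" and f_in: "\<And>i t. i \<in> J \<Longrightarrow> t \<in> I \<Longrightarrow> f i t \<in> V"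
    and hyp: "hgraph n k V E"
    and ext: "\<And>X. finite X \<Longrightarrow> X \<subseteq> V \<Longrightarrow> extends_over n k V E X"
    and Pr: "Pr n k TYPE('l) TYPE('c)"
    and perf: "perfect Ds"
    and \<sigma>: "\<And>i. finite (\<sigma> i) \<and> \<sigma> i \<subseteq> J"
    and dist: "\<And>i i'. i \<in> J \<Longrightarrow> i' \<in> J \<Longrightarrow> i \<noteq> i' \<Longrightarrow> j {t \<in> I. f i t \<noteq> f i' t} \<in> Ds"
    and cons: "\<And>w. w \<subseteq> J \<Longrightarrow> card w = n \<Longrightarrow> (\<exists>v\<subseteq>w. card v = k \<and> v \<notin> S) \<or>
        (\<exists>z\<subseteq>w. card z = k + 1 \<and> j {t \<in> I. (\<lambda>i. f i t) ` z \<notin> E} \<in> Ds)"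
  shows "\<exists>b. multiplicative b \<and> (\<forall>u. finite u \<longrightarrow> b u \<in> Ds \<and> b u \<le> j (B (\<sigma> ` u)))"
proof -
  interpret parameters I j J f prec by (rule par)
  have Ds: "ba_ultrafilter Ds" using perf by (simp add: perfect_def)
  define b where "b u = j (B (\<sigma> ` u))" for u
  \<comment> \<open>Besides the \<open>b u\<close>, the support has to carry the equalities and
    edges between parameters, since \<open>generic_refinement\<close> needs their values supported
    by the coordinates below \<open>\<alpha>\<close>.\<close>
  define X where "X = (\<lambda>(i, i'). j {t \<in> I. f i t = f i' t}) ` UNIV \<union>
    ((\<lambda>z. j {t \<in> I. (\<lambda>i. f i t) ` z \<in> E}) ` Fpow UNIV \<union> b ` Fpow UNIV)"
  have refl: "|UNIV :: 'l set| \<le>o |UNIV :: 'l set|" by (simp add: card_of_refl ordIso_imp_ordLeq)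
  have Fp: "|Fpow (UNIV :: 'l set)| \<le>o |UNIV :: 'l set|" by (rule card_of_Fpow_le[OF inf refl])
  have "|(UNIV :: 'l set) \<times> (UNIV :: 'l set)| \<le>o |UNIV :: 'l set|"
    using card_of_Times_ordLeq_infinite_Field[OF _ refl refl card_of_Card_order] inf
    by (simp add: Field_card_of del: UNIV_Times_UNIV)
  then have le: "|UNIV :: ('l \<times> 'l) set| \<le>o |UNIV :: 'l set|" by simp
  have un: "|A \<union> A'| \<le>o |UNIV :: 'l set|"
    if "|A| \<le>o |UNIV :: 'l set|" "|A'| \<le>o |UNIV :: 'l set|" for A A' :: "('l set, 'c) fi_algebra set"
    using that inf card_of_Un_ordLeq_infinite_Field[OF _ _ _ card_of_Card_order]
    by (metis Field_card_of)
  have "|X| \<le>o |UNIV :: 'l set|"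
    unfolding X_def
    by (intro un ordLeq_transitive[OF card_of_image le] ordLeq_transitive[OF card_of_image Fp])
  then obtain d0 where d0: "|d0| \<le>o |UNIV :: 'l set|" "\<And>x. x \<in> X \<Longrightarrow> supported d0 x"
    using exists_common_support[OF inf lc] by blast
  have seq: "supported d0 (j {t \<in> I. f i t = f i' t})" for i i'
    by (rule d0(2)) (auto simp: X_def)
  have sed: "supported d0 (j {t \<in> I. (\<lambda>i. f i t) ` z \<in> E})" if "finite z" for z
    by (rule d0(2)) (use that in \<open>auto simp: X_def Fpow_def\<close>)
  have sb: "supported d0 (b u)" if "finite u" for u
    by (rule d0(2)) (use that in \<open>auto simp: X_def Fpow_def\<close>)
  have gen_ref: "\<exists>b'. multiplicative b' \<and> (\<forall>u. finite u \<longrightarrow> b' u \<le> b u \<and>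
           (\<forall>c\<in>Ds. supported d c \<longrightarrow> inf c (b' u) \<noteq> bot))"
    if d: "|d :: 'l set set| <o |UNIV :: 'l set set|" and sub: "d0 \<subseteq> d" for d
    unfolding b_def B_def
    by (rule generic_refinement[OF par inf infc k f_in hyp ext Pr Ds \<sigma> dist cons d])
      (use seq sed supp_set_mono sub in blast)+
  have l2: "|UNIV :: 'l set| <o |UNIV :: 'l set set|"
    using card_of_Pow[of "UNIV :: 'l set"] by simp
  \<comment> \<open>Otherwise \<open>- b u\<close> would be an element of \<open>Ds\<close> with
    support \<open>d0\<close>, and the refinement generic over \<open>d0\<close> would meet it,
    although it lies below \<open>b u\<close>.\<close>
  have bD: "b u \<in> Ds" if u: "finite u" for u
  proof (rule ccontr)
    assume "b u \<notin> Ds"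
    then have "- b u \<in> Ds" using Ds by (auto simp: ba_ultrafilter_def)
    moreover have "supported d0 (- b u)" by (rule supported_uminus[OF sb[OF u]])
    moreover obtain b' where b': "b' u \<le> b u"
      "\<forall>c\<in>Ds. supported d0 c \<longrightarrow> inf c (b' u) \<noteq> bot"
      using gen_ref[OF ordLeq_ordLess_trans[OF d0(1) l2]] u by blast
    ultimately have "inf (- b u) (b' u) \<noteq> bot" by blast
    moreover have "inf (- b u) (b' u) \<le> inf (- b u) (b u)"
      by (rule inf_mono[OF order_refl b'(1)])
    ultimately show False by (simp add: bot_unique)
  qed
  have mon: "monotonic b"
    unfolding monotonic_def b_def by (intro allI impI j_mono) (auto simp: B_def)
  have "|gen ` FI_on d0 :: ('l set, 'c) fi_algebra set| \<le>o |UNIV :: 'l set|"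
    by (rule ordLeq_transitive[OF card_of_image card_of_FI_on_le[OF inf lc d0(1)]])
  moreover have "is_support (gen ` FI_on d0) b" by (rule is_support_FI_on[OF sb])
  moreover have "\<exists>b' :: 'l set \<Rightarrow> ('l set, 'c) fi_algebra.
                 multiplicative b' \<and>
                 (\<forall>u. finite u \<longrightarrow> b' u \<noteq> bot \<and> b' u \<le> b u) \<and>
                 (\<forall>c \<in> complete_subalgebra (gen ` FI_on (below \<alpha>)) \<inter> Ds. c \<noteq> bot \<longrightarrow>
                    (\<forall>F. finite F \<longrightarrow> inf c (INF i\<in>F. sup (b' {i}) (- b {i})) \<noteq> bot))"
    if \<alpha>: "\<forall>f\<in>FI. gen f \<in> gen ` (FI_on d0 :: ('l set \<rightharpoonup> 'c) set) \<longrightarrow> dom f \<subseteq> below \<alpha>" for \<alpha>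
  proof -
    \<comment> \<open>The one-point conditions at elements of \<open>d0\<close> belong to the
      support, so the hypothesis on \<open>\<alpha>\<close> puts \<open>d0\<close> below
      \<open>\<alpha>\<close>; the value \<open>undefined\<close> is arbitrary.\<close>
    have "a \<in> below \<alpha>" if "a \<in> d0" for a
    proof -
      have "[a \<mapsto> (undefined :: 'c)] \<in> FI_on d0" using that by (simp add: FI_def)
      then have "dom [a \<mapsto> (undefined :: 'c)] \<subseteq> below \<alpha>" using \<alpha> by blast
      then show ?thesis by simp
    qed
    moreover have "|below \<alpha>| <o |UNIV :: 'l set set|"
      by (rule card_of_underS[OF card_of_Card_order]) (simp add: Field_card_of)
    ultimately obtain b' where b': "multiplicative b'" "\<And>u. finite u \<Longrightarrow> b' u \<le> b u"
      "\<And>u c. finite u \<Longrightarrow> c \<in> Ds \<Longrightarrow> supported (below \<alpha>) c \<Longrightarrow> inf c (b' u) \<noteq> bot"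
      using gen_ref[of "below \<alpha>"] by blast
    have "inf top (b' u) \<noteq> bot" if "finite u" for u
      using that Ds supported_complete_subalgebra[OF top_complete_subalgebra]
      by (intro b'(3)) (auto simp: ba_ultrafilter_def)
    then have "b' u \<noteq> bot" if "finite u" for u using that by simp
    moreover have "inf c (INF i\<in>F. sup (b' {i}) (- b {i})) \<noteq> bot"
      if "c \<in> complete_subalgebra (gen ` FI_on (below \<alpha>)) \<inter> Ds" "finite F" for c F
    proof -
      \<comment> \<open>Each factor of the finite meet lies above some \<open>b' {i}\<close> and
        hence above \<open>b' F\<close>, so meeting \<open>b' F\<close> is enough.\<close>
      have "b' F \<le> b' {i}" if "i \<in> F" for i
        using b'(1) \<open>finite F\<close> that unfolding multiplicative_def
        by (metis finite.emptyI finite.insertI inf.cobounded1 insert_absorb insert_is_Un)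
      then have "b' F \<le> (INF i\<in>F. sup (b' {i}) (- b {i}))"
        by (intro INF_greatest) (simp add: le_supI1)
      then have "inf c (b' F) \<le> inf c (INF i\<in>F. sup (b' {i}) (- b {i}))"
        by (intro inf_mono) auto
      moreover have "inf c (b' F) \<noteq> bot"
        using that supported_complete_subalgebra by (intro b'(3)) auto
      ultimately show ?thesis by (metis bot.extremum_uniqueI)
    qed
    ultimately show ?thesis using b'(1,2) by (intro exI[of _ b']) blast
  qed
  ultimately have "\<exists>b' :: 'l set \<Rightarrow> ('l set, 'c) fi_algebra.
           multiplicative b' \<and> (\<forall>u. finite u \<longrightarrow> b' u \<in> Ds \<and> b' u \<le> b u)"
    using perf mon bD unfolding perfect_def by blast
  then show ?thesis by (simp add: b_def)
qed

section \<open>Lifting a multiplicative refinement along a good filter\<close>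

lemma filter_on_Ball:
  assumes D: "filter_on I D" and "finite K" "\<And>x. x \<in> K \<Longrightarrow> {t \<in> I. P x t} \<in> D"
  shows "{t \<in> I. \<forall>x\<in>K. P x t} \<in> D"
  using assms(2,3)
proof (induction K)
  case empty
  then show ?case using D by (simp add: filter_on_def)
next
  case (insert x K)
  then have "{t \<in> I. P x t} \<inter> {t \<in> I. \<forall>x\<in>K. P x t} \<in> D"
    using D by (simp add: filter_on_def)
  moreover have "{t \<in> I. P x t} \<inter> {t \<in> I. \<forall>x\<in>K. P x t} = {t \<in> I. \<forall>x\<in>insert x K. P x t}" by blast
  ultimately show ?case by simp
qed

text \<open>Goodness concerns families indexed by finite subsets of \<open>I\<close>; a bijection
  with \<open>'l\<close> transports it. For nonempty \<open>u\<close> multiplicativity makes the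
  refinement at \<open>u\<close> the intersection of its values at singletons, and only those are
  kept.\<close>

lemma good_filter_indexed:
  fixes I :: "'i set" and E :: "'l set \<Rightarrow> 'i set"
  assumes D: "good_filter I D" and card: "|I| =o |UNIV :: 'l set|"
    and E: "\<And>u. finite u \<Longrightarrow> E u \<in> D" and anti: "\<And>u v. finite v \<Longrightarrow> u \<subseteq> v \<Longrightarrow> E v \<subseteq> E u"
  shows "\<exists>g. (\<forall>i. g i \<in> D) \<and> (\<forall>u t. finite u \<and> u \<noteq> {} \<and> (\<forall>i\<in>u. t \<in> g i) \<longrightarrow> t \<in> E u)"
proof -
  obtain \<pi> where \<pi>: "bij_betw \<pi> (UNIV :: 'l set) I"
    using card ordIso_symmetric card_of_ordIso by metis
  have inj: "inj \<pi>" and \<pi>_in: "\<pi> i \<in> I" for i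
    using \<pi> by (auto simp: bij_betw_def)
  define F where "F w = E (\<pi> -` w)" for w
  have fin: "finite (\<pi> -` w)" if "finite w" for w
    using that inj by (rule finite_vimageI)
  have "(\<forall>u. finite u \<and> u \<subseteq> I \<longrightarrow> F u \<in> D) \<and>
      (\<forall>u v. finite v \<and> v \<subseteq> I \<and> u \<subseteq> v \<longrightarrow> F v \<subseteq> F u)"
    unfolding F_def using E fin anti by (metis vimage_mono)
  then obtain g where g: "\<And>u. finite u \<Longrightarrow> u \<subseteq> I \<Longrightarrow> g u \<in> D \<and> g u \<subseteq> F u"
    "\<And>u v. finite u \<Longrightarrow> u \<subseteq> I \<Longrightarrow> finite v \<Longrightarrow> v \<subseteq> I \<Longrightarrow> g (u \<union> v) = g u \<inter> g v"
    using D unfolding good_filter_def by metis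
  have sub: "\<pi> ` u \<subseteq> I" for u using \<pi>_in by blast
  have "t \<in> g (\<pi> ` u)" if "finite u" "u \<noteq> {}" "\<forall>i\<in>u. t \<in> g {\<pi> i}" for u t
    using that
  proof (induction u rule: finite_ne_induct)
    case (insert x u)
    have "g ({\<pi> x} \<union> \<pi> ` u) = g {\<pi> x} \<inter> g (\<pi> ` u)"
      using insert.hyps(1) sub \<pi>_in by (intro g(2)) auto
    then show ?case using insert by simp
  qed simp
  moreover have "g (\<pi> ` u) \<subseteq> E u" if "finite u" for u
    using g(1)[of "\<pi> ` u"] that sub inj by (simp add: F_def inj_vimage_image_eq)
  ultimately have "\<forall>u t. finite u \<and> u \<noteq> {} \<and> (\<forall>i\<in>u. t \<in> g {\<pi> i}) \<longrightarrow> t \<in> E u" by blast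
  moreover have "g {\<pi> i} \<in> D" for i using g(1)[of "{\<pi> i}"] \<pi>_in by simp
  ultimately show ?thesis by (intro exI[of _ "\<lambda>i. g {\<pi> i}"]) blast
qed

lemma regular_filter_indexed:
  fixes I :: "'i set"
  assumes D: "regular_filter I D" and card: "|I| =o |UNIV :: 'l set|"
  shows "\<exists>X :: 'l \<Rightarrow> 'i set. (\<forall>i. X i \<in> D) \<and> (\<forall>t\<in>I. finite {i. t \<in> X i})"
proof -
  obtain \<E> where \<E>: "\<E> \<subseteq> D" "|\<E>| =o |I|" "\<And>t. t \<in> I \<Longrightarrow> finite {A \<in> \<E>. t \<in> A}"
    using D unfolding regular_filter_def by blast
  have "|UNIV :: 'l set| =o |\<E>|"
    using \<E>(2) card ordIso_symmetric ordIso_transitive by metis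
  then obtain X where X: "bij_betw X (UNIV :: 'l set) \<E>" using card_of_ordIso by metis
  then have inj: "inj X" and X_in: "\<And>i. X i \<in> \<E>" by (auto simp: bij_betw_def)
  have "finite {i. t \<in> X i}" if "t \<in> I" for t
  proof -
    have "finite (X -` {A \<in> \<E>. t \<in> A})" using \<E>(3)[OF that] inj by (rule finite_vimageI)
    moreover have "X -` {A \<in> \<E>. t \<in> A} = {i. t \<in> X i}" using X_in by auto
    ultimately show ?thesis by simp
  qed
  then show ?thesis using X_in \<E>(1) by (intro exI[of _ X]) auto
qed

text \<open>Choose \<open>C i\<close> with image \<open>b {i}\<close>. That the \<open>C i\<close>
  with \<open>i\<close> in \<open>u\<close> intersect inside \<open>B u\<close> holds only modulo
  \<open>D0\<close>. Goodness of \<open>D0\<close> removes the errors for all finite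
  \<open>u\<close> at once, and regularity leaves every \<open>t\<close> in finitely many
  \<open>h i\<close>.\<close>

lemma built_from_lift:
  fixes I :: "'i set" and B :: "'l set \<Rightarrow> 'i set" and b :: "'l set \<Rightarrow> 'b::boolean_algebra"
  assumes card: "|I| =o |UNIV :: 'l set|"
    and reg: "regular_filter I D0" and good: "good_filter I D0"
    and Ds: "ba_ultrafilter Ds" and surj: "j ` Pow I = (UNIV :: 'b set)"
    and j_Int: "\<And>A B. A \<subseteq> I \<Longrightarrow> B \<subseteq> I \<Longrightarrow> j (A \<inter> B) = inf (j A) (j B)"
    and j_compl: "\<And>A. A \<subseteq> I \<Longrightarrow> j (I - A) = - j A"
    and D0: "D0 = {A. A \<subseteq> I \<and> j A = top}" and D: "D = {A. A \<subseteq> I \<and> j A \<in> Ds}"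
    and B: "\<And>u. B u \<subseteq> I" "B {} = I"
    and b: "multiplicative b" "\<And>u. finite u \<Longrightarrow> b u \<in> Ds \<and> b u \<le> j (B u)"
  shows "\<exists>h. (\<forall>i. h i \<in> D) \<and> (\<forall>t\<in>I. finite {i. t \<in> h i} \<and> t \<in> B {i. t \<in> h i})"
proof -
  have fil: "filter_on I D0" using reg by (simp add: regular_filter_def)
  have "\<forall>i. \<exists>A. A \<subseteq> I \<and> j A = b {i}" using surj by (metis PowD UNIV_I imageE)
  then obtain C where C: "\<And>i. C i \<subseteq> I \<and> j (C i) = b {i}" by metis
  obtain X where X: "\<And>i :: 'l. X i \<in> D0" "\<And>t. t \<in> I \<Longrightarrow> finite {i. t \<in> X i}"
    using regular_filter_indexed[OF reg card] by blast
  have C_le: "j {t \<in> I. \<forall>i\<in>u. t \<in> C i} = b u" if "finite u" "u \<noteq> {}" for u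
    using that
  proof (induction u rule: finite_ne_induct)
    case (singleton i)
    have "{t \<in> I. \<forall>i\<in>{i}. t \<in> C i} = C i" using C[of i] by blast
    then show ?case using C[of i] by simp
  next
    case (insert i u)
    have "{t \<in> I. \<forall>i\<in>insert i u. t \<in> C i} = C i \<inter> {t \<in> I. \<forall>i\<in>u. t \<in> C i}"
      using C[of i] by blast
    then have "j {t \<in> I. \<forall>i\<in>insert i u. t \<in> C i} = inf (j (C i)) (j {t \<in> I. \<forall>i\<in>u. t \<in> C i})"
      using C[of i] j_Int[of "C i" "{t \<in> I. \<forall>i\<in>u. t \<in> C i}"] by auto
    also have "\<dots> = inf (b {i}) (b u)" using C[of i] insert.IH by simp
    also have "\<dots> = b ({i} \<union> u)"
      using b(1) insert.hyps(1) unfolding multiplicative_def by (metis finite.emptyI finite.insertI)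
    finally show ?case by simp
  qed
  have C_B: "{t \<in> I. (\<forall>i\<in>u. t \<in> C i) \<longrightarrow> t \<in> B u} \<in> D0" if u: "finite u" for u
  proof (cases "u = {}")
    case True
    then show ?thesis using B(2) fil by (simp add: filter_on_def)
  next
    case False
    let ?K = "{t \<in> I. \<forall>i\<in>u. t \<in> C i}"
    have "j ?K \<le> j (B u)" using C_le[OF u False] b(2)[OF u] by simp
    then have "inf (j ?K) (- j (B u)) \<le> inf (j (B u)) (- j (B u))" by (rule inf_mono) simp
    then have "inf (j ?K) (- j (B u)) = bot" by (simp add: bot_unique)
    moreover have "j (?K \<inter> (I - B u)) = inf (j ?K) (j (I - B u))" by (rule j_Int) auto
    ultimately have "j (?K \<inter> (I - B u)) = bot" using j_compl[OF B(1)] by simp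
    then have "j (I - (?K \<inter> (I - B u))) = top" using j_compl[of "?K \<inter> (I - B u)"] by auto
    moreover have "I - (?K \<inter> (I - B u)) = {t \<in> I. (\<forall>i\<in>u. t \<in> C i) \<longrightarrow> t \<in> B u}" by blast
    ultimately show ?thesis by (simp add: D0)
  qed
  \<comment> \<open>Ranging over all subsets \<open>u'\<close> of \<open>u\<close> makes
    \<open>E\<close> decreasing, as goodness requires; the second factor brings in
    regularity.\<close>
  define E where "E u = {t \<in> I. (\<forall>u'\<in>Pow u. (\<forall>i\<in>u'. t \<in> C i) \<longrightarrow> t \<in> B u')} \<inter> {t \<in> I. \<forall>i\<in>u. t \<in> X i}" for u
  have E_D0: "E u \<in> D0" if u: "finite u" for u
  proof -
    have "{t \<in> I. (\<forall>u'\<in>Pow u. (\<forall>i\<in>u'. t \<in> C i) \<longrightarrow> t \<in> B u')} \<in> D0"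
      by (rule filter_on_Ball[OF fil]) (use u C_B finite_subset in auto)
    moreover have "{t \<in> I. \<forall>i\<in>u. t \<in> X i} \<in> D0"
    proof (rule filter_on_Ball[OF fil u])
      fix i
      have "{t \<in> I. t \<in> X i} = X i" using X(1)[of i] fil by (auto simp: filter_on_def)
      then show "{t \<in> I. t \<in> X i} \<in> D0" using X(1) by simp
    qed
    ultimately show ?thesis using fil unfolding E_def filter_on_def by blast
  qed
  have E_anti: "E v \<subseteq> E u" if "u \<subseteq> v" for u v using that by (auto simp: E_def)
  have "\<exists>g. (\<forall>i. g i \<in> D0) \<and> (\<forall>u t. finite u \<and> u \<noteq> {} \<and> (\<forall>i\<in>u. t \<in> g i) \<longrightarrow> t \<in> E u)"
    by (rule good_filter_indexed[OF good card, where E = E]) (simp_all add: E_D0 E_anti)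
  then obtain g where "(\<forall>i. g i \<in> D0) \<and>
      (\<forall>u t. finite u \<and> u \<noteq> {} \<and> (\<forall>i\<in>u. t \<in> g i) \<longrightarrow> t \<in> E u)" ..
  then have g: "\<And>i. g i \<in> D0"
    "\<And>u t. finite u \<Longrightarrow> u \<noteq> {} \<Longrightarrow> \<forall>i\<in>u. t \<in> g i \<Longrightarrow> t \<in> E u"
    by simp_all
  define h where "h i = C i \<inter> g i" for i
  have "h i \<in> D" for i
  proof -
    have gi: "g i \<subseteq> I" "j (g i) = top" using g(1)[of i] by (auto simp: D0)
    have "j (h i) = inf (j (C i)) (j (g i))" unfolding h_def using C gi by (intro j_Int) auto
    then have "j (h i) = b {i}" using C gi by simp
    then have "j (h i) \<in> Ds" using b(2)[of "{i}"] by simp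
    then show ?thesis using C[of i] by (auto simp: D h_def)
  qed
  moreover have "finite {i. t \<in> h i} \<and> t \<in> B {i. t \<in> h i}" if t: "t \<in> I" for t
  proof
    have "t \<in> X i" if "t \<in> h i" for i
      using g(2)[of "{i}" t] that by (auto simp: h_def E_def)
    then have "{i. t \<in> h i} \<subseteq> {i. t \<in> X i}" by blast
    then show fin: "finite {i. t \<in> h i}" by (rule finite_subset[OF _ X(2)[OF t]])
    show "t \<in> B {i. t \<in> h i}"
    proof (cases "{i. t \<in> h i} = {}")
      case True
      then show ?thesis using B(2) t by simp
    next
      case False
      \<comment> \<open>The set of all \<open>i\<close> with \<open>t \<in> h i\<close> is finite by
        now, so it may itself be taken for \<open>u\<close>.\<close>
      have "t \<in> E {i. t \<in> h i}" by (rule g(2)[OF fin False]) (auto simp: h_def)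
      moreover have "\<forall>i\<in>{i. t \<in> h i}. t \<in> C i" by (auto simp: h_def)
      ultimately show ?thesis unfolding E_def by blast
    qed
  qed
  ultimately show ?thesis by (intro exI[of _ h]) simp
qed

text \<open>After lifting, every index \<open>t\<close> is charged with finitely many requirements
  that have a common solution \<open>x t\<close> in \<open>V\<close>, and each requirement is
  charged at a set of indices in \<open>D\<close>.\<close>

lemma perfected_realizes:
  fixes I :: "'i set" and f :: "'l \<Rightarrow> 'i \<Rightarrow> 'm" and J :: "'l set"
  assumes k: "0 < k" "k \<le> n"
    and inf: "infinite (UNIV :: 'l set)" and infc: "infinite (UNIV :: 'c set)"
    and lc: "|UNIV :: 'c set| \<le>o |UNIV :: 'l set|"
    and Pr: "Pr n k TYPE('l) TYPE('c)"
    and perfected: "perfected TYPE('l) TYPE('c) I D"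
    and V: "V \<noteq> {}" and hyp: "hgraph n k V E"
    and ext: "\<And>X. finite X \<Longrightarrow> X \<subseteq> V \<Longrightarrow> extends_over n k V E X"
    and f_in: "\<And>i t. i \<in> J \<Longrightarrow> t \<in> I \<Longrightarrow> f i t \<in> V"
    and dist: "\<And>i i'. i \<in> J \<Longrightarrow> i' \<in> J \<Longrightarrow> i \<noteq> i' \<Longrightarrow> {t \<in> I. f i t = f i' t} \<notin> D"
    and cons: "\<And>w. w \<subseteq> J \<Longrightarrow> card w = n \<Longrightarrow> (\<exists>v\<subseteq>w. card v = k \<and> v \<notin> S) \<or>
        (\<exists>z\<subseteq>w. card z = k + 1 \<and> {t \<in> I. (\<lambda>i. f i t) ` z \<in> E} \<notin> D)"
  shows "\<exists>x. (\<forall>t\<in>I. x t \<in> V) \<and>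
    (\<forall>v. finite v \<and> v \<subseteq> J \<longrightarrow> {t \<in> I. link_at f E k S v (x t) t} \<in> D)"
proof -
  obtain D0 and Ds :: "('l set, 'c) fi_algebra set" where
    card: "|I| =o |UNIV :: 'l set|" and ultra: "ultrafilter_on I D" and
    perf: "perfect Ds" and built: "built_from I D D0 Ds"
    using perfected unfolding perfected_def by blast
  then obtain j where reg: "regular_filter I D0" and good: "good_filter I D0"
    and Ds: "ba_ultrafilter Ds" and surj: "j ` Pow I = UNIV"
    and j_Int: "\<And>A B. A \<subseteq> I \<Longrightarrow> B \<subseteq> I \<Longrightarrow> j (A \<inter> B) = inf (j A) (j B)"
    and j_compl: "\<And>A. A \<subseteq> I \<Longrightarrow> j (I - A) = - j A"
    and D0: "D0 = {A. A \<subseteq> I \<and> j A = top}" and D: "D = {A. A \<subseteq> I \<and> j A \<in> Ds}"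
    unfolding built_from_def by blast
  have fil: "filter_on I D" using ultra by (simp add: ultrafilter_on_def)
  have neg: "j {t \<in> I. \<not> P t} \<in> Ds" if "{t \<in> I. P t} \<notin> D" for P
  proof -
    have "\<forall>A\<subseteq>I. A \<in> D \<or> I - A \<in> D" using ultra by (simp add: ultrafilter_on_def)
    moreover have "{t \<in> I. P t} \<subseteq> I" by blast
    ultimately have "I - {t \<in> I. P t} \<in> D" using that by blast
    moreover have "I - {t \<in> I. P t} = {t \<in> I. \<not> P t}" by blast
    ultimately show ?thesis by (simp add: D)
  qed
  \<comment> \<open>Any well-order will do: it only has to single out canonical names.\<close>
  obtain r where r: "well_order_on (UNIV :: 'l set) r" using well_order_on by blast
  define prec where "prec x y \<longleftrightarrow> (x, y) \<in> r - Id" for x y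
  interpret parameters I j J f prec
  proof
    have "wf (r - Id)" using r by (simp add: well_order_on_def)
    moreover have "{(x, y). prec x y} = r - Id" by (auto simp: prec_def)
    ultimately show "wfP prec" by (simp add: wfp_def)
    show "prec x y \<or> prec y x" if "x \<noteq> y" for x y
      using r that unfolding well_order_on_def linear_order_on_def total_on_def prec_def by blast
  qed (use j_Int j_compl in auto)
  have refl: "|J| \<le>o |UNIV :: 'l set|" by (rule card_of_mono1) simp
  \<comment> \<open>The requirements belong to finite subsets of \<open>J\<close>, of which there
    are at most \<lambda>. Enumerated by \<open>'l\<close>, they give a family of the kind that
    perfection treats.\<close>
  have "\<exists>\<sigma>. \<sigma> ` (UNIV :: 'l set) = Fpow J"
    using card_of_Fpow_le[OF inf refl] card_of_ordLeq2 Fpow_not_empty by metis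
  then obtain \<sigma> where \<sigma>_range: "\<sigma> ` (UNIV :: 'l set) = Fpow J" by blast
  have \<sigma>: "finite (\<sigma> i) \<and> \<sigma> i \<subseteq> J" for i
    using \<sigma>_range by (auto simp: Fpow_def)
  define B where "B u = {t \<in> I. \<exists>x\<in>V. \<forall>v\<in>\<sigma> ` u. link_at f E k S v x t}" for u
  have "\<exists>b. multiplicative b \<and> (\<forall>u. finite u \<longrightarrow> b u \<in> Ds \<and> b u \<le> j (B u))"
    unfolding B_def
  proof (rule perfect_refinement[OF parameters_axioms inf infc lc k f_in hyp ext Pr perf \<sigma>])
    show "j {t \<in> I. f i t \<noteq> f i' t} \<in> Ds" if "i \<in> J" "i' \<in> J" "i \<noteq> i'" for i i'
      by (rule neg[OF dist[OF that]])
    show "(\<exists>v\<subseteq>w. card v = k \<and> v \<notin> S) \<or>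
        (\<exists>z\<subseteq>w. card z = k + 1 \<and> j {t \<in> I. (\<lambda>i. f i t) ` z \<notin> E} \<in> Ds)"
      if "w \<subseteq> J" "card w = n" for w
      using cons[OF that] neg[of "\<lambda>t. (\<lambda>i. f i t) ` z \<in> E" for z] by blast
  qed
  then obtain b where b: "multiplicative b" "\<And>u. finite u \<Longrightarrow> b u \<in> Ds \<and> b u \<le> j (B u)" by blast
  have "\<exists>h. (\<forall>i. h i \<in> D) \<and> (\<forall>t\<in>I. finite {i. t \<in> h i} \<and> t \<in> B {i. t \<in> h i})"
    by (rule built_from_lift[OF card reg good Ds surj j_Int j_compl D0 D _ _ b])
      (use V in \<open>auto simp: B_def\<close>)
  then obtain h where h: "\<And>i. h i \<in> D" "\<And>t. t \<in> I \<Longrightarrow> t \<in> B {i. t \<in> h i}" by blast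
  have "\<forall>t\<in>I. \<exists>x\<in>V. \<forall>v\<in>\<sigma> ` {i. t \<in> h i}. link_at f E k S v x t"
    using h(2) unfolding B_def by blast
  then obtain x where x: "\<And>t. t \<in> I \<Longrightarrow> x t \<in> V"
    "\<And>t i. t \<in> I \<Longrightarrow> t \<in> h i \<Longrightarrow> link_at f E k S (\<sigma> i) (x t) t"
    by (metis imageI mem_Collect_eq)
  have "{t \<in> I. link_at f E k S v (x t) t} \<in> D" if "finite v" "v \<subseteq> J" for v
  proof -
    have "v \<in> \<sigma> ` UNIV" unfolding \<sigma>_range using that by (simp add: Fpow_def)
    then obtain i where i: "v = \<sigma> i" by blast
    have "h i \<subseteq> I" using h(1)[of i] by (simp add: D)
    then have "h i \<subseteq> {t \<in> I. link_at f E k S v (x t) t}" using x(2) i by blast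
    moreover have "{t \<in> I. link_at f E k S v (x t) t} \<subseteq> I" by blast
    ultimately show ?thesis using fil h(1)[of i] unfolding filter_on_def by blast
  qed
  then show ?thesis using x(1) by blast
qed

section \<open>Saturation from one-point extensions\<close>

definition partial_iso :: "'m rstruct \<Rightarrow> 'm set \<Rightarrow> ('m \<Rightarrow> 'm) \<Rightarrow> bool" where
  "partial_iso N A g \<longleftrightarrow> finite A \<and> A \<subseteq> univ N \<and> inj_on g A \<and> g ` A \<subseteq> univ N \<and>
     (\<forall>X\<subseteq>A. X \<in> edges N \<longleftrightarrow> g ` X \<in> edges N)"

lemma partial_iso_inverse:
  assumes "partial_iso N A g"
  shows "partial_iso N (g ` A) (inv_into A g)"
proof -
  have inj: "inj_on g A" using assms by (simp add: partial_iso_def)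
  have "X \<in> edges N \<longleftrightarrow> inv_into A g ` X \<in> edges N" if X: "X \<subseteq> g ` A" for X
  proof -
    obtain Y where Y: "Y \<subseteq> A" "X = g ` Y" using X by (metis subset_imageE)
    then have "inv_into A g ` X = Y" using inv_into_image_cancel[OF inj] by simp
    then show ?thesis using Y assms by (simp add: partial_iso_def)
  qed
  then show ?thesis
    using assms inj inv_into_image_cancel[OF inj subset_refl]
    by (simp add: partial_iso_def inj_on_inv_into)
qed

text \<open>A set through \<open>a\<close> can be an edge only if its remainder has exactly
  \<open>k\<close> elements, so the link on \<open>k\<close>-sets decides everything.\<close>

lemma partial_iso_insert:
  assumes hyp: "hgraph n k (univ N) (edges N)" and g: "partial_iso N A g"
    and ab: "a \<in> univ N - A" "b \<in> univ N - g ` A"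
    and link: "\<And>X. X \<subseteq> A \<Longrightarrow> card X = k \<Longrightarrow> insert b (g ` X) \<in> edges N \<longleftrightarrow> insert a X \<in> edges N"
  shows "partial_iso N (insert a A) (g(a := b))"
proof -
  have fin: "finite A" and inj: "inj_on g A" using g by (simp_all add: partial_iso_def)
  have img: "(g(a := b)) ` X = g ` X" if "X \<subseteq> A" for X
    using that ab(1) by (intro image_cong) auto
  have edge_card: "card e = k + 1" if "e \<in> edges N" for e
    using hyp that by (auto simp: hgraph_def)
  have "X \<in> edges N \<longleftrightarrow> (g(a := b)) ` X \<in> edges N" if X: "X \<subseteq> insert a A" for X
  proof (cases "a \<in> X")
    case False
    then have "X \<subseteq> A" using X by blast
    then show ?thesis using img g by (simp add: partial_iso_def)
  next
    case True
    define Y where "Y = X - {a}"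
    have Y: "X = insert a Y" "Y \<subseteq> A" "a \<notin> Y" "finite Y"
      using True X fin finite_subset by (auto simp: Y_def)
    have gX: "(g(a := b)) ` X = insert b (g ` Y)" unfolding Y(1) image_insert img[OF Y(2)] by simp
    have bY: "b \<notin> g ` Y" using ab(2) Y(2) by blast
    have cY: "card (g ` Y) = card Y" by (rule card_image[OF inj_on_subset[OF inj Y(2)]])
    show ?thesis
    proof (cases "card Y = k")
      case True
      then show ?thesis using link[OF Y(2)] gX Y(1) by simp
    next
      case False
      then have "card X \<noteq> k + 1" "card (insert b (g ` Y)) \<noteq> k + 1"
        using Y bY cY by simp_all
      then show ?thesis using edge_card gX by metis
    qed
  qed
  moreover have "inj_on (g(a := b)) (insert a A)"
    using inj ab by (auto simp: inj_on_def)
  ultimately show ?thesis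
    using g ab fin img[OF subset_refl] by (auto simp: partial_iso_def)
qed

text \<open>The link of \<open>a\<close> over \<open>A\<close>, transported by \<open>g\<close>, is
  admissible over the image, because a violation would pull back to a complete hypergraph on
  \<open>a\<close> and \<open>n\<close> elements of \<open>A\<close>.\<close>

lemma partial_iso_extend:
  assumes hyp: "hgraph n k (univ N) (edges N)" and k: "0 < k" "k \<le> n"
    and ext: "\<And>X. finite X \<Longrightarrow> X \<subseteq> univ N \<Longrightarrow> extends_over n k (univ N) (edges N) X"
    and g: "partial_iso N A g" and a: "a \<in> univ N"
  shows "\<exists>g'. partial_iso N (insert a A) g' \<and> (\<forall>y\<in>A. g' y = g y)"
proof (cases "a \<in> A")
  case True
  then show ?thesis using g by (intro exI[of _ g]) (simp add: insert_absorb)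
next
  case False
  have fin: "finite A" and inj: "inj_on g A" and sub: "A \<subseteq> univ N" "g ` A \<subseteq> univ N"
    and iso: "\<And>X. X \<subseteq> A \<Longrightarrow> X \<in> edges N \<longleftrightarrow> g ` X \<in> edges N"
    using g by (simp_all add: partial_iso_def)
  have card_g: "card (g ` X) = card X" if "X \<subseteq> A" for X
    by (rule card_image[OF inj_on_subset[OF inj that]])
  define S where "S = (\<lambda>X. g ` X) ` {X. X \<subseteq> A \<and> card X = k \<and> insert a X \<in> edges N}"
  have S_iff: "g ` X \<in> S \<longleftrightarrow> insert a X \<in> edges N" if X: "X \<subseteq> A" "card X = k" for X
  proof
    assume "g ` X \<in> S"
    then obtain X' where "X' \<subseteq> A" "g ` X = g ` X'" "insert a X' \<in> edges N" by (auto simp: S_def)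
    then show "insert a X \<in> edges N" using inj_on_image_eq_iff[OF inj X(1)] by simp
  qed (use X in \<open>auto simp: S_def\<close>)
  have "admissible n k (edges N) (g ` A) S"
    unfolding admissible_def
  proof (intro conjI ballI allI impI)
    fix Y assume "Y \<in> S"
    then obtain X where X: "X \<subseteq> A" "card X = k" "Y = g ` X" by (auto simp: S_def)
    then show "Y \<subseteq> g ` A" "finite Y" "card Y = k"
      using card_g finite_subset[OF X(1) fin] by auto
  next
    fix W assume W: "W \<subseteq> g ` A" "card W = n"
    obtain w where w: "w \<subseteq> A" "W = g ` w" using W(1) by (metis subset_imageE)
    have "card w = n" using W w card_g by simp
    then have "card (insert a w) = n + 1" "insert a w \<subseteq> univ N"
      using False a w(1) sub finite_subset[OF w(1) fin] by (auto simp: card_insert_if)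
    then obtain Z where Z: "Z \<subseteq> insert a w" "card Z = k + 1" "Z \<notin> edges N"
      using hyp unfolding hgraph_def by metis
    show "(\<exists>Y\<subseteq>W. card Y = k \<and> Y \<notin> S) \<or> (\<exists>Z\<subseteq>W. card Z = k + 1 \<and> Z \<notin> edges N)"
    proof (cases "a \<in> Z")
      case True
      have X: "Z - {a} \<subseteq> A" "card (Z - {a}) = k" "insert a (Z - {a}) = Z"
        using Z(1,2) True w(1) by auto
      then have "g ` (Z - {a}) \<notin> S" using S_iff[OF X(1,2)] Z(3) by simp
      moreover have "g ` (Z - {a}) \<subseteq> W" using Z(1) w(2) by blast
      ultimately show ?thesis using card_g[OF X(1)] X(2) by metis
    next
      case False
      then have ZA: "Z \<subseteq> w" "Z \<subseteq> A" using Z(1) w(1) by auto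
      then have "g ` Z \<notin> edges N" "g ` Z \<subseteq> W" "card (g ` Z) = k + 1"
        using iso Z w(2) card_g by auto
      then show ?thesis by blast
    qed
  qed
  then obtain b where b: "b \<in> univ N - g ` A"
    "\<And>Y. Y \<subseteq> g ` A \<Longrightarrow> finite Y \<Longrightarrow> card Y = k \<Longrightarrow> insert b Y \<in> edges N \<longleftrightarrow> Y \<in> S"
    using ext[of "g ` A"] fin sub(2) unfolding extends_over_def by blast
  have "partial_iso N (insert a A) (g(a := b))"
  proof (rule partial_iso_insert[OF hyp g _ b(1)])
    fix X assume X: "X \<subseteq> A" "card X = k"
    have "insert b (g ` X) \<in> edges N \<longleftrightarrow> g ` X \<in> S"
      using X card_g[OF X(1)] finite_subset[OF X(1) fin] by (intro b(2)) auto
    then show "insert b (g ` X) \<in> edges N \<longleftrightarrow> insert a X \<in> edges N" using S_iff[OF X] by simp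
  qed (use a False in auto)
  then show ?thesis using False by (intro exI[of _ "g(a := b)"]) auto
qed

text \<open>Back-and-forth: at a quantifier either the map or its inverse is extended to the new
  element. This is quantifier elimination in semantic form.\<close>

lemma sat_partial_iso:
  assumes N: "hgraph_struct n k N" and k: "0 < k" "k \<le> n"
    and ext: "\<And>X. finite X \<Longrightarrow> X \<subseteq> univ N \<Longrightarrow> extends_over n k (univ N) (edges N) X"
  shows "partial_iso N A g \<Longrightarrow> v ` fv p \<subseteq> A \<Longrightarrow> sat N v p \<longleftrightarrow> sat N (g \<circ> v) p"
proof (induction p arbitrary: A g v)
  case (Eq i l)
  then have "inj_on g A" "v i \<in> A" "v l \<in> A" by (auto simp: partial_iso_def)
  then show ?case by (simp add: inj_on_eq_iff)
next
  case (Rel xs)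
  have sub: "set (map v xs) \<subseteq> A" using Rel.prems by auto
  have inj: "inj_on g (set (map v xs))"
    using Rel.prems(1) inj_on_subset sub unfolding partial_iso_def by blast
  have rel: "ys \<in> rel N \<longleftrightarrow> distinct ys \<and> set ys \<in> edges N" for ys
    using N by (simp add: hgraph_struct_def)
  have "map (g \<circ> v) xs \<in> rel N \<longleftrightarrow> distinct (map g (map v xs)) \<and> g ` set (map v xs) \<in> edges N"
    unfolding rel by (simp add: image_image)
  also have "\<dots> \<longleftrightarrow> distinct (map v xs) \<and> set (map v xs) \<in> edges N"
  proof -
    have "distinct (map g (map v xs)) \<longleftrightarrow> distinct (map v xs)"
      unfolding distinct_map[of g] using inj by blast
    moreover have "g ` set (map v xs) \<in> edges N \<longleftrightarrow> set (map v xs) \<in> edges N"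
      using sub Rel.prems(1) unfolding partial_iso_def by blast
    ultimately show ?thesis by (simp only:)
  qed
  finally show ?case unfolding sat.simps rel[of "map v xs"] by (rule sym)
next
  case (Imp p q)
  have "sat N v p \<longleftrightarrow> sat N (g \<circ> v) p" using Imp.prems by (intro Imp.IH(1)[of A]) auto
  moreover have "sat N v q \<longleftrightarrow> sat N (g \<circ> v) q" using Imp.prems by (intro Imp.IH(2)[of A]) auto
  ultimately show ?case unfolding sat.simps by simp
next
  case (All i p)
  have hyp: "hgraph n k (univ N) (edges N)" using N by (simp add: hgraph_struct_def)
  have vA: "v l \<in> A" if "l \<in> fv p" "l \<noteq> i" for l using All.prems(2) that by auto
  have inj: "inj_on g A" using All.prems(1) by (simp add: partial_iso_def)
  show ?case
  proof
    assume l: "sat N v (All i p)"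
    have "sat N ((g \<circ> v)(i := b)) p" if b: "b \<in> univ N" for b
    proof -
      obtain h where h: "partial_iso N (insert b (g ` A)) h" "\<And>y. y \<in> g ` A \<Longrightarrow> h y = inv_into A g y"
        using partial_iso_extend[OF hyp k ext partial_iso_inverse[OF All.prems(1)] b] by blast
      have "h b \<in> univ N" using h(1) by (simp add: partial_iso_def)
      then have "sat N (v(i := h b)) p" using l unfolding sat.simps by blast
      moreover have "sat N ((g \<circ> v)(i := b)) p \<longleftrightarrow> sat N (h \<circ> (g \<circ> v)(i := b)) p"
        by (rule All.IH[OF h(1)]) (use vA in auto)
      moreover have "sat N (h \<circ> (g \<circ> v)(i := b)) p \<longleftrightarrow> sat N (v(i := h b)) p"
        by (rule sat_cong) (use vA h(2) inj in auto)
      ultimately show ?thesis by (simp only:)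
    qed
    then show "sat N (g \<circ> v) (All i p)" unfolding sat.simps by blast
  next
    assume r: "sat N (g \<circ> v) (All i p)"
    have "sat N (v(i := a)) p" if a: "a \<in> univ N" for a
    proof -
      obtain h where h: "partial_iso N (insert a A) h" "\<And>y. y \<in> A \<Longrightarrow> h y = g y"
        using partial_iso_extend[OF hyp k ext All.prems(1) a] by blast
      have "h a \<in> univ N" using h(1) by (simp add: partial_iso_def)
      then have "sat N ((g \<circ> v)(i := h a)) p" using r unfolding sat.simps by blast
      moreover have "sat N (v(i := a)) p \<longleftrightarrow> sat N (h \<circ> v(i := a)) p"
        by (rule All.IH[OF h(1)]) (use vA in auto)
      moreover have "sat N (h \<circ> v(i := a)) p \<longleftrightarrow> sat N ((g \<circ> v)(i := h a)) p"
        by (rule sat_cong) (use vA h(2) in auto)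
      ultimately show ?thesis by (simp only:)
    qed
    then show "sat N v (All i p)" unfolding sat.simps by blast
  qed
qed (simp add: sat.simps(1))

section \<open>Complete types over a set of parameters\<close>

definition realizes :: "'m rstruct \<Rightarrow> 'm \<Rightarrow> (fm \<times> (nat \<Rightarrow> 'm)) set \<Rightarrow> bool" where
  "realizes N a Q \<longleftrightarrow> a \<in> univ N \<and> (\<forall>(p, v)\<in>Q. sat N (v(0 := a)) p)"

lemma is_type_over_realizes:
  "is_type_over r N A P \<longleftrightarrow> (\<forall>(p, v)\<in>P. wf_fm r p \<and> v ` (fv p - {0}) \<subseteq> A) \<and>
     (\<forall>Q\<subseteq>P. finite Q \<longrightarrow> (\<exists>a. realizes N a Q))"
  unfolding is_type_over_def realizes_def by blast

lemma realizes_mono: "realizes N a Q \<Longrightarrow> Q' \<subseteq> Q \<Longrightarrow> realizes N a Q'"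
  unfolding realizes_def by blast

text \<open>A maximal finitely satisfiable set is complete: if both \<open>p\<close> and its
  negation were refuted by finite parts, an element realizing the two parts together would satisfy
  one of them.\<close>

lemma complete_type_exists:
  assumes P: "is_type_over r N A P"
  shows "\<exists>P'. P \<subseteq> P' \<and> is_type_over r N A P' \<and>
    (\<forall>p v. wf_fm r p \<and> v ` (fv p - {0}) \<subseteq> A \<longrightarrow> (p, v) \<in> P' \<or> (Imp p Fls, v) \<in> P')"
proof -
  define T where "T = {P'. P \<subseteq> P' \<and> is_type_over r N A P'}"
  have "\<exists>M\<in>T. \<forall>X\<in>T. M \<subseteq> X \<longrightarrow> X = M"
  proof (rule subset_Zorn_nonempty)
    show "T \<noteq> {}" using P by (auto simp: T_def)
    fix C assume ne: "C \<noteq> {}" and C: "subset.chain T C"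
    have CT: "C \<subseteq> T" using C by (simp add: subset.chain_def)
    have "\<exists>a. realizes N a Q" if Q: "Q \<subseteq> \<Union>C" "finite Q" for Q
    proof -
      obtain X where X: "X \<in> C" "Q \<subseteq> X"
        using finite_subset_Union_chain[OF Q(2,1) ne C] by blast
      then have "is_type_over r N A X" using CT by (auto simp: T_def)
      then show ?thesis using X(2) Q(2) by (simp add: is_type_over_realizes)
    qed
    moreover have "\<forall>(p, v)\<in>\<Union>C. wf_fm r p \<and> v ` (fv p - {0}) \<subseteq> A"
    proof -
      have "\<forall>X\<in>C. is_type_over r N A X" using CT by (auto simp: T_def)
      then show ?thesis unfolding is_type_over_def by blast
    qed
    moreover have "P \<subseteq> \<Union>C" using ne CT by (auto simp: T_def)
    ultimately show "\<Union>C \<in> T" by (simp add: T_def is_type_over_realizes)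
  qed
  then obtain P' where P': "P' \<in> T" and max: "\<And>X. X \<in> T \<Longrightarrow> P' \<subseteq> X \<Longrightarrow> X = P'" by blast
  have ty: "is_type_over r N A P'" "P \<subseteq> P'" using P' by (simp_all add: T_def)
  have neg: "\<exists>Q\<subseteq>P'. finite Q \<and> (\<forall>a. \<not> realizes N a (insert (q, v) Q))"
    if q: "wf_fm r q" "v ` (fv q - {0}) \<subseteq> A" "(q, v) \<notin> P'" for q v
  proof (rule ccontr)
    assume n: "\<not> ?thesis"
    have "\<exists>a. realizes N a Q" if Q: "Q \<subseteq> insert (q, v) P'" "finite Q" for Q
    proof -
      have "Q - {(q, v)} \<subseteq> P'" "finite (Q - {(q, v)})" using Q by auto
      then obtain a where "realizes N a (insert (q, v) (Q - {(q, v)}))" using n by blast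
      then have "realizes N a Q" by (rule realizes_mono) blast
      then show ?thesis by blast
    qed
    then have "is_type_over r N A (insert (q, v) P')"
      using ty(1) q(1,2) by (simp add: is_type_over_realizes)
    then have "insert (q, v) P' \<in> T" using ty(2) by (auto simp: T_def)
    then show False using max[of "insert (q, v) P'"] q(3) by blast
  qed
  have "(p, v) \<in> P' \<or> (Imp p Fls, v) \<in> P'" if p: "wf_fm r p" "v ` (fv p - {0}) \<subseteq> A" for p v
  proof (rule ccontr)
    assume n: "\<not> ?thesis"
    then obtain Q1 where Q1: "Q1 \<subseteq> P'" "finite Q1" "\<And>a. \<not> realizes N a (insert (p, v) Q1)"
      using neg[OF p] by blast
    obtain Q2 where Q2: "Q2 \<subseteq> P'" "finite Q2" "\<And>a. \<not> realizes N a (insert (Imp p Fls, v) Q2)"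
      using neg[of "Imp p Fls" v] p n by auto
    have "Q1 \<union> Q2 \<subseteq> P'" "finite (Q1 \<union> Q2)" using Q1 Q2 by auto
    then obtain a where a: "realizes N a (Q1 \<union> Q2)" using ty(1) unfolding is_type_over_realizes by blast
    then show False
      using Q1(3)[of a] Q2(3)[of a] by (auto simp: realizes_def)
  qed
  then show ?thesis using ty by blast
qed

text \<open>A complete extension \<open>P'\<close> of the type either equates the element with a
  parameter or determines a link \<open>S\<close> over \<open>A\<close>. A vertex with link
  \<open>S\<close> realizes the type: each formula concerns finitely many parameters, over which the
  vertex looks like an element that realizes the formula together with the relevant finite part of
  \<open>P'\<close>.\<close>

lemma saturated_of_extends_over:
  fixes N :: "'n rstruct"
  assumes N: "hgraph_struct n k N" and k: "0 < k" "k \<le> n" and inf: "infinite (UNIV :: 'l set)"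
    and ext: "\<And>A. A \<subseteq> univ N \<Longrightarrow> |A| \<le>o |UNIV :: 'l set| \<Longrightarrow> extends_over n k (univ N) (edges N) A"
  shows "saturated (k + 1) (cardSuc |UNIV :: 'l set| ) N"
  unfolding saturated_def
proof (intro allI impI)
  fix A P assume *: "A \<subseteq> univ N \<and> |A| <o cardSuc |UNIV :: 'l set| \<and> is_type_over (k + 1) N A P"
  have A: "A \<subseteq> univ N" using * by blast
  have cA: "|A| \<le>o |UNIV :: 'l set|"
    using * by (simp add: cardSuc_ordLeq_ordLess card_of_Card_order)
  have hyp: "hgraph n k (univ N) (edges N)" using N by (simp add: hgraph_struct_def)
  have rel: "xs \<in> rel N \<longleftrightarrow> distinct xs \<and> set xs \<in> edges N" for xs
    using N by (simp add: hgraph_struct_def)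
  have edge_card: "card e = k + 1" if "e \<in> edges N" for e
    using hyp that by (auto simp: hgraph_def)
  have ext_fin: "extends_over n k (univ N) (edges N) X" if "finite X" "X \<subseteq> univ N" for X
  proof (rule ext[OF that(2)])
    show "|X| \<le>o |UNIV :: 'l set|"
      using that(1) inf finite_ordLess_infinite[OF card_of_Well_order card_of_Well_order]
      by (intro ordLess_imp_ordLeq) (simp add: Field_card_of)
  qed
  have "is_type_over (k + 1) N A P" using * by blast
  then obtain P' where P': "P \<subseteq> P' \<and> is_type_over (k + 1) N A P' \<and> (\<forall>p v.
      wf_fm (k + 1) p \<and> v ` (fv p - {0}) \<subseteq> A \<longrightarrow> (p, v) \<in> P' \<or> (Imp p Fls, v) \<in> P')"
    using complete_type_exists by metis
  have PP': "P \<subseteq> P'" and ty: "is_type_over (k + 1) N A P'" using P' by simp_all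
  have compl: "(p, v) \<in> P' \<or> (Imp p Fls, v) \<in> P'"
    if "wf_fm (k + 1) p" "v ` (fv p - {0}) \<subseteq> A" for p v
    using P' that by simp
  have "\<forall>Q\<subseteq>P'. finite Q \<longrightarrow> (\<exists>a. realizes N a Q)"
    using ty unfolding is_type_over_realizes ..
  then have fin_real: "\<exists>a. realizes N a Q" if "Q \<subseteq> P'" "finite Q" for Q
    using that by simp
  have "\<exists>a. realizes N a P"
  proof (cases "\<exists>a\<in>A. (Eq 0 1, \<lambda>_. a) \<in> P'")
    case True
    then obtain a where a: "a \<in> A" "(Eq 0 1, \<lambda>_. a) \<in> P'" by blast
    have "sat N (v(0 := a)) p" if pv: "(p, v) \<in> P" for p v
    proof -
      obtain c where c: "realizes N c {(p, v), (Eq 0 1, \<lambda>_. a)}"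
        using fin_real[of "{(p, v), (Eq 0 1, \<lambda>_. a)}"] a(2) pv PP' by blast
      then have "c = a" "sat N (v(0 := c)) p" by (auto simp: realizes_def)
      then show ?thesis by simp
    qed
    then show ?thesis using a(1) A by (intro exI[of _ a]) (auto simp: realizes_def)
  next
    case False
    have neq: "(Imp (Eq 0 1) Fls, \<lambda>_. a) \<in> P'" if "a \<in> A" for a
      using compl[of "Eq 0 1" "\<lambda>_. a"] False that by auto
    \<comment> \<open>A \<open>k\<close>-set of parameters is listed in the variables
      \<open>1\<close> to \<open>k\<close>, hence the index \<open>i - 1\<close> below; variable
      \<open>0\<close> is the element sought.\<close>
    define en where "en Y = (SOME ys. set ys = Y \<and> distinct ys)" for Y :: "'n set"
    have en: "set (en Y) = Y \<and> distinct (en Y)" if "finite Y" for Y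
      unfolding en_def by (rule someI_ex) (use finite_distinct_list[OF that] in blast)
    define par where "par Y i = en Y ! (i - 1)" for Y :: "'n set" and i :: nat
    let ?R = "Rel [0..<k+1]"
    have par_map: "map ((par Y)(0 := c)) [0..<k+1] = c # en Y" if "finite Y" "card Y = k" for Y c
    proof -
      have len: "length (en Y) = k" using en[OF that(1)] that(2) distinct_card by force
      show ?thesis
        by (rule nth_equalityI) (use len in \<open>auto simp: par_def nth_Cons' simp del: upt_Suc\<close>)
    qed
    have sat_R: "sat N ((par Y)(0 := c)) ?R \<longleftrightarrow> c \<notin> Y \<and> insert c Y \<in> edges N"
      if "finite Y" "card Y = k" for Y c
      unfolding sat.simps par_map[OF that] rel using en[OF that(1)] by simp
    have R_ok: "wf_fm (k + 1) ?R \<and> par Y ` (fv ?R - {0}) \<subseteq> A" if "Y \<subseteq> A" "finite Y" "card Y = k" for Y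
    proof -
      have len: "length (en Y) = k" using en[OF that(2)] that(3) distinct_card by force
      have "par Y i \<in> Y" if "0 < i" "i < k + 1" for i
        using that len en[OF \<open>finite Y\<close>] nth_mem[of "i - 1" "en Y"] by (auto simp: par_def)
      then have "par Y i \<in> A" if "i \<in> {0..<k+1} - {0}" for i using that \<open>Y \<subseteq> A\<close> by auto
      then have "par Y ` ({0..<k+1} - {0}) \<subseteq> A" by (rule image_subsetI)
      then show ?thesis by (simp del: upt_Suc)
    qed
    define S where "S = {Y. Y \<subseteq> A \<and> finite Y \<and> card Y = k \<and> (?R, par Y) \<in> P'}"
    have claim: "\<exists>c. realizes N c Q \<and> c \<notin> A0 \<and>
        (\<forall>Y\<subseteq>A0. card Y = k \<longrightarrow> (insert c Y \<in> edges N \<longleftrightarrow> Y \<in> S))"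
      if Q: "Q \<subseteq> P'" "finite Q" and A0: "finite A0" "A0 \<subseteq> A" for Q A0
    proof -
      \<comment> \<open>\<open>L1\<close> keeps \<open>c\<close> off \<open>A0\<close>, and
        \<open>L2\<close> gives it the link \<open>S\<close> on the \<open>k\<close>-subsets of
        \<open>A0\<close>. Both are finite parts of \<open>P'\<close> and can be realized along with
        \<open>Q\<close>.\<close>
      define L1 where "L1 = (\<lambda>a. (Imp (Eq 0 1) Fls, \<lambda>_ :: nat. a)) ` A0"
      define L2 where "L2 = (\<lambda>Y. (if Y \<in> S then ?R else Imp ?R Fls, par Y)) ` {Y. Y \<subseteq> A0 \<and> card Y = k}"
      have "L1 \<subseteq> P'" using neq A0(2) by (auto simp: L1_def)
      moreover have "L2 \<subseteq> P'"
      proof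
        fix l assume "l \<in> L2"
        then obtain Y where Y: "Y \<subseteq> A0" "card Y = k" "l = (if Y \<in> S then ?R else Imp ?R Fls, par Y)"
          by (auto simp: L2_def)
        have YA: "Y \<subseteq> A" "finite Y" using Y(1) A0 finite_subset by auto
        show "l \<in> P'"
        proof (cases "Y \<in> S")
          case False
          then have "(?R, par Y) \<notin> P'" using YA Y(2) by (simp add: S_def)
          then have "(Imp ?R Fls, par Y) \<in> P'"
            using compl[of ?R "par Y"] R_ok[OF YA Y(2)] by blast
          then show ?thesis using Y(3) False by simp
        qed (use Y(3) in \<open>simp add: S_def\<close>)
      qed
      moreover have "finite L1" "finite L2" using A0(1) by (simp_all add: L1_def L2_def)
      ultimately obtain c where c: "realizes N c (Q \<union> L1 \<union> L2)"
        using fin_real[of "Q \<union> L1 \<union> L2"] Q by auto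
      have L1: "realizes N c L1" and L2: "realizes N c L2" and cQ: "realizes N c Q"
        using c by (auto intro: realizes_mono)
      have cA0: "c \<notin> A0"
      proof
        assume "c \<in> A0"
        then have "(Imp (Eq 0 1) Fls, \<lambda>_ :: nat. c) \<in> L1" by (simp add: L1_def)
        then show False using L1 by (auto simp: realizes_def)
      qed
      have "insert c Y \<in> edges N \<longleftrightarrow> Y \<in> S" if Y: "Y \<subseteq> A0" "card Y = k" for Y
      proof -
        have finY: "finite Y" using Y(1) A0(1) finite_subset by blast
        have "(if Y \<in> S then ?R else Imp ?R Fls, par Y) \<in> L2" using Y by (auto simp: L2_def)
        then have "sat N ((par Y)(0 := c)) (if Y \<in> S then ?R else Imp ?R Fls)"
          using L2 unfolding realizes_def by blast
        then have "Y \<in> S \<longleftrightarrow> sat N ((par Y)(0 := c)) ?R" by (auto split: if_splits)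
        also have "\<dots> \<longleftrightarrow> insert c Y \<in> edges N" using sat_R[OF finY Y(2)] cA0 Y(1) by blast
        finally show ?thesis by simp
      qed
      then show ?thesis using cQ cA0 by blast
    qed
    have adm: "admissible n k (edges N) A S"
      unfolding admissible_def
    proof (intro conjI ballI allI impI)
      fix W assume W: "W \<subseteq> A" "card W = n"
      have finW: "finite W" using W(2) k by (metis card.infinite le_zero_eq not_gr_zero)
      \<comment> \<open>\<open>S\<close> agrees on \<open>W\<close> with the link of an actual
        vertex \<open>c\<close>, and \<open>insert c W\<close> is not complete in
        \<open>N\<close>.\<close>
      obtain c where c: "realizes N c {}" "c \<notin> W"
        "\<And>Y. Y \<subseteq> W \<Longrightarrow> card Y = k \<Longrightarrow> insert c Y \<in> edges N \<longleftrightarrow> Y \<in> S"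
        using claim[OF _ _ finW W(1), of "{}"] by blast
      have "insert c W \<subseteq> univ N" "card (insert c W) = n + 1"
        using c(1,2) W A finW by (auto simp: realizes_def)
      then obtain Z where Z: "Z \<subseteq> insert c W" "card Z = k + 1" "Z \<notin> edges N"
        using hyp unfolding hgraph_def by metis
      show "(\<exists>Y\<subseteq>W. card Y = k \<and> Y \<notin> S) \<or> (\<exists>Z\<subseteq>W. card Z = k + 1 \<and> Z \<notin> edges N)"
      proof (cases "c \<in> Z")
        case True
        have X: "Z - {c} \<subseteq> W" "card (Z - {c}) = k" "insert c (Z - {c}) = Z"
          using Z(1,2) True by auto
        then show ?thesis using c(3)[OF X(1,2)] Z(3) by metis
      next
        case False
        then have "Z \<subseteq> W" using Z(1) by blast
        then show ?thesis using Z by blast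
      qed
    qed (auto simp: S_def)
    obtain x where "x \<in> univ N - A"
      "\<forall>Y\<subseteq>A. finite Y \<and> card Y = k \<longrightarrow> (insert x Y \<in> edges N \<longleftrightarrow> Y \<in> S)"
      using ext[OF A cA, unfolded extends_over_def, rule_format, OF adm] ..
    then have x: "x \<in> univ N" "x \<notin> A"
      "\<And>Y. Y \<subseteq> A \<Longrightarrow> finite Y \<Longrightarrow> card Y = k \<Longrightarrow> insert x Y \<in> edges N \<longleftrightarrow> Y \<in> S"
      by simp_all
    have "sat N (v(0 := x)) p" if pv: "(p, v) \<in> P" for p v
    proof -
      define A0 where "A0 = v ` (fv p - {0})"
      have "(p, v) \<in> P'" using pv PP' by blast
      then have "A0 \<subseteq> A" using ty unfolding is_type_over_def A0_def by blast
      moreover have "finite A0" using finite_fv by (simp add: A0_def)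
      ultimately have A0: "finite A0" "A0 \<subseteq> A" by simp_all
      obtain c where c: "realizes N c {(p, v)}" "c \<notin> A0"
        "\<And>Y. Y \<subseteq> A0 \<Longrightarrow> card Y = k \<Longrightarrow> insert c Y \<in> edges N \<longleftrightarrow> Y \<in> S"
        using claim[OF _ _ A0, of "{(p, v)}"] \<open>(p, v) \<in> P'\<close> by auto
      have id: "partial_iso N A0 id" using A0 A by (auto simp: partial_iso_def)
      \<comment> \<open>\<open>c\<close> and \<open>x\<close> have the same link over
        \<open>A0\<close>, so fixing \<open>A0\<close> and sending \<open>c\<close> to
        \<open>x\<close> is a partial isomorphism, which carries the truth of \<open>p\<close>
        over.\<close>
      have iso: "partial_iso N (insert c A0) (id(c := x))"
      proof (rule partial_iso_insert[OF hyp id])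
        show "c \<in> univ N - A0" using c(1,2) by (simp add: realizes_def)
        show "x \<in> univ N - id ` A0" using x(1,2) A0(2) by auto
        fix X assume X: "X \<subseteq> A0" "card X = k"
        have "insert x X \<in> edges N \<longleftrightarrow> X \<in> S"
          using X A0 finite_subset[OF X(1) A0(1)] by (intro x(3)) auto
        then show "insert x (id ` X) \<in> edges N \<longleftrightarrow> insert c X \<in> edges N" using c(3)[OF X] by simp
      qed
      have "sat N (v(0 := c)) p \<longleftrightarrow> sat N (id(c := x) \<circ> v(0 := c)) p"
        by (rule sat_partial_iso[OF N k _ iso]) (use ext_fin in \<open>auto simp: A0_def\<close>)
      also have "\<dots> \<longleftrightarrow> sat N (v(0 := x)) p"
        by (rule sat_cong) (use c(2) in \<open>auto simp: A0_def\<close>)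
      finally show ?thesis using c(1) by (simp add: realizes_def)
    qed
    then show ?thesis using x(1) by (intro exI[of _ x]) (auto simp: realizes_def)
  qed
  then show "\<exists>a\<in>univ N. \<forall>(p, v)\<in>P. sat N (v(0 := a)) p" unfolding realizes_def by blast
qed

section \<open>Ultrapowers of hypergraphs\<close>

locale hypergraph_ultrapower =
  fixes I :: "'i set" and D :: "'i set set" and M :: "'m rstruct" and n k :: nat
  assumes ultra: "ultrafilter_on I D" and HM: "hgraph_struct n k M"
begin

abbreviation "fs \<equiv> I \<rightarrow>\<^sub>E univ M"

definition "cls f = ultra_equiv I D M `` {f}"

abbreviation "N \<equiv> ultrapower I D M"

lemma filter: "filter_on I D"
  using ultra by (simp add: ultrafilter_on_def)

lemma D_mono: "A \<in> D \<Longrightarrow> A \<subseteq> B \<Longrightarrow> B \<subseteq> I \<Longrightarrow> B \<in> D"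
  using filter by (simp add: filter_on_def)

lemma D_Int: "A \<in> D \<Longrightarrow> B \<in> D \<Longrightarrow> A \<inter> B \<in> D"
  using filter by (simp add: filter_on_def)

lemma D_neg: "{t \<in> I. P t} \<notin> D \<Longrightarrow> {t \<in> I. \<not> P t} \<in> D"
proof -
  have "I - {t \<in> I. P t} = {t \<in> I. \<not> P t}" by blast
  moreover have "{t \<in> I. P t} \<in> D \<or> I - {t \<in> I. P t} \<in> D"
    using ultra by (simp add: ultrafilter_on_def)
  ultimately show "{t \<in> I. P t} \<notin> D \<Longrightarrow> ?thesis" by simp
qed

lemma D_ex: "{t \<in> I. P t} \<in> D \<Longrightarrow> \<exists>t\<in>I. P t"
  using filter unfolding filter_on_def by (metis (mono_tags, lifting) Collect_empty_eq)

lemma D_ex2: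
  assumes "{t \<in> I. P t} \<in> D" "{t \<in> I. Q t} \<in> D"
  shows "\<exists>t\<in>I. P t \<and> Q t"
proof -
  have "{t \<in> I. P t} \<inter> {t \<in> I. Q t} = {t \<in> I. P t \<and> Q t}" by blast
  then show ?thesis using D_Int[OF assms] D_ex by simp
qed

lemma cls_iff: "h \<in> cls f \<longleftrightarrow> f \<in> fs \<and> h \<in> fs \<and> {t \<in> I. f t = h t} \<in> D"
  by (simp add: cls_def ultra_equiv_def)

lemma cls_eq:
  assumes "f \<in> fs" "g \<in> fs"
  shows "cls f = cls g \<longleftrightarrow> {t \<in> I. f t = g t} \<in> D"
proof
  assume "cls f = cls g"
  moreover have "g \<in> cls g" using assms filter by (simp add: cls_iff filter_on_def)
  ultimately show "{t \<in> I. f t = g t} \<in> D" using cls_iff by blast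
next
  assume fg: "{t \<in> I. f t = g t} \<in> D"
  have "{t \<in> I. f t = h t} \<in> D \<longleftrightarrow> {t \<in> I. g t = h t} \<in> D" for h
  proof
    assume "{t \<in> I. f t = h t} \<in> D"
    from D_Int[OF fg this] show "{t \<in> I. g t = h t} \<in> D" by (rule D_mono) auto
  next
    assume "{t \<in> I. g t = h t} \<in> D"
    from D_Int[OF fg this] show "{t \<in> I. f t = h t} \<in> D" by (rule D_mono) auto
  qed
  then show "cls f = cls g" using assms by (auto simp: cls_iff)
qed

lemma univ_N: "univ N = cls ` fs"
  by (auto simp: ultrapower_def quotient_def cls_def)

lemma relM: "xs \<in> rel M \<longleftrightarrow> distinct xs \<and> set xs \<in> edges M"
  using HM by (simp add: hgraph_struct_def)

lemma edgeM: "e \<in> edges M \<Longrightarrow> e \<subseteq> univ M \<and> finite e \<and> card e = k + 1"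
  using HM by (simp add: hgraph_struct_def hgraph_def)

text \<open>The theorem of Los for the relation symbol. The forward direction is independence of
  representatives: finitely many entries agree on a common set in \<open>D\<close>.\<close>

lemma rel_N:
  assumes "set xs \<subseteq> fs"
  shows "map cls xs \<in> rel N \<longleftrightarrow> {t \<in> I. map (\<lambda>f. f t) xs \<in> rel M} \<in> D"
proof
  assume "map cls xs \<in> rel N"
  then obtain ys where ys: "map cls xs = map cls ys" "set ys \<subseteq> fs"
    "{t \<in> I. map (\<lambda>f. f t) ys \<in> rel M} \<in> D"
    by (auto simp: ultrapower_def cls_def[abs_def])
  have len: "length xs = length ys" using ys(1) by (rule map_eq_imp_length_eq)
  have "{t \<in> I. \<forall>a\<in>{..<length xs}. (xs ! a) t = (ys ! a) t} \<in> D"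
  proof (rule filter_on_Ball[OF filter])
    fix a assume a: "a \<in> {..<length xs}"
    have "cls (xs ! a) = cls (ys ! a)" using ys(1) a len by (metis lessThan_iff nth_map)
    moreover have "xs ! a \<in> fs" "ys ! a \<in> fs"
      using a len nth_mem[of a xs] nth_mem[of a ys] subsetD[OF assms] subsetD[OF ys(2)] by simp_all
    ultimately show "{t \<in> I. (xs ! a) t = (ys ! a) t} \<in> D" using cls_eq by blast
  qed simp
  from D_Int[OF this ys(3)] show "{t \<in> I. map (\<lambda>f. f t) xs \<in> rel M} \<in> D"
  proof (rule D_mono)
    show "{t \<in> I. \<forall>a\<in>{..<length xs}. (xs ! a) t = (ys ! a) t} \<inter> {t \<in> I. map (\<lambda>f. f t) ys \<in> rel M}
        \<subseteq> {t \<in> I. map (\<lambda>f. f t) xs \<in> rel M}"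
    proof
      fix t assume t: "t \<in> {t \<in> I. \<forall>a\<in>{..<length xs}. (xs ! a) t = (ys ! a) t} \<inter> {t \<in> I. map (\<lambda>f. f t) ys \<in> rel M}"
      then have "map (\<lambda>f. f t) xs = map (\<lambda>f. f t) ys"
        using len by (intro nth_equalityI) auto
      then show "t \<in> {t \<in> I. map (\<lambda>f. f t) xs \<in> rel M}" using t by simp
    qed
  qed blast
next
  assume "{t \<in> I. map (\<lambda>f. f t) xs \<in> rel M} \<in> D"
  then show "map cls xs \<in> rel N" using assms by (auto simp: ultrapower_def cls_def[abs_def])
qed

lemma rel_N_cases:
  assumes "ys \<in> rel N"
  obtains xs where "ys = map cls xs" "set xs \<subseteq> fs" "{t \<in> I. map (\<lambda>f. f t) xs \<in> rel M} \<in> D"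
proof -
  obtain xs where "ys = map cls xs" "set xs \<subseteq> fs"
    using assms by (auto simp: ultrapower_def cls_def[abs_def])
  then show thesis using that rel_N assms by blast
qed

lemma rel_N_distinct:
  assumes "ys \<in> rel N"
  shows "distinct ys" "length ys = k + 1" "set ys \<subseteq> univ N"
proof -
  obtain xs where xs: "ys = map cls xs" "set xs \<subseteq> fs" "{t \<in> I. map (\<lambda>f. f t) xs \<in> rel M} \<in> D"
    using rel_N_cases[OF assms] .
  show "set ys \<subseteq> univ N" using xs(1,2) by (auto simp: univ_N)
  obtain t where "t \<in> I" "map (\<lambda>f. f t) xs \<in> rel M" using D_ex[OF xs(3)] by blast
  then show "length ys = k + 1"
    using relM edgeM xs(1) distinct_card by (metis length_map)
  have "ys ! a \<noteq> ys ! b" if ab: "a < length ys" "b < length ys" "a \<noteq> b" for a b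
  proof
    assume "ys ! a = ys ! b"
    then have "cls (xs ! a) = cls (xs ! b)" using ab xs(1) by simp
    moreover have "xs ! a \<in> fs" "xs ! b \<in> fs"
      using ab xs(1) nth_mem[of a xs] nth_mem[of b xs] subsetD[OF xs(2)] by simp_all
    ultimately have "{t \<in> I. (xs ! a) t = (xs ! b) t} \<in> D" using cls_eq by blast
    from D_ex2[OF this xs(3)] obtain t where
      t: "(xs ! a) t = (xs ! b) t" "distinct (map (\<lambda>f. f t) xs)" using relM by blast
    then show False using ab xs(1) nth_eq_iff_index_eq[OF t(2), of a b] by simp
  qed
  then show "distinct ys" by (simp add: distinct_conv_nth)
qed

text \<open>Symmetry is inherited because one and the same permutation of positions is applied at
  all indices, where \<open>M\<close> is symmetric.\<close>

lemma rel_N_iff: "ys \<in> rel N \<longleftrightarrow> distinct ys \<and> set ys \<in> edges N"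
proof
  assume "ys \<in> rel N"
  then show "distinct ys \<and> set ys \<in> edges N" using rel_N_distinct by (auto simp: edges_def)
next
  assume ys: "distinct ys \<and> set ys \<in> edges N"
  then obtain zs where zs: "zs \<in> rel N" "set ys = set zs" by (auto simp: edges_def)
  obtain xs where xs: "zs = map cls xs" "set xs \<subseteq> fs" "{t \<in> I. map (\<lambda>f. f t) xs \<in> rel M} \<in> D"
    using rel_N_cases[OF zs(1)] .
  obtain ps where ps: "distinct ps" "set ps = {0..<length zs}" "ys = map ((!) zs) ps"
    using Rel_perm[of ys zs "length zs"] ys zs rel_N_distinct(1) by blast
  have len: "length xs = length zs" using xs(1) by simp
  have ys_eq: "ys = map cls (map ((!) xs) ps)"
    unfolding ps(3) map_map
  proof (rule map_cong[OF refl])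
    fix i assume "i \<in> set ps"
    then have "i < length xs" using ps(2) len by simp
    then show "zs ! i = (cls \<circ> (!) xs) i" by (simp add: xs(1))
  qed
  have "set (map ((!) xs) ps) \<subseteq> set xs" using ps(2) len by auto
  then have sub: "set (map ((!) xs) ps) \<subseteq> fs" using xs(2) by (rule subset_trans)
  have "{t \<in> I. map (\<lambda>f. f t) (map ((!) xs) ps) \<in> rel M} \<in> D"
  proof (rule D_mono[OF xs(3)])
    show "{t \<in> I. map (\<lambda>f. f t) xs \<in> rel M} \<subseteq> {t \<in> I. map (\<lambda>f. f t) (map ((!) xs) ps) \<in> rel M}"
    proof
      fix t assume t: "t \<in> {t \<in> I. map (\<lambda>f. f t) xs \<in> rel M}"
      define ws where "ws = map (\<lambda>f. f t) xs"
      have ws: "distinct ws" "set ws \<in> edges M" "length ws = length zs"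
        using t relM len by (simp_all add: ws_def)
      have eq: "map (\<lambda>f. f t) (map ((!) xs) ps) = map ((!) ws) ps"
        using ps(2) len by (auto simp: ws_def)
      have "inj_on ((!) ws) (set ps)" using ws ps(2) by (intro inj_on_nth) auto
      then have "distinct (map ((!) ws) ps)" using ps(1) by (simp add: distinct_map)
      moreover have "set (map ((!) ws) ps) = set ws"
        using ps(2) ws(3) nth_image[of "length ws" ws] by simp
      ultimately show "t \<in> {t \<in> I. map (\<lambda>f. f t) (map ((!) xs) ps) \<in> rel M}"
        using t ws(2) unfolding mem_Collect_eq eq relM by simp
    qed
  qed blast
  then show "ys \<in> rel N" using rel_N[OF sub] ys_eq by simp
qed

text \<open>In \<open>N\<close> distinctness is assumed. In \<open>M\<close> it comes for free: an
  edge has \<open>k + 1\<close> elements, so the values cannot collide at an index where they form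
  one.\<close>

lemma edge_N_iff:
  assumes z: "finite z" "card z = k + 1" and f: "\<And>i. i \<in> z \<Longrightarrow> f i \<in> fs"
    and inj: "inj_on (\<lambda>i. cls (f i)) z"
  shows "(\<lambda>i. cls (f i)) ` z \<in> edges N \<longleftrightarrow> {t \<in> I. (\<lambda>i. f i t) ` z \<in> edges M} \<in> D"
proof -
  obtain zs where zs: "set zs = z" "distinct zs" using z(1) finite_distinct_list by blast
  have sub: "set (map f zs) \<subseteq> fs" using f zs by auto
  have "distinct (map cls (map f zs))" using inj zs by (simp add: distinct_map comp_def)
  then have "(\<lambda>i. cls (f i)) ` z \<in> edges N \<longleftrightarrow> map cls (map f zs) \<in> rel N"
    unfolding rel_N_iff using zs by (simp add: image_image)
  also have "\<dots> \<longleftrightarrow> {t \<in> I. map (\<lambda>f. f t) (map f zs) \<in> rel M} \<in> D" by (rule rel_N[OF sub])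
  also have "{t \<in> I. map (\<lambda>f. f t) (map f zs) \<in> rel M} = {t \<in> I. (\<lambda>i. f i t) ` z \<in> edges M}"
  proof (intro Collect_cong conj_cong refl)
    fix t
    show "map (\<lambda>f. f t) (map f zs) \<in> rel M \<longleftrightarrow> (\<lambda>i. f i t) ` z \<in> edges M"
    proof
      assume e: "(\<lambda>i. f i t) ` z \<in> edges M"
      then have "inj_on (\<lambda>i. f i t) z" using edgeM z by (intro eq_card_imp_inj_on) auto
      then show "map (\<lambda>f. f t) (map f zs) \<in> rel M"
        unfolding relM using e zs by (simp add: distinct_map comp_def image_image)
    qed (use zs in \<open>simp add: relM image_image\<close>)
  qed
  finally show ?thesis .
qed

lemma representatives: "\<exists>f. \<forall>w\<in>univ N. f w \<in> fs \<and> cls (f w) = w"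
  unfolding univ_N by (rule exI[of _ "inv_into fs cls"]) (simp add: inv_into_into f_inv_into_f)

text \<open>Finitely many edges and inequalities hold together at one index, where a complete
  hypergraph in \<open>N\<close> would show up in \<open>M\<close>.\<close>

lemma N_no_complete:
  assumes W: "W \<subseteq> univ N" "card W = n + 1"
  shows "\<exists>Z\<subseteq>W. card Z = k + 1 \<and> Z \<notin> edges N"
proof (rule ccontr)
  assume neg: "\<not> ?thesis"
  obtain f where f0: "\<forall>w\<in>univ N. f w \<in> fs \<and> cls (f w) = w" using representatives ..
  have f: "f w \<in> fs \<and> cls (f w) = w" if "w \<in> W" for w using f0 W(1) that by blast
  have fin: "finite W" using W(2) by (metis add_is_0 card.infinite one_neq_zero)
  have cls_id: "(\<lambda>w. cls (f w)) ` Z = Z" "inj_on (\<lambda>w. cls (f w)) Z" if "Z \<subseteq> W" for Z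
    using that f by (force, auto simp: inj_on_def subset_iff)
  have 1: "{t \<in> I. \<forall>Z\<in>{Z. Z \<subseteq> W \<and> card Z = k + 1}. (\<lambda>w. f w t) ` Z \<in> edges M} \<in> D"
  proof (rule filter_on_Ball[OF filter])
    show "finite {Z. Z \<subseteq> W \<and> card Z = k + 1}" using fin by simp
    fix Z assume Z: "Z \<in> {Z. Z \<subseteq> W \<and> card Z = k + 1}"
    then have "(\<lambda>w. cls (f w)) ` Z \<in> edges N" using neg cls_id(1)[of Z] by auto
    then show "{t \<in> I. (\<lambda>w. f w t) ` Z \<in> edges M} \<in> D"
      using edge_N_iff[of Z f] Z f cls_id(2)[of Z] finite_subset[OF _ fin] by blast
  qed
  have 2: "{t \<in> I. \<forall>p\<in>{(w, w'). (w, w') \<in> W \<times> W \<and> w \<noteq> w'}. f (fst p) t \<noteq> f (snd p) t} \<in> D"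
  proof (rule filter_on_Ball[OF filter])
    show "finite {(w, w'). (w, w') \<in> W \<times> W \<and> w \<noteq> w'}"
      by (rule finite_subset[of _ "W \<times> W"]) (use fin in auto)
    fix p assume "p \<in> {(w, w'). (w, w') \<in> W \<times> W \<and> w \<noteq> w'}"
    then have p: "fst p \<in> W" "snd p \<in> W" "fst p \<noteq> snd p" by auto
    then have "{t \<in> I. f (fst p) t = f (snd p) t} \<notin> D" using f cls_eq by metis
    then show "{t \<in> I. f (fst p) t \<noteq> f (snd p) t} \<in> D" by (rule D_neg)
  qed
  obtain t where t: "t \<in> I" "\<And>Z. Z \<subseteq> W \<Longrightarrow> card Z = k + 1 \<Longrightarrow> (\<lambda>w. f w t) ` Z \<in> edges M"
    "\<And>w w'. w \<in> W \<Longrightarrow> w' \<in> W \<Longrightarrow> w \<noteq> w' \<Longrightarrow> f w t \<noteq> f w' t"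
    using D_ex2[OF 1 2] by auto
  have inj: "inj_on (\<lambda>w. f w t) W" using t(3) by (auto simp: inj_on_def)
  have "(\<lambda>w. f w t) ` W \<subseteq> univ M" using f t(1) by (auto simp: PiE_def Pi_def)
  moreover have "card ((\<lambda>w. f w t) ` W) = n + 1" using card_image[OF inj] W(2) by simp
  ultimately obtain Z where Z: "Z \<subseteq> (\<lambda>w. f w t) ` W" "card Z = k + 1" "Z \<notin> edges M"
    using HM unfolding hgraph_struct_def hgraph_def by metis
  obtain Z' where Z': "Z' \<subseteq> W" "Z = (\<lambda>w. f w t) ` Z'" using Z(1) by (metis subset_imageE)
  have "card Z' = k + 1" using Z(2) Z' card_image[OF inj_on_subset[OF inj Z'(1)]] by simp
  then show False using t(2)[OF Z'(1)] Z(3) Z'(2) by simp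
qed

lemma hgraph_struct_N: "hgraph_struct n k N"
proof -
  have ne: "univ N \<noteq> {}"
  proof -
    obtain a where "a \<in> univ M" using HM by (auto simp: hgraph_struct_def is_rstruct_def)
    then have "(\<lambda>t\<in>I. a) \<in> fs" by auto
    then have "cls (\<lambda>t\<in>I. a) \<in> univ N" unfolding univ_N by (rule imageI)
    then show ?thesis by blast
  qed
  then have "is_rstruct (k + 1) N"
    using rel_N_distinct by (auto simp: is_rstruct_def)
  moreover have "e \<subseteq> univ N \<and> finite e \<and> card e = k + 1" if "e \<in> edges N" for e
    using that rel_N_distinct distinct_card unfolding edges_def by (metis List.finite_set imageE)
  ultimately show ?thesis
    using rel_N_iff N_no_complete by (simp add: hgraph_struct_def hgraph_def)
qed

text \<open>Carries the extension property from finite sets in \<open>M\<close> to sets of size at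
  most \<lambda> in \<open>N\<close>: the parameters receive indices in \<open>'l\<close> and
  representatives \<open>f i\<close>, and the function supplied by \<open>perfected_realizes\<close>
  becomes the new vertex.\<close>

lemma extends_over_N:
  fixes A :: "('i \<Rightarrow> 'm) set set"
  assumes k: "0 < k" "k \<le> n"
    and inf: "infinite (UNIV :: 'l set)" and infc: "infinite (UNIV :: 'c set)"
    and lc: "|UNIV :: 'c set| \<le>o |UNIV :: 'l set|"
    and Pr: "Pr n k TYPE('l) TYPE('c)"
    and perfected: "perfected TYPE('l) TYPE('c) I D"
    and ext: "\<And>X. finite X \<Longrightarrow> X \<subseteq> univ M \<Longrightarrow> extends_over n k (univ M) (edges M) X"
    and A: "A \<subseteq> univ N" "|A| \<le>o |UNIV :: 'l set|"
  shows "extends_over n k (univ N) (edges N) A"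
  unfolding extends_over_def
proof (intro allI impI)
  fix S0 assume S0: "admissible n k (edges N) A S0"
  obtain e :: "('i \<Rightarrow> 'm) set \<Rightarrow> 'l" where e: "inj_on e A"
    using A(2) card_of_ordLeq[of A "UNIV :: 'l set"] by blast
  define J where "J = e ` A"
  define \<alpha> where "\<alpha> = inv_into A e"
  have \<alpha>: "inj_on \<alpha> J" "\<alpha> ` J = A"
    unfolding \<alpha>_def J_def using inv_into_image_cancel[OF e subset_refl] by (simp_all add: inj_on_inv_into)
  obtain rp where rp: "\<forall>w\<in>univ N. rp w \<in> fs \<and> cls (rp w) = w" using representatives ..
  define f where "f i = rp (\<alpha> i)" for i
  have f: "f i \<in> fs" "cls (f i) = \<alpha> i" if "i \<in> J" for i
  proof -
    have "\<alpha> i \<in> univ N" using that \<alpha>(2) A(1) by blast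
    then show "f i \<in> fs" "cls (f i) = \<alpha> i" using rp by (simp_all add: f_def)
  qed
  define S where "S = {v. v \<subseteq> J \<and> \<alpha> ` v \<in> S0}"
  have preimage: "\<exists>v\<subseteq>w. Y = \<alpha> ` v \<and> card v = card Y" if "Y \<subseteq> \<alpha> ` w" "w \<subseteq> J" for Y w
  proof -
    obtain v where v: "v \<subseteq> w" "Y = \<alpha> ` v" using \<open>Y \<subseteq> \<alpha> ` w\<close> by (metis subset_imageE)
    then have "v \<subseteq> J" using \<open>w \<subseteq> J\<close> by blast
    then have "card Y = card v" using v(2) card_image[OF inj_on_subset[OF \<alpha>(1)]] by simp
    then show ?thesis using v by auto
  qed
  have "\<exists>x. (\<forall>t\<in>I. x t \<in> univ M) \<and>
      (\<forall>v. finite v \<and> v \<subseteq> J \<longrightarrow> {t \<in> I. link_at f (edges M) k S v (x t) t} \<in> D)"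
  proof (rule perfected_realizes[OF k inf infc lc Pr perfected _ _ ext])
    show "univ M \<noteq> {}" using HM by (simp add: hgraph_struct_def is_rstruct_def)
    show "hgraph n k (univ M) (edges M)" using HM by (simp add: hgraph_struct_def)
    show "f i t \<in> univ M" if "i \<in> J" "t \<in> I" for i t using f(1)[OF that(1)] that(2) by auto
    show "{t \<in> I. f i t = f i' t} \<notin> D" if "i \<in> J" "i' \<in> J" "i \<noteq> i'" for i i'
      using cls_eq[OF f(1)[OF that(1)] f(1)[OF that(2)]] f(2) that inj_onD[OF \<alpha>(1)] by metis
    fix w assume w: "w \<subseteq> J" "card w = n"
    have "\<alpha> ` w \<subseteq> A" "card (\<alpha> ` w) = n"
      using w \<alpha>(2) card_image[OF inj_on_subset[OF \<alpha>(1) w(1)]] by auto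
    then consider Y where "Y \<subseteq> \<alpha> ` w" "card Y = k" "Y \<notin> S0"
      | Z where "Z \<subseteq> \<alpha> ` w" "card Z = k + 1" "Z \<notin> edges N"
      using S0 unfolding admissible_def by metis
    then show "(\<exists>v\<subseteq>w. card v = k \<and> v \<notin> S) \<or>
        (\<exists>z\<subseteq>w. card z = k + 1 \<and> {t \<in> I. (\<lambda>i. f i t) ` z \<in> edges M} \<notin> D)"
    proof cases
      case (1 Y)
      then obtain v where "v \<subseteq> w" "Y = \<alpha> ` v" "card v = k" using preimage[OF 1(1) w(1)] by auto
      then show ?thesis using 1(3) by (auto simp: S_def)
    next
      case (2 Z)
      then obtain z where z: "z \<subseteq> w" "Z = \<alpha> ` z" "card z = k + 1"
        using preimage[OF 2(1) w(1)] by auto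
      have zJ: "z \<subseteq> J" using z(1) w(1) by blast
      have eq: "(\<lambda>i. cls (f i)) ` z = Z" using z(2) zJ f(2) by (auto simp: subset_iff)
      have inj: "inj_on (\<lambda>i. cls (f i)) z"
        using inj_on_subset[OF \<alpha>(1) zJ] zJ f(2) by (auto simp: inj_on_def subset_iff)
      have "finite z" using z(3) by (metis add_is_0 card.infinite one_neq_zero)
      then have "{t \<in> I. (\<lambda>i. f i t) ` z \<in> edges M} \<notin> D"
        using edge_N_iff[OF _ z(3) _ inj] f(1) zJ 2(3) unfolding eq by blast
      then show ?thesis using z by blast
    qed
  qed
  then obtain x where x: "\<And>t. t \<in> I \<Longrightarrow> x t \<in> univ M"
    "\<And>v. finite v \<Longrightarrow> v \<subseteq> J \<Longrightarrow> {t \<in> I. link_at f (edges M) k S v (x t) t} \<in> D"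
    by blast
  define \<xi> where "\<xi> = restrict x I"
  have \<xi>: "\<xi> \<in> fs" using x(1) by (auto simp: \<xi>_def)
  have notA: "cls \<xi> \<notin> A"
  proof
    assume "cls \<xi> \<in> A"
    then obtain i where i: "i \<in> J" "cls \<xi> = \<alpha> i" using \<alpha>(2) by (metis imageE)
    then have "{t \<in> I. \<xi> t = f i t} \<in> D" using cls_eq[OF \<xi> f(1)[OF i(1)]] f(2) by simp
    \<comment> \<open>The requirement for the singleton \<open>{i}\<close> keeps \<open>x\<close>
      away from \<open>f i\<close>.\<close>
    moreover have "{t \<in> I. link_at f (edges M) k S {i} (x t) t} \<in> D" using x(2) i(1) by simp
    ultimately have "\<exists>t\<in>I. \<xi> t = f i t \<and> link_at f (edges M) k S {i} (x t) t"
      by (rule D_ex2)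
    then obtain t where "t \<in> I" "\<xi> t = f i t" "link_at f (edges M) k S {i} (x t) t" by blast
    then show False by (simp add: \<xi>_def link_at_def)
  qed
  have "insert (cls \<xi>) Y \<in> edges N \<longleftrightarrow> Y \<in> S0" if Y: "Y \<subseteq> A" "card Y = k" for Y
  proof -
    obtain v where v: "v \<subseteq> J" "Y = \<alpha> ` v" "card v = k"
      using preimage[of Y J] Y \<alpha>(2) by auto
    have finv: "finite v" using v(3) k(1) by (metis card.infinite less_irrefl)
    \<comment> \<open>\<open>None\<close> stands for the new vertex, so that
      \<open>edge_N_iff\<close> treats all \<open>k + 1\<close> members of \<open>z\<close>
      uniformly.\<close>
    define f' where "f' = case_option \<xi> f"
    define z where "z = insert None (Some ` v)"
    have z: "finite z" "card z = k + 1"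
      using finv v(3) by (simp_all add: z_def card_image)
    have f': "f' i \<in> fs" if "i \<in> z" for i
    proof (cases i)
      case None
      then show ?thesis using \<xi> by (simp only: f'_def option.case)
    next
      case (Some l)
      then have "l \<in> J" using that v(1) by (auto simp: z_def)
      then show ?thesis using f(1) Some by (simp only: f'_def option.case)
    qed
    have img: "(\<lambda>i. cls (f' i)) ` z = insert (cls \<xi>) Y"
      using v f(2) by (auto simp: z_def f'_def image_image subset_iff)
    have "card (insert (cls \<xi>) Y) = card z"
    proof -
      have "finite Y" using finv v(2) by simp
      moreover have "cls \<xi> \<notin> Y" using notA Y(1) by blast
      ultimately show ?thesis using Y(2) z(2) by simp
    qed
    then have inj: "inj_on (\<lambda>i. cls (f' i)) z"
      using img z(1) by (intro eq_card_imp_inj_on) simp_all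
    have "insert (cls \<xi>) Y \<in> edges N \<longleftrightarrow> {t \<in> I. (\<lambda>i. f' i t) ` z \<in> edges M} \<in> D"
      using edge_N_iff[OF z f' inj] img by simp
    also have "{t \<in> I. (\<lambda>i. f' i t) ` z \<in> edges M} =
        {t \<in> I. insert (x t) ((\<lambda>i. f i t) ` v) \<in> edges M}"
      by (auto simp: z_def f'_def \<xi>_def image_image)
    also have "\<dots> \<in> D \<longleftrightarrow> v \<in> S"
    proof
      assume "{t \<in> I. insert (x t) ((\<lambda>i. f i t) ` v) \<in> edges M} \<in> D"
      from D_ex2[OF this x(2)[OF finv v(1)]] show "v \<in> S" using v(3) by (auto simp: link_at_def)
    next
      assume "v \<in> S"
      then show "{t \<in> I. insert (x t) ((\<lambda>i. f i t) ` v) \<in> edges M} \<in> D"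
        by (intro D_mono[OF x(2)[OF finv v(1)]]) (use v(3) in \<open>auto simp: link_at_def\<close>)
    qed
    also have "\<dots> \<longleftrightarrow> Y \<in> S0" using v by (simp add: S_def)
    finally show ?thesis .
  qed
  moreover have "cls \<xi> \<in> univ N - A" using \<xi> notA by (simp add: univ_N)
  ultimately show "\<exists>x\<in>univ N - A. \<forall>Y\<subseteq>A. finite Y \<and> card Y = k \<longrightarrow> (insert x Y \<in> edges N \<longleftrightarrow> Y \<in> S0)"
    by blast
qed

end

theorem theorem4p1:
  fixes n k :: nat and T :: "fm set" and I :: "'i set" and D :: "'i set set"
  assumes "2 \<le> k" and "k < n"
    and "infinite (UNIV :: 'c set)" and "infinite (UNIV :: 'l set)"
    and "|UNIV :: 'c set| <o |UNIV :: 'l set|"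
    and "Pr n k TYPE('l) TYPE('c)"
    and "infinite (UNIV :: 'u set)"
    and "model_completion TYPE('u) (k + 1) T (hypergraph_theory n k)"
    and "perfected TYPE('l) TYPE('c) I D"
  shows "\<forall>M :: 'm rstruct. models (k + 1) M T \<longrightarrow>
           saturated (k + 1) (cardSuc |UNIV :: 'l set| ) (ultrapower I D M)"
proof (intro allI impI)
  fix M :: "'m rstruct" assume M: "models (k + 1) M T"
  have k: "0 < k" "k \<le> n" using assms(1,2) by simp_all
  have HM: "hgraph_struct n k M" by (rule models_completion_hgraph_struct[OF assms(8,7) M])
  have "ultrafilter_on I D" using assms(9) by (simp add: perfected_def)
  then interpret hypergraph_ultrapower I D M n k using HM by unfold_locales
  have ext: "extends_over n k (univ M) (edges M) X" if "finite X" "X \<subseteq> univ M" for X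
    by (rule models_completion_extends[OF assms(8,7) M k that])
  show "saturated (k + 1) (cardSuc |UNIV :: 'l set| ) (ultrapower I D M)"
  proof (rule saturated_of_extends_over[OF hgraph_struct_N k assms(4)])
    fix A assume A: "A \<subseteq> univ N" "|A| \<le>o |UNIV :: 'l set|"
    show "extends_over n k (univ N) (edges N) A"
      by (rule extends_over_N[OF k assms(4,3) ordLess_imp_ordLeq[OF assms(5)] assms(6,9) ext A])
  qed
qed

end
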